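(* Let $A\subseteq\mathbb{R}^n$, $h$, $g=\nabla h$, the constants $C,D,m>0$, and the smooth function $f$ on $A\times\mathbb{T}^n$ with $\mathcal{R}(f)$ dense in $A$ be as in the context, and let $G^T$, $F^{\mu}$, $F^{\mu,\nu}$ (for $T,\mu,\nu>0$), $\bar f$ and the norm $|\cdot|^1$ be as defined there. (1) The functions $G^T$ (as $T\to+\infty$) and $F^{\mu}$ (as $\mu\to0^+$) do not converge to $\bar f$ in the norm $|\cdot|^1$ on any set $B\times\mathbb{T}^n$ with $B\subseteq A$ open and nonempty. (2) Differently, for any $\mu,\nu>0$ the function $F^{\mu,\nu}$ satisfies, on $A\times\mathbb{T}^n$, $$|F^{\mu,\nu}-\bar f|^1\le\frac{2C^{n-1}}{m}\sum_{k\in\mathbb{Z}^n\setminus 0}\Bigg(\mu\Big[1+\log\frac{\|k\|C}{\mu+\nu\|k\|^2}\Big]\Big((1+n)|f_k|^\infty+\sum_{j=1}^n\Big|\frac{\partial f_k}{\partial I_j}\Big|^\infty\Big)+\frac12 n^2\pi D\,\frac{\mu}{\mu+\nu\|k\|^2}\,|f_k|^\infty\Bigg).$$ (3) In particular, for any sequences $\mu_i,\nu_i>0$ converging to zero and such that $\lim_{i\to+\infty}\frac{\mu_i}{\nu_i}=0$, $$\lim_{i\to+\infty}|F^{\mu_i,\nu_i}-\bar f|^1=0.$$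
   Context: Setting. $A\subseteq\mathbb{R}^n$ is open and bounded, $\mathbb{T}^n=(\mathbb{R}/2\pi\mathbb{Z})^n$, $h$ is a function on $A$ (the Hamiltonian $H(I,\varphi)=h(I)$ of an integrable system on $A\times\mathbb{T}^n$) and $g(I):=\nabla h(I)$ is a diffeomorphism over $A$ such that for all $I\in A$ $$|g(I)|\le C,\qquad \max_{i,j}\left|\frac{\partial g_i}{\partial I_j}(I)\right|\le D,\qquad \left|\det\frac{\partial g}{\partial I}(I)\right|\ge m,$$ with constants $C,D,m>0$; moreover $g$ is Lipschitz on $A$ (with some constant $\lambda>0$). $|g(I)|$ and $\|k\|$ denote Euclidean norms. The function. $f$ is a smooth function on $A\times\mathbb{T}^n$, with Fourier expansion $f(I,\varphi)=\sum_{k\in\mathbb{Z}^n}f_k(I)e^{ik\cdot\varphi}$. Put $\mathcal{R}_k(f)=\{I\in A: k\cdot g(I)=0 \text{ and } |f_k(I)|>0\}$ and $\mathcal{R}(f)=\bigcup_{k\in\mathbb{Z}^n\setminus 0}\mathcal{R}_k(f)$. It is assumed that $\mathcal{R}(f)$ is dense in $A$. For a function $v$ on $A$ (such as $f_k$ or $\partial f_k/\partial I_j$) write $|v|^\infty=\sup_{I\in A}|v(I)|$. Averages. Let $\phi^t(I,\varphi)=(I,\varphi+g(I)t)$. For $T>0$, $$G^T(I,\varphi)=\frac1T\int_0^T f(\phi^t(I,\varphi))\,dt,\qquad \bar f(I,\varphi)=\lim_{T\to+\infty}G^T(I,\varphi);$$ the Fourier coefficients of $\bar f$ are $\bar f_k(I)=f_k(I)$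 if $k\cdot g(I)=0$ and $\bar f_k(I)=0$ otherwise. For $\mu>0$, $$F^\mu(I,\varphi)=\mu\int_0^{+\infty}f(\phi^t(I,\varphi))e^{-\mu t}\,dt.$$ Let $w_t$ be an $n$-dimensional Wiener process on a probability space $(\Omega,\mathcal{F},P)$ (with covariance matrix $t\,\delta_{ij}$), and let $\Phi^t_\nu(I,\varphi,\omega)=(I,\varphi+g(I)t+2\nu\,w_t(\omega))$ be the flow of the stochastic differential equation $\dot I_t=0$, $\dot\varphi_t=g(I)+2\nu\,\dot w_t$. For $\mu,\nu>0$, $$F^{\mu,\nu}(I,\varphi)=\mu\int_\Omega\left(\int_0^{+\infty}f(\Phi^t_\nu(I,\varphi,\omega))e^{-\mu t}\,dt\right)P(d\omega).$$ Norm. For $u(I,\varphi)=\sum_{k\in\mathbb{Z}^n}u_k(I)e^{ik\cdot\varphi}$ on $A\times\mathbb{T}^n$, $$|u|^1=\sum_{k\in\mathbb{Z}^n}\int_A|u_k(I)|\,dI+\sum_{k\in\mathbb{Z}^n}\sum_{j=1}^n\int_A\left(\left|\frac{\partial u_k}{\partial I_j}(I)\right|+|k_j u_k(I)|\right)dI;$$ on $B\times\mathbb{T}^n$ with $B\subseteq A$ open, replace $A$ by $B$. The integrals are taken off the measure-zero set of resonances $\bigcup_{k\in\mathbb{Z}^n\setminus 0}\{I\in A: k\cdot g(I)=0\}$, where $\bar f_k$ and its derivatives are $0$ for $k\ne0$ and $\bar f_0=f_0$.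
   Formalization: Corrected: the noise is √(2ν) w_t instead of 2ν w_t; the constant in (2) is 2ω_{n-1}C^{n-1}/m with ω_d the volume of the unit d-ball; log is replaced by max(0, log); (3) assumes Σ_{k≠0}(|f_k|^∞+Σ_j|∂f_k/∂I_j|^∞) < ∞. *)

theory Defs
  imports "HOL-Probability.Probability"
begin

(* Meant for open S, where the derivatives taken "at x" depend on f only through its
   values on S. *)
primrec Ck_on :: "nat \<Rightarrow> 'a::euclidean_space set \<Rightarrow> ('a \<Rightarrow> 'b::real_normed_vector) \<Rightarrow> bool" where
  "Ck_on 0 S f \<longleftrightarrow> continuous_on S f"
| "Ck_on (Suc k) S f \<longleftrightarrow>
     (\<forall>x\<in>S. f differentiable (at x)) \<and>
     (\<forall>b\<in>Basis. Ck_on k S (\<lambda>x. frechet_derivative f (at x) b))"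

definition smooth_on :: "'a::euclidean_space set \<Rightarrow> ('a \<Rightarrow> 'b::real_normed_vector) \<Rightarrow> bool" where
  "smooth_on S f \<longleftrightarrow> (\<forall>k. Ck_on k S f)"

definition diffeomorphism_on ::
    "'a::euclidean_space set \<Rightarrow> ('a \<Rightarrow> 'b::euclidean_space) \<Rightarrow> bool" where
  "diffeomorphism_on S g \<longleftrightarrow>
     inj_on g S \<and> open (g ` S) \<and> Ck_on 1 S g \<and> Ck_on 1 (g ` S) (inv_into S g)"

(* A function on A x T^n is a function of (I, phi) in R^n x R^n, 2 pi-periodic in each
   component of phi. *)
definition angle_periodic_on ::
    "(real^'n) set \<Rightarrow> ((real^'n) \<times> (real^'n) \<Rightarrow> 'b) \<Rightarrow> bool" where
  "angle_periodic_on A f \<longleftrightarrow>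
     (\<forall>I\<in>A. \<forall>\<phi>. \<forall>j. f (I, \<phi> + (2 * pi) *\<^sub>R axis j 1) = f (I, \<phi>))"

definition ivec :: "int^'n \<Rightarrow> real^'n" where
  "ivec k = (\<chi> i. real_of_int (k $ i))"

definition fourier_coeff ::
    "((real^'n) \<times> (real^'n) \<Rightarrow> real) \<Rightarrow> int^'n \<Rightarrow> real^'n \<Rightarrow> complex" where
  "fourier_coeff u k I =
     (1 / (2 * pi) ^ CARD('n)) *\<^sub>R
       (LINT \<phi>:cbox 0 (\<chi> i. 2 * pi)|lborel. complex_of_real (u (I, \<phi>)) * cis (- (ivec k \<bullet> \<phi>)))"

definition partial :: "'n \<Rightarrow> (real^'n \<Rightarrow> complex) \<Rightarrow> real^'n \<Rightarrow> complex" where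
  "partial j v I = vector_derivative (\<lambda>t. v (I + t *\<^sub>R axis j 1)) (at 0)"

definition sup_norm :: "(real^'n) set \<Rightarrow> (real^'n \<Rightarrow> complex) \<Rightarrow> ennreal" where
  "sup_norm A v = (SUP I\<in>A. ennreal (cmod (v I)))"

definition resonances :: "(real^'n) set \<Rightarrow> (real^'n \<Rightarrow> real^'n) \<Rightarrow> (real^'n) set" where
  "resonances A g = (\<Union>k\<in>- {0}. {I \<in> A. ivec k \<bullet> g I = 0})"

definition active_resonances ::
    "(real^'n) set \<Rightarrow> (real^'n \<Rightarrow> real^'n) \<Rightarrow> ((real^'n) \<times> (real^'n) \<Rightarrow> real) \<Rightarrow> (real^'n) set" where
  "active_resonances A g f =
     (\<Union>k\<in>- {0}. {I \<in> A. ivec k \<bullet> g I = 0 \<and> cmod (fourier_coeff f k I) > 0})"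

(* The norm |u|^1, with values in [0,\<infinity>]. For u on B x T^n the domain S of the action integrals
   is B minus the resonances, a null set: each coefficient of the long-time average jumps
   there, so its classical partial derivatives exist only off the resonances. *)
definition norm1 :: "(real^'n) set \<Rightarrow> ((real^'n) \<times> (real^'n) \<Rightarrow> real) \<Rightarrow> ennreal" where
  "norm1 S u =
     (\<Sum>\<^sub>\<infinity>k\<in>UNIV. \<integral>\<^sup>+I\<in>S. ennreal (cmod (fourier_coeff u k I)) \<partial>lborel)
   + (\<Sum>\<^sub>\<infinity>k\<in>UNIV. \<Sum>j\<in>UNIV. \<integral>\<^sup>+I\<in>S.
        ennreal (cmod (partial j (fourier_coeff u k) I)
                 + cmod (of_int (k $ j) * fourier_coeff u k I)) \<partial>lborel)"

definition free_flow ::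
    "(real^'n \<Rightarrow> real^'n) \<Rightarrow> real \<Rightarrow> (real^'n) \<times> (real^'n) \<Rightarrow> (real^'n) \<times> (real^'n)" where
  "free_flow g t x = (fst x, snd x + t *\<^sub>R g (fst x))"

definition time_average ::
    "(real^'n \<Rightarrow> real^'n) \<Rightarrow> ((real^'n) \<times> (real^'n) \<Rightarrow> real) \<Rightarrow> real \<Rightarrow> (real^'n) \<times> (real^'n) \<Rightarrow> real" where
  "time_average g f T x = (1 / T) * (LINT t:{0..T}|lborel. f (free_flow g t x))"

definition limit_average ::
    "(real^'n \<Rightarrow> real^'n) \<Rightarrow> ((real^'n) \<times> (real^'n) \<Rightarrow> real) \<Rightarrow> (real^'n) \<times> (real^'n) \<Rightarrow> real" where
  "limit_average g f x = Lim at_top (\<lambda>T. time_average g f T x)"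

definition discounted_average ::
    "(real^'n \<Rightarrow> real^'n) \<Rightarrow> ((real^'n) \<times> (real^'n) \<Rightarrow> real) \<Rightarrow> real \<Rightarrow> (real^'n) \<times> (real^'n) \<Rightarrow> real" where
  "discounted_average g f \<mu> x =
     \<mu> * (LINT t:{0..}|lborel. f (free_flow g t x) * exp (- \<mu> * t))"

(* Standard n-dimensional Wiener process: increments over [s,t] are N(0, (t - s) Id).
   Every path is continuous (not just almost every one), so that the discounted time integral
   of an observable along the path is a measurable function of \<omega> without completing P. *)
definition wiener_process :: "'w measure \<Rightarrow> (real \<Rightarrow> 'w \<Rightarrow> real^'n) \<Rightarrow> bool" where
  "wiener_process P w \<longleftrightarrow>
     prob_space P \<and>
     (\<forall>t\<ge>0. w t \<in> borel_measurable P) \<and>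
     (AE \<omega> in P. w 0 \<omega> = 0) \<and>
     (\<forall>\<omega>\<in>space P. continuous_on {0..} (\<lambda>t. w t \<omega>)) \<and>
     (\<forall>(\<tau>::nat \<Rightarrow> real) m. 0 \<le> \<tau> 0 \<and> (\<forall>l<m. \<tau> l < \<tau> (Suc l)) \<longrightarrow>
        prob_space.indep_vars P (\<lambda>_. borel) (\<lambda>l \<omega>. w (\<tau> (Suc l)) \<omega> - w (\<tau> l) \<omega>) {..<m}) \<and>
     (\<forall>s t. 0 \<le> s \<and> s < t \<longrightarrow>
        prob_space.indep_vars P (\<lambda>_. borel) (\<lambda>i \<omega>. (w t \<omega> - w s \<omega>) $ i) UNIV \<and>
        (\<forall>i. distributed P lborel (\<lambda>\<omega>. (w t \<omega> - w s \<omega>) $ i) (normal_density 0 (sqrt (t - s)))))"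

(* Flow of dI = 0, dphi = g(I) dt + sqrt(2 nu) dw. The amplitude sqrt(2 nu) is the one for which
   the generator is g(I) . grad_phi + nu Laplace_phi, so that the k-th harmonic is damped
   like exp(- nu |k|^2 t); an amplitude 2 nu would give exp(- 2 nu^2 |k|^2 t) instead. *)
definition noisy_flow ::
    "(real^'n \<Rightarrow> real^'n) \<Rightarrow> (real \<Rightarrow> 'w \<Rightarrow> real^'n) \<Rightarrow> real \<Rightarrow> real \<Rightarrow>
     (real^'n) \<times> (real^'n) \<Rightarrow> 'w \<Rightarrow> (real^'n) \<times> (real^'n)" where
  "noisy_flow g w \<nu> t x \<omega> = (fst x, snd x + t *\<^sub>R g (fst x) + sqrt (2 * \<nu>) *\<^sub>R w t \<omega>)"

definition noisy_average ::
    "'w measure \<Rightarrow> (real \<Rightarrow> 'w \<Rightarrow> real^'n) \<Rightarrow> (real^'n \<Rightarrow> real^'n) \<Rightarrow>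
     ((real^'n) \<times> (real^'n) \<Rightarrow> real) \<Rightarrow> real \<Rightarrow> real \<Rightarrow> (real^'n) \<times> (real^'n) \<Rightarrow> real" where
  "noisy_average P w g f \<mu> \<nu> x =
     \<mu> * (\<integral>\<omega>. (LINT t:{0..}|lborel. f (noisy_flow g w \<nu> t x \<omega>) * exp (- \<mu> * t)) \<partial>P)"

(* Bound for the noisy average. The factor unit_ball_vol (n - 1) * C^(n - 1) is the volume of
   the (n-1)-dimensional ball of radius C, which bounds the sections of g ` A by hyperplanes
   k . y = const. The logarithm is cut off at 0: it comes from
   arsinh r <= 1 + max 0 (ln r), and arsinh r <= 1 + ln r fails for small r > 0. *)
definition noisy_average_bound ::
    "(real^'n) set \<Rightarrow> ((real^'n) \<times> (real^'n) \<Rightarrow> real) \<Rightarrow> real \<Rightarrow> real \<Rightarrow> real \<Rightarrow> real \<Rightarrow> real \<Rightarrow> ennreal" where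
  "noisy_average_bound A f C D m \<mu> \<nu> =
     ennreal (2 * (unit_ball_vol (real (CARD('n) - 1)) * C ^ (CARD('n) - 1)) / m) *
     (\<Sum>\<^sub>\<infinity>k\<in>- {0}.
        ennreal (\<mu> * (1 + max 0 (ln (norm (ivec k) * C / (\<mu> + \<nu> * (norm (ivec k))\<^sup>2)))))
          * (of_nat (1 + CARD('n)) * sup_norm A (fourier_coeff f k)
             + (\<Sum>j\<in>UNIV. sup_norm A (partial j (fourier_coeff f k))))
        + ennreal (1/2 * (real CARD('n))\<^sup>2 * pi * D * (\<mu> / (\<mu> + \<nu> * (norm (ivec k))\<^sup>2)))
          * sup_norm A (fourier_coeff f k))"

end

theory Submission
  imports Defs
begin

text \<open>
  Each of the averages has the form \<open>E f (I, \<phi> + X)\<close> with a random displacement \<open>X\<close> depending only on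
  \<open>I\<close>, so its \<open>k\<close>-th Fourier coefficient is \<open>f\<^sub>k(I)\<close> times the characteristic function of \<open>X\<close> at \<open>k\<close>,
  a function \<open>\<sigma>\<close> of \<open>a = k \<bullet> g(I)\<close> (and of \<open>k\<close>). For the long-time average \<open>\<sigma>\<close> is the indicator of \<open>a = 0\<close>; for the time averages
  and the discounted averages \<open>\<sigma>(0) = 1\<close> while \<open>\<sigma> \<rightarrow> 0\<close> away from \<open>0\<close>; for the noisy average
  \<open>\<sigma>(a) = \<mu> / (\<mu> + \<nu> |k|\<^sup>2 - \<i> a)\<close>.

  (1) Near an active resonance, \<open>f\<^sub>k \<sigma>(a)\<close> keeps the value \<open>f\<^sub>k\<close> on the hypersurface \<open>a = 0\<close> but
  becomes small at a fixed distance from it. Along every segment that crosses the hypersurface the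
  integral of the directional derivative is therefore bounded below, and Fubini gives a lower bound
  for the norm.

  (2) The substitution \<open>y = g(I)\<close>, followed by a rotation taking \<open>k\<close> to a coordinate axis and by slicing
  the ball of radius \<open>C\<close>, reduces everything to one-dimensional integrals of
  \<open>1 / sqrt (s\<^sup>2 + |k|\<^sup>2 x\<^sup>2)\<close> and \<open>1 / (s\<^sup>2 + |k|\<^sup>2 x\<^sup>2)\<close> with \<open>s = \<mu> + \<nu> |k|\<^sup>2\<close>.

  (3) The bound tends to \<open>0\<close> because \<open>max 0 (ln x) \<le> x\<close> turns the logarithmic term into \<open>C \<mu> / \<nu>\<close>.
\<close>

section \<open>Periodic functions on the torus\<close>

text \<open>For each harmonic k, the averages replace the jump of the long-time average at the
  resonance a = 0 by a thin layer. The derivative across a layer integrates to at least its height,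
  however thin it is. Without noise the height is |f_k|, because \<sigma>(0) = 1; this is the
  obstruction in (1), and density of the active resonances puts such a layer into every open B.
  Noise moves the pole of \<sigma> to distance s = \<mu> + \<nu> |k|^2 from the real line and lowers
  the height to \<mu> / s times |f_k|, which tends to 0 together with \<mu> / \<nu>. The constants
  of (2): 1 + n counts u_k and the n terms k_j u_k. The derivative of k \<bullet> g in one action is
  at most n D |k|; its |k| cancels against the integral of \<mu> / (s^2 + |k|^2 x^2), at most pi
  \<mu> / (|k| s), and the sum over the n actions completes n^2. The limit in the long-time average
  is taken with \<open>Lim\<close>, which says something only if the time means converge for each
  angle. This is why trigonometric approximation is developed first.\<close>

definition periodic :: "(real^'n \<Rightarrow> 'b) \<Rightarrow> bool" where
  "periodic F \<longleftrightarrow> (\<forall>\<phi> j. F (\<phi> + (2 * pi) *\<^sub>R axis j 1) = F \<phi>)"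

definition cube :: "(real^'n) set" where
  "cube = cbox 0 (\<chi> i. 2 * pi)"

lemma cube_altdef: "cube = {\<phi>::real^'n. \<forall>i. 0 \<le> \<phi> $ i \<and> \<phi> $ i \<le> 2 * pi}"
  by (auto simp: cube_def mem_box_cart)

lemma compact_cube: "compact (cube :: (real^'n) set)"
  by (simp add: cube_def)

lemma periodic_int_shift:
  assumes "periodic F"
  shows "F (\<phi> + (2 * pi * of_int r) *\<^sub>R axis j 1) = F \<phi>"
proof -
  have nat: "F (\<phi> + (2 * pi * real n) *\<^sub>R axis j 1) = F \<phi>" for n \<phi>
  proof (induction n arbitrary: \<phi>)
    case (Suc n)
    have "\<phi> + (2 * pi * real (Suc n)) *\<^sub>R axis j 1
        = (\<phi> + (2 * pi * real n) *\<^sub>R axis j 1) + (2 * pi) *\<^sub>R axis j 1"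
      by (simp add: algebra_simps)
    then have "F (\<phi> + (2 * pi * real (Suc n)) *\<^sub>R axis j 1) = F (\<phi> + (2 * pi * real n) *\<^sub>R axis j 1)"
      using assms unfolding periodic_def by metis
    then show ?case using Suc by simp
  qed simp
  show ?thesis
  proof (cases "r \<ge> 0")
    case True
    then show ?thesis using nat[of \<phi> "nat r"] by simp
  next
    case False
    then show ?thesis
      using nat[of "\<phi> + (2 * pi * of_int r) *\<^sub>R axis j 1" "nat (- r)"]
      by (simp add: algebra_simps)
  qed
qed

lemma periodic_lattice_shift:
  fixes F :: "real^'n \<Rightarrow> 'b"
  assumes "periodic F"
  shows "F (\<phi> + (2 * pi) *\<^sub>R ivec m) = F \<phi>"
proof -
  have "F (\<phi> + (\<Sum>j\<in>J. (2 * pi * of_int (m $ j)) *\<^sub>R axis j 1)) = F \<phi>" if "finite J" for J :: "'n set"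
    using that
  proof (induction J arbitrary: \<phi>)
    case (insert j J)
    have "F (\<phi> + (\<Sum>j\<in>insert j J. (2 * pi * of_int (m $ j)) *\<^sub>R axis j 1))
        = F ((\<phi> + (2 * pi * of_int (m $ j)) *\<^sub>R axis j 1) + (\<Sum>j\<in>J. (2 * pi * of_int (m $ j)) *\<^sub>R axis j 1))"
      using insert.hyps by (simp add: add.assoc)
    also have "\<dots> = F \<phi>"
      by (simp only: insert.IH periodic_int_shift[OF assms])
    finally show ?case .
  qed simp
  moreover have "(2 * pi) *\<^sub>R ivec m = (\<Sum>j\<in>UNIV. (2 * pi * of_int (m $ j)) *\<^sub>R axis j 1)"
    using basis_expansion[of "(2 * pi) *\<^sub>R ivec m"] by (simp add: ivec_def scalar_mult_eq_scaleR)
  ultimately show ?thesis by simp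
qed

lemma reduce_to_cube:
  fixes \<phi> :: "real^'n"
  obtains m :: "int^'n" where "\<phi> + (2 * pi) *\<^sub>R ivec m \<in> cube"
proof
  define m :: "int^'n" where "m = (\<chi> i. - \<lfloor>\<phi> $ i / (2 * pi)\<rfloor>)"
  have "0 \<le> \<phi> $ i - 2 * pi * of_int \<lfloor>\<phi> $ i / (2 * pi)\<rfloor>
      \<and> \<phi> $ i - 2 * pi * of_int \<lfloor>\<phi> $ i / (2 * pi)\<rfloor> \<le> 2 * pi" for i
  proof -
    have "of_int \<lfloor>\<phi> $ i / (2 * pi)\<rfloor> * (2 * pi) \<le> \<phi> $ i"
      by (rule floor_divide_lower) simp
    moreover have "\<phi> $ i < (of_int \<lfloor>\<phi> $ i / (2 * pi)\<rfloor> + 1) * (2 * pi)"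
      by (rule floor_divide_upper) simp
    ultimately show ?thesis by (simp add: algebra_simps)
  qed
  then show "\<phi> + (2 * pi) *\<^sub>R ivec m \<in> cube"
    by (simp add: cube_altdef m_def ivec_def)
qed

lemma periodic_continuous_bounded:
  fixes F :: "real^'n \<Rightarrow> 'b::real_normed_vector"
  assumes "periodic F" "continuous_on UNIV F"
  obtains M where "M > 0" "\<And>\<phi>. norm (F \<phi>) \<le> M"
proof -
  have "compact (F ` cube)"
    using assms compact_cube by (intro compact_continuous_image) (auto intro: continuous_on_subset)
  then have "bounded (F ` cube)"
    by (rule compact_imp_bounded)
  then obtain M where M: "M > 0" "\<forall>x\<in>F ` cube. norm x \<le> M"
    by (auto simp: bounded_pos)
  have "norm (F \<phi>) \<le> M" for \<phi>
  proof -
    obtain m where "\<phi> + (2 * pi) *\<^sub>R ivec m \<in> cube" using reduce_to_cube .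
    then have "norm (F (\<phi> + (2 * pi) *\<^sub>R ivec m)) \<le> M" using M(2) by blast
    then show ?thesis by (simp add: periodic_lattice_shift[OF assms(1)])
  qed
  with M(1) show ?thesis using that by blast
qed

section \<open>The integral over a period cell does not depend on the position of the cell\<close>

definition half_cube :: "(real^'n) set" where
  "half_cube = {\<phi>. \<forall>i. 0 \<le> \<phi> $ i \<and> \<phi> $ i < 2 * pi}"

lemma borel_half_cube [measurable]: "half_cube \<in> sets (borel :: (real^'n) measure)"
  unfolding half_cube_def by measurable

text \<open>Fourier coefficients integrate over the closed cube, but only translates of the
  half-open one tile the space without overlap. The two differ on faces that lie in null
  hyperplanes.\<close>

lemma AE_half_cube: "AE \<phi> in (lborel :: (real^'n) measure). \<phi> \<in> half_cube \<longleftrightarrow> \<phi> \<in> cube"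
proof -
  have "AE \<phi> in (lborel :: (real^'n) measure). \<phi> $ i \<noteq> 2 * pi" for i
  proof -
    have "{\<phi>::real^'n. axis i 1 \<bullet> \<phi> = 2 * pi} \<in> null_sets lebesgue"
      using negligible_hyperplane[of "axis i 1 :: real^'n" "2 * pi"]
      by (auto simp: negligible_iff_null_sets axis_eq_0_iff)
    moreover have "{\<phi>::real^'n. axis i 1 \<bullet> \<phi> = 2 * pi} \<in> sets lborel"
      by simp
    ultimately have "{\<phi>::real^'n. axis i 1 \<bullet> \<phi> = 2 * pi} \<in> null_sets lborel"
      by (metis null_sets_completion_iff)
    from AE_not_in[OF this] show ?thesis by (simp add: inner_axis')
  qed
  then have "AE \<phi> in (lborel :: (real^'n) measure). \<forall>i. \<phi> $ i \<noteq> 2 * pi"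
    by (simp add: AE_all_countable)
  then show ?thesis
    by eventually_elim (auto simp: half_cube_def cube_altdef less_le)
qed

lemma set_integrable_bounded:
  fixes F :: "real^'n \<Rightarrow> 'b::{banach,second_countable_topology}"
  assumes "F \<in> borel_measurable borel" "\<And>\<phi>. norm (F \<phi>) \<le> M" "S \<in> sets borel" "bounded S"
  shows "set_integrable lborel S F"
proof -
  have "emeasure lborel S < \<infinity>"
    by (rule emeasure_bounded_finite) fact
  then have "set_integrable lborel S (\<lambda>x. M)"
    using assms by (simp add: set_integrable_def)
  then show ?thesis
    unfolding set_integrable_def
  proof (rule Bochner_Integration.integrable_bound)
    have "norm (F \<phi>) \<le> \<bar>M\<bar>" for \<phi>
      using assms(2)[of \<phi>] by linarith
    then show "AE \<phi> in lborel. norm (indicator S \<phi> *\<^sub>R F \<phi>) \<le> norm (indicator S \<phi> *\<^sub>R M)"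
      by (auto simp: indicator_def)
  qed (use assms in measurable)
qed

lemma lborel_integral_shift:
  fixes F :: "'a::euclidean_space \<Rightarrow> 'b::{banach,second_countable_topology}"
  assumes [measurable]: "F \<in> borel_measurable borel"
  shows "(\<integral>x. F (x + c) \<partial>lborel) = (\<integral>x. F x \<partial>lborel)"
proof -
  have "(\<integral>x. F x \<partial>lborel) = (\<integral>x. F x \<partial>distr lborel borel ((+) c))"
    by (simp add: lborel_distr_plus)
  also have "\<dots> = (\<integral>x. F (c + x) \<partial>lborel)"
    by (subst integral_distr) auto
  finally show ?thesis by (simp add: add.commute)
qed

text \<open>Shifting the cell by s along an axis cuts off the slab below height s and adds the same
  slab one period higher; periodicity moves it back.\<close>

lemma integral_half_cube_axis_shift:
  fixes F :: "real^'n \<Rightarrow> 'b::{banach,second_countable_topology}"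
  assumes per: "periodic F" and meas: "F \<in> borel_measurable borel" and bd: "\<And>\<phi>. norm (F \<phi>) \<le> M"
    and s: "0 \<le> s" "s \<le> 2 * pi"
  shows "(LINT \<phi>:half_cube|lborel. F (\<phi> + s *\<^sub>R axis j 1)) = (LINT \<phi>:half_cube|lborel. F \<phi>)"
proof -
  let ?o = "\<lambda>\<phi> :: real^'n. \<forall>i. i \<noteq> j \<longrightarrow> 0 \<le> \<phi> $ i \<and> \<phi> $ i < 2 * pi"
  define e where "e = (axis j 1 :: real^'n)"
  define Q :: "(real^'n) set" where "Q = half_cube"
  define L where "L = {\<phi>\<in>Q. \<phi> $ j < s}"
  define U where "U = {\<phi>\<in>Q. s \<le> \<phi> $ j}"
  define L' where "L' = {\<phi>. \<phi> - (2 * pi) *\<^sub>R e \<in> L}"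
  have Qm [measurable]: "Q \<in> sets borel" by (simp add: Q_def)
  have Lm [measurable]: "L \<in> sets borel" and Um [measurable]: "U \<in> sets borel"
    unfolding L_def U_def by measurable
  have L'm [measurable]: "L' \<in> sets borel" unfolding L'_def by measurable
  have bQ: "bounded Q"
    by (rule bounded_subset[OF compact_imp_bounded[OF compact_cube]])
      (auto simp: Q_def half_cube_def cube_altdef intro: less_imp_le)
  have int: "set_integrable lborel S F" if "S \<in> sets borel" "bounded S" for S
    using set_integrable_bounded[OF meas bd that] .
  have bL: "bounded L" "bounded U" using bQ by (auto simp: L_def U_def intro: bounded_subset)
  have "L' = (\<lambda>\<phi>. (2 * pi) *\<^sub>R e + \<phi>) ` L"
    by (force simp: L'_def image_iff algebra_simps)
  then have bL': "bounded L'" using bL bounded_translation by blast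
  \<comment> \<open>The shifted cell is the disjoint union of the upper slab \<open>U\<close> and
    the raised lower slab \<open>L'\<close>. Thanks to the half-open inequalities this holds at
    every point.\<close>
  have ind: "indicator Q (\<phi> - s *\<^sub>R e) = indicator U \<phi> + (indicator L' \<phi> :: real)" for \<phi>
  proof -
    have c: "(\<phi> - r *\<^sub>R e) $ i = \<phi> $ i - (if i = j then r else 0)" for i r
      by (simp add: e_def axis_def)
    have 1: "\<phi> - s *\<^sub>R e \<in> Q \<longleftrightarrow> ?o \<phi> \<and> s \<le> \<phi> $ j \<and> \<phi> $ j < 2 * pi + s"
    proof -
      have "(\<forall>i. 0 \<le> (\<phi> - s *\<^sub>R e) $ i \<and> (\<phi> - s *\<^sub>R e) $ i < 2 * pi) \<longleftrightarrow>
          ?o \<phi> \<and> 0 \<le> \<phi> $ j - s \<and> \<phi> $ j - s < 2 * pi"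
        unfolding c by (auto split: if_splits)
      then show ?thesis by (auto simp: Q_def half_cube_def)
    qed
    have 2: "\<phi> \<in> U \<longleftrightarrow> ?o \<phi> \<and> s \<le> \<phi> $ j \<and> \<phi> $ j < 2 * pi"
    proof -
      have "(\<forall>i. 0 \<le> \<phi> $ i \<and> \<phi> $ i < 2 * pi) \<longleftrightarrow>
          ?o \<phi> \<and> 0 \<le> \<phi> $ j \<and> \<phi> $ j < 2 * pi"
        by metis
      then show ?thesis using s by (auto simp: U_def Q_def half_cube_def)
    qed
    have 3: "\<phi> \<in> L' \<longleftrightarrow> ?o \<phi> \<and> 2 * pi \<le> \<phi> $ j \<and> \<phi> $ j < 2 * pi + s"
    proof -
      have "(\<forall>i. 0 \<le> (\<phi> - (2 * pi) *\<^sub>R e) $ i \<and> (\<phi> - (2 * pi) *\<^sub>R e) $ i < 2 * pi) \<longleftrightarrow>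
          ?o \<phi> \<and> 0 \<le> \<phi> $ j - 2 * pi \<and> \<phi> $ j - 2 * pi < 2 * pi"
        unfolding c by (auto split: if_splits)
      moreover have "(\<phi> - (2 * pi) *\<^sub>R e) $ j = \<phi> $ j - 2 * pi" by (simp add: e_def axis_def)
      ultimately show ?thesis using s by (auto simp: L'_def L_def Q_def half_cube_def)
    qed
    show ?thesis unfolding indicator_def 1 2 3 using s by auto
  qed
  have "(LINT \<phi>:Q|lborel. F (\<phi> + s *\<^sub>R e)) = (\<integral>\<phi>. indicator Q (\<phi> - s *\<^sub>R e) *\<^sub>R F \<phi> \<partial>lborel)"
    unfolding set_lebesgue_integral_def
    using lborel_integral_shift[of "\<lambda>\<phi>. indicator Q (\<phi> - s *\<^sub>R e) *\<^sub>R F \<phi>" "s *\<^sub>R e"] meas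
    by simp
  also have "\<dots> = (\<integral>\<phi>. indicator U \<phi> *\<^sub>R F \<phi> + indicator L' \<phi> *\<^sub>R F \<phi> \<partial>lborel)"
    by (simp add: ind scaleR_add_left)
  also have "\<dots> = (LINT \<phi>:U|lborel. F \<phi>) + (LINT \<phi>:L'|lborel. F \<phi>)"
    unfolding set_lebesgue_integral_def
    using int[OF Um bL(2)] int[OF L'm bL'] by (intro Bochner_Integration.integral_add) (auto simp: set_integrable_def)
  also have "(LINT \<phi>:L'|lborel. F \<phi>) = (LINT \<phi>:L|lborel. F \<phi>)"
  proof -
    have "(\<integral>\<phi>. indicator L' \<phi> *\<^sub>R F \<phi> \<partial>lborel)
        = (\<integral>\<phi>. indicator L' (\<phi> + (2 * pi) *\<^sub>R e) *\<^sub>R F (\<phi> + (2 * pi) *\<^sub>R e) \<partial>lborel)"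
      using meas by (intro lborel_integral_shift[symmetric]) measurable
    also have "\<dots> = (\<integral>\<phi>. indicator L \<phi> *\<^sub>R F \<phi> \<partial>lborel)"
      using per by (simp add: periodic_def L'_def e_def indicator_def)
    finally show ?thesis by (simp add: set_lebesgue_integral_def)
  qed
  also have "(LINT \<phi>:U|lborel. F \<phi>) + (LINT \<phi>:L|lborel. F \<phi>) = (LINT \<phi>:U \<union> L|lborel. F \<phi>)"
    using int[OF Um bL(2)] int[OF Lm bL(1)] 
    by (subst set_integral_Un) (auto simp: U_def L_def)
  also have "U \<union> L = Q" by (auto simp: U_def L_def)
  finally show ?thesis unfolding Q_def e_def .
qed

lemma integral_cube_eq_half_cube:
  fixes F :: "real^'n \<Rightarrow> 'b::{banach,second_countable_topology}"
  assumes [measurable]: "F \<in> borel_measurable borel"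
  shows "(LINT \<phi>:cube|lborel. F \<phi>) = (LINT \<phi>:half_cube|lborel. F \<phi>)"
  unfolding set_lebesgue_integral_def
proof (rule integral_cong_AE)
  have [measurable]: "cube \<in> sets (borel :: (real^'n) measure)"
    by (simp add: cube_def)
  show "AE \<phi> in lborel. indicator cube \<phi> *\<^sub>R F \<phi> = indicator half_cube \<phi> *\<^sub>R F \<phi>"
    using AE_half_cube by eventually_elim (simp add: indicator_def)
  show "(\<lambda>\<phi>. indicator cube \<phi> *\<^sub>R F \<phi>) \<in> borel_measurable lborel"
    "(\<lambda>\<phi>. indicator half_cube \<phi> *\<^sub>R F \<phi>) \<in> borel_measurable lborel" by measurable
qed

lemma periodic_translate: "periodic F \<Longrightarrow> periodic (\<lambda>\<phi>. F (\<phi> + v))"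
proof -
  assume "periodic F"
  moreover have "\<phi> + (2 * pi) *\<^sub>R axis j 1 + v = (\<phi> + v) + (2 * pi) *\<^sub>R axis j 1" for \<phi> j
    by simp
  ultimately show ?thesis unfolding periodic_def by metis
qed

text \<open>A general shift is composed of shifts along the axes. A translate of a periodic
  continuous function is again of this kind, so the one-axis statement applies to each partial
  translate.\<close>

lemma integral_cube_shift:
  fixes F :: "real^'n \<Rightarrow> 'b::{banach,second_countable_topology}"
  assumes per: "periodic F" and cont: "continuous_on UNIV F"
  shows "(LINT \<phi>:cube|lborel. F (\<phi> + v)) = (LINT \<phi>:cube|lborel. F \<phi>)"
proof -
  have axis: "(LINT \<phi>:cube|lborel. G (\<phi> + s *\<^sub>R axis j 1)) = (LINT \<phi>:cube|lborel. G \<phi>)"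
    if G: "periodic G" "continuous_on UNIV G" for G :: "real^'n \<Rightarrow> 'b" and s j
  proof -
    obtain M where M: "\<And>\<phi>. norm (G \<phi>) \<le> M"
      using periodic_continuous_bounded[OF G] by blast
    have meas: "G \<in> borel_measurable borel"
      using G(2) by (rule borel_measurable_continuous_onI)
    \<comment> \<open>The shift along one axis is known for 0 \<le> s \<le> 2 pi; whole periods are
      split off from an arbitrary s.\<close>
    define s' where "s' = s - 2 * pi * of_int \<lfloor>s / (2 * pi)\<rfloor>"
    have s': "0 \<le> s'" "s' \<le> 2 * pi"
      using floor_divide_lower[of "2 * pi" s] floor_divide_upper[of "2 * pi" s]
      by (auto simp: s'_def algebra_simps)
    have "G (\<phi> + s *\<^sub>R axis j 1) = G (\<phi> + s' *\<^sub>R axis j 1)" for \<phi>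
      using periodic_int_shift[OF G(1), of "\<phi> + s' *\<^sub>R axis j 1" "\<lfloor>s / (2 * pi)\<rfloor>" j]
      by (simp add: s'_def algebra_simps)
    then have "(LINT \<phi>:cube|lborel. G (\<phi> + s *\<^sub>R axis j 1)) = (LINT \<phi>:cube|lborel. G (\<phi> + s' *\<^sub>R axis j 1))"
      by simp
    also have "\<dots> = (LINT \<phi>:half_cube|lborel. G (\<phi> + s' *\<^sub>R axis j 1))"
      by (intro integral_cube_eq_half_cube borel_measurable_continuous_onI continuous_on_compose2[OF G(2)])
        (auto intro!: continuous_intros)
    also have "\<dots> = (LINT \<phi>:cube|lborel. G \<phi>)"
      using integral_half_cube_axis_shift[OF G(1) meas M s'] integral_cube_eq_half_cube[OF meas] by simp
    finally show ?thesis .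
  qed
  have "(LINT \<phi>:cube|lborel. G (\<phi> + (\<Sum>j\<in>J. (v $ j) *\<^sub>R axis j 1))) = (LINT \<phi>:cube|lborel. G \<phi>)"
    if "finite J" "periodic G" "continuous_on UNIV G" for J and G :: "real^'n \<Rightarrow> 'b"
    using that
  proof (induction J arbitrary: G)
    case (insert j J)
    define H where "H = (\<lambda>\<phi>. G (\<phi> + (\<Sum>j\<in>J. (v $ j) *\<^sub>R axis j 1)))"
    have H: "periodic H" "continuous_on UNIV H"
      unfolding H_def using insert.prems
      by (auto intro!: periodic_translate continuous_intros continuous_on_compose2[OF insert.prems(2)])
    have "(LINT \<phi>:cube|lborel. G (\<phi> + (\<Sum>j\<in>insert j J. (v $ j) *\<^sub>R axis j 1)))
        = (LINT \<phi>:cube|lborel. H (\<phi> + (v $ j) *\<^sub>R axis j 1))"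
      using insert.hyps by (simp add: H_def add.assoc)
    also have "\<dots> = (LINT \<phi>:cube|lborel. H \<phi>)" using axis[OF H] .
    also have "\<dots> = (LINT \<phi>:cube|lborel. G \<phi>)" unfolding H_def using insert.IH[OF insert.prems] .
    finally show ?case .
  qed simp
  from this[of UNIV F] show ?thesis
    using per cont basis_expansion[of v] by (simp add: scalar_mult_eq_scaleR)
qed

section \<open>Trigonometric polynomials and their density\<close>

inductive trig_poly :: "(real^'n \<Rightarrow> complex) \<Rightarrow> bool" where
  cis: "trig_poly (\<lambda>\<phi>. c * cis (ivec k \<bullet> \<phi>))"
| add: "trig_poly p \<Longrightarrow> trig_poly q \<Longrightarrow> trig_poly (\<lambda>\<phi>. p \<phi> + q \<phi>)"

lemma ivec_add: "ivec (k + l) = ivec k + ivec l"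
  by (simp add: ivec_def vec_eq_iff)

lemma ivec_0 [simp]: "ivec 0 = 0"
  by (simp add: ivec_def vec_eq_iff)

lemma ivec_uminus: "ivec (- k) = - ivec k"
  by (simp add: ivec_def vec_eq_iff)

lemma ivec_axis: "ivec (axis i 1) = axis i 1"
  by (simp add: ivec_def vec_eq_iff axis_def)

text \<open>The product of the harmonics k and l is the harmonic k + l. This closure is what turns
  polynomials in cosines and sines into trigonometric polynomials.\<close>

lemma trig_poly_mult:
  assumes "trig_poly p" "trig_poly q"
  shows "trig_poly (\<lambda>\<phi>. p \<phi> * q \<phi>)"
  using assms(1)
proof induction
  case (cis c k)
  show ?case using assms(2)
  proof induction
    case (cis d l)
    have "(\<lambda>\<phi>. c * cis (ivec k \<bullet> \<phi>) * (d * cis (ivec l \<bullet> \<phi>))) = (\<lambda>\<phi>. (c * d) * cis (ivec (k + l) \<bullet> \<phi>))"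
      by (rule ext) (simp add: ivec_add inner_add_left flip: cis_mult)
    then show ?case using trig_poly.cis[of "c * d" "k + l"] by simp
  next
    case (add p q)
    then show ?case using trig_poly.add by (fastforce simp: distrib_left)
  qed
next
  case (add p q)
  then show ?case using trig_poly.add by (fastforce simp: distrib_right)
qed

lemma trig_poly_const: "trig_poly (\<lambda>\<phi>. c)"
  using trig_poly.cis[of c 0] by simp

lemma trig_poly_cmult: "trig_poly p \<Longrightarrow> trig_poly (\<lambda>\<phi>. c * p \<phi>)"
  using trig_poly_mult[OF trig_poly_const] .

lemma trig_poly_sum: "finite J \<Longrightarrow> (\<And>j. j \<in> J \<Longrightarrow> trig_poly (p j)) \<Longrightarrow> trig_poly (\<lambda>\<phi>. \<Sum>j\<in>J. p j \<phi>)"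
  by (induction J rule: finite_induct) (auto intro: trig_poly_const trig_poly.add)

lemma trig_poly_cos: "trig_poly (\<lambda>\<phi>. complex_of_real (cos (\<phi> $ i)))"
proof -
  have eq: "(\<lambda>\<phi>. complex_of_real (cos (\<phi> $ i)))
      = (\<lambda>\<phi>. (1/2) * cis (ivec (axis i 1) \<bullet> \<phi>) + (1/2) * cis (ivec (- axis i 1) \<bullet> \<phi>))"
    by (rule ext) (simp add: ivec_uminus ivec_axis inner_axis' complex_eq_iff)
  show ?thesis unfolding eq by (intro trig_poly.intros)
qed

lemma trig_poly_sin: "trig_poly (\<lambda>\<phi>. complex_of_real (sin (\<phi> $ i)))"
proof -
  have eq: "(\<lambda>\<phi>. complex_of_real (sin (\<phi> $ i)))
      = (\<lambda>\<phi>. (- \<i>/2) * cis (ivec (axis i 1) \<bullet> \<phi>) + (\<i>/2) * cis (ivec (- axis i 1) \<bullet> \<phi>))"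
    by (rule ext) (simp add: ivec_uminus ivec_axis inner_axis' complex_eq_iff)
  show ?thesis unfolding eq by (intro trig_poly.intros)
qed

definition torus_embed :: "real^'n \<Rightarrow> (real^'n) \<times> (real^'n)" where
  "torus_embed \<phi> = ((\<chi> i. cos (\<phi> $ i)), (\<chi> i. sin (\<phi> $ i)))"

lemma continuous_on_torus_embed: "continuous_on S torus_embed"
  unfolding torus_embed_def by (intro continuous_intros)

text \<open>Real polynomials are generated from bounded linear functionals, so the base case is a
  functional of (cos \<phi>, sin \<phi>), expanded in the coordinates
  \<open>cos (\<phi> $ i)\<close> and \<open>sin (\<phi> $ i)\<close>.\<close>

lemma trig_poly_real_polynomial:
  fixes p :: "(real^'n) \<times> (real^'n) \<Rightarrow> real"
  assumes "real_polynomial_function p"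
  shows "trig_poly (\<lambda>\<phi>. complex_of_real (p (torus_embed \<phi>)))"
  using assms
proof induction
  case (linear f)
  interpret f: bounded_linear f by fact
  have "f (torus_embed \<phi>) = (\<Sum>i\<in>UNIV. cos (\<phi> $ i) * f (axis i 1, 0)) + (\<Sum>i\<in>UNIV. sin (\<phi> $ i) * f (0, axis i 1))" for \<phi> :: "real^'n"
  proof -
    have 1: "(\<chi> i. cos (\<phi> $ i)) = (\<Sum>i\<in>UNIV. cos (\<phi> $ i) *\<^sub>R (axis i 1 :: real^'n))"
      using basis_expansion[of "\<chi> i. cos (\<phi> $ i)"] by (simp add: scalar_mult_eq_scaleR)
    have 2: "(\<chi> i. sin (\<phi> $ i)) = (\<Sum>i\<in>UNIV. sin (\<phi> $ i) *\<^sub>R (axis i 1 :: real^'n))"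
      using basis_expansion[of "\<chi> i. sin (\<phi> $ i)"] by (simp add: scalar_mult_eq_scaleR)
    have "torus_embed \<phi> = (\<Sum>i\<in>UNIV. cos (\<phi> $ i) *\<^sub>R (axis i 1 :: real^'n, 0 :: real^'n))
        + (\<Sum>i\<in>UNIV. sin (\<phi> $ i) *\<^sub>R (0 :: real^'n, axis i 1 :: real^'n))"
      unfolding torus_embed_def 1 2 by (simp add: prod_eq_iff fst_sum snd_sum)
    then show ?thesis by (simp add: f.add f.sum f.scaleR del: scaleR_Pair)
  qed
  then have "(\<lambda>\<phi>. complex_of_real (f (torus_embed \<phi>)))
    = (\<lambda>\<phi>. (\<Sum>i\<in>UNIV. complex_of_real (f (axis i 1, 0)) * complex_of_real (cos (\<phi> $ i)))
        + (\<Sum>i\<in>UNIV. complex_of_real (f (0, axis i 1)) * complex_of_real (sin (\<phi> $ i))))"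
    by (simp add: mult.commute)
  then show ?case
    by (auto intro!: trig_poly.add trig_poly_sum trig_poly_cmult trig_poly_cos trig_poly_sin)
next
  case (const c)
  then show ?case by (rule trig_poly_const)
next
  case (add f g)
  then show ?case using trig_poly.add by fastforce
next
  case (mult f g)
  then show ?case using trig_poly_mult by fastforce
qed

text \<open>Equal sines and cosines force the coordinates to differ by multiples of 2 pi. Hence a
  periodic function factors through \<open>torus_embed\<close>.\<close>

lemma torus_embed_eq_imp:
  fixes F :: "real^'n \<Rightarrow> 'b"
  assumes "periodic F" "torus_embed \<phi> = torus_embed \<psi>"
  shows "F \<phi> = F \<psi>"
proof -
  have "\<forall>i. \<exists>n::int. \<phi> $ i = \<psi> $ i + 2 * pi * of_int n"
  proof
    fix i
    have "sin (\<phi> $ i) = sin (\<psi> $ i) \<and> cos (\<phi> $ i) = cos (\<psi> $ i)"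
      using assms(2) by (auto simp: torus_embed_def vec_eq_iff)
    then show "\<exists>n::int. \<phi> $ i = \<psi> $ i + 2 * pi * of_int n"
      by (subst (asm) sin_cos_eq_iff) (auto simp: mult_ac)
  qed
  then obtain n where n: "\<And>i. \<phi> $ i = \<psi> $ i + 2 * pi * of_int (n i)"
    by metis
  have "\<phi> = \<psi> + (2 * pi) *\<^sub>R ivec (\<chi> i. n i)"
    by (simp add: vec_eq_iff n ivec_def)
  then show ?thesis using periodic_lattice_shift[OF assms(1)] by metis
qed

lemma torus_embed_cube: "torus_embed ` cube = range (torus_embed :: real^'n \<Rightarrow> _)"
proof -
  have per: "periodic (torus_embed :: real^'n \<Rightarrow> _)"
    by (auto simp: periodic_def torus_embed_def vec_eq_iff axis_def)
  have "torus_embed \<phi> \<in> torus_embed ` cube" for \<phi> :: "real^'n"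
  proof -
    obtain m where "\<phi> + (2 * pi) *\<^sub>R ivec m \<in> cube" using reduce_to_cube .
    then show ?thesis using periodic_lattice_shift[OF per, of \<phi> m] by (metis imageI)
  qed
  then show ?thesis by auto
qed

text \<open>Stone--Weierstrass on the torus, embedded by \<open>\<phi> \<mapsto> (cos \<phi>, sin \<phi>)\<close>; polynomials in these
  coordinates are trigonometric polynomials.\<close>

lemma trig_poly_approx:
  fixes F :: "real^'n \<Rightarrow> real"
  assumes per: "periodic F" and cont: "continuous_on UNIV F" and "e > 0"
  obtains p where "trig_poly p" "\<And>\<phi>. cmod (complex_of_real (F \<phi>) - p \<phi>) < e"
proof -
  define T where "T = range (torus_embed :: real^'n \<Rightarrow> _)"
  define G where "G = (\<lambda>z. F (SOME \<phi>. torus_embed \<phi> = z))"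
  have G: "G (torus_embed \<phi>) = F \<phi>" for \<phi>
    unfolding G_def by (rule torus_embed_eq_imp[OF per]) (rule someI[of _ \<phi>], simp)
  have "compact T"
    unfolding T_def torus_embed_cube[symmetric]
    by (intro compact_continuous_image continuous_on_torus_embed compact_cube)
  \<comment> \<open>Quotient-map argument: the preimage in \<open>T\<close> of a closed set is the
    image of a compact part of the cube, hence closed. \<open>G\<close> is defined by a choice, so
    its continuity cannot be read off.\<close>
  moreover have "continuous_on T G"
    unfolding continuous_on_closed_vimage[OF compact_imp_closed[OF \<open>compact T\<close>]]
  proof (intro allI impI)
    fix B :: "real set" assume "closed B"
    have "closed (F -` B)"
      by (rule continuous_closed_vimage[OF \<open>closed B\<close>]) (use cont in \<open>simp add: continuous_on_eq_continuous_at\<close>)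
    then have "compact (cube \<inter> F -` B)"
      by (intro compact_Int_closed compact_cube)
    then have "compact (torus_embed ` (cube \<inter> F -` B))"
      by (intro compact_continuous_image continuous_on_torus_embed)
    moreover have "torus_embed ` (cube \<inter> F -` B) = G -` B \<inter> T"
      unfolding T_def torus_embed_cube[symmetric] using G by auto
    ultimately show "closed (G -` B \<inter> T)" by (simp add: compact_imp_closed)
  qed
  ultimately obtain q where q: "real_polynomial_function q" "\<And>x. x \<in> T \<Longrightarrow> \<bar>G x - q x\<bar> < e"
    using Stone_Weierstrass_real_polynomial_function[OF _ _ \<open>e > 0\<close>] by blast
  show ?thesis
  proof (rule that)
    show "trig_poly (\<lambda>\<phi>. complex_of_real (q (torus_embed \<phi>)))"
      using trig_poly_real_polynomial[OF q(1)] .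
    show "cmod (complex_of_real (F \<phi>) - complex_of_real (q (torus_embed \<phi>))) < e" for \<phi>
      using q(2)[of "torus_embed \<phi>"] by (simp add: T_def G flip: of_real_diff)
  qed
qed

section \<open>Time means and Fourier coefficients of averages\<close>

lemma set_integrable_continuous_Icc:
  fixes F :: "real \<Rightarrow> 'b::{banach,second_countable_topology}"
  assumes "continuous_on {a..b} F"
  shows "set_integrable lborel {a..b} F"
  unfolding set_integrable_def by (rule borel_integrable_compact) (use assms in auto)

text \<open>The Fourier multiplier of the time average as a function of the frequency a, that is
  (exp(i T a) - 1) / (i T a) for a \<noteq> 0. The integral form needs no case distinction at a =
  0.\<close>

definition time_mult :: "real \<Rightarrow> real \<Rightarrow> complex" where
  "time_mult T a = (1 / T) *\<^sub>R (LINT t:{0..T}|lborel. cis (t * a))"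

lemma time_mult_0: "T > 0 \<Longrightarrow> time_mult T 0 = 1"
  by (simp add: time_mult_def set_integral_const scaleR_conv_of_real)

lemma norm_time_mult_le:
  assumes "T > 0" "a \<noteq> 0"
  shows "cmod (time_mult T a) \<le> 2 / (T * \<bar>a\<bar>)"
proof -
  have "((\<lambda>t. cis (t * a) / (\<i> * a)) has_vector_derivative cis (t * a)) (at t within {0..T})" for t
  proof -
    have ii: "- (\<i> * (x * \<i>)) = x" for x by (simp add: complex_eq_iff)
    have "((\<lambda>z. exp (\<i> * (z * a)) / (\<i> * a)) has_field_derivative exp (\<i> * (complex_of_real t * a))) (at (complex_of_real t))"
      using assms by (auto intro!: derivative_eq_intros simp: ii)
    from has_vector_derivative_real_field[OF this] show ?thesis
      by (simp add: cis_conv_exp)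
  qed
  moreover have "continuous_on {0..T} (\<lambda>t. cis (t * a))"
    by (intro continuous_intros)
  ultimately have "(LINT t:{0..T}|lborel. cis (t * a)) = cis (T * a) / (\<i> * a) - cis (0 * a) / (\<i> * a)"
    unfolding set_lebesgue_integral_def using assms by (intro integral_FTC_atLeastAtMost) auto
  also have "\<dots> = (cis (T * a) - 1) / (\<i> * a)"
    by (simp add: diff_divide_distrib)
  finally have "cmod (time_mult T a) = cmod (cis (T * a) - 1) / (T * \<bar>a\<bar>)"
    using assms by (simp add: time_mult_def norm_divide norm_mult)
  moreover have "cmod (cis (T * a) - 1) \<le> 2"
    using norm_triangle_ineq4[of "cis (T * a)" 1] by simp
  ultimately show ?thesis using assms by (simp add: divide_right_mono)
qed

lemma time_mult_tendsto: "((\<lambda>T. time_mult T a) \<longlongrightarrow> of_bool (a = 0)) at_top"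
proof (cases "a = 0")
  case True
  have "eventually (\<lambda>T. time_mult T a = 1) at_top"
    using eventually_gt_at_top[of 0] by eventually_elim (simp add: True time_mult_0)
  then show ?thesis using True by (simp add: tendsto_eventually)
next
  case False
  have "((\<lambda>T. 2 / (T * \<bar>a\<bar>)) \<longlongrightarrow> 0) at_top"
    using False by real_asymp
  moreover have "eventually (\<lambda>T. cmod (time_mult T a) \<le> 2 / (T * \<bar>a\<bar>)) at_top"
    using eventually_gt_at_top[of 0] by eventually_elim (simp add: False norm_time_mult_le)
  ultimately show ?thesis using False by (simp add: Lim_null_comparison)
qed

lemma trig_poly_continuous: "trig_poly p \<Longrightarrow> continuous_on S p"
  by (induction rule: trig_poly.induct) (auto intro!: continuous_intros)

lemma trig_poly_mean:
  assumes "trig_poly p"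
  shows "\<exists>L. ((\<lambda>T. (1 / T) *\<^sub>R (LINT t:{0..T}|lborel. p (\<phi> + t *\<^sub>R v))) \<longlongrightarrow> L) at_top"
  using assms
proof induction
  case (cis c k)
  have "(1 / T) *\<^sub>R (LINT t:{0..T}|lborel. c * cis (ivec k \<bullet> (\<phi> + t *\<^sub>R v)))
      = c * cis (ivec k \<bullet> \<phi>) * time_mult T (ivec k \<bullet> v)" for T
  proof -
    have "(LINT t:{0..T}|lborel. c * cis (ivec k \<bullet> (\<phi> + t *\<^sub>R v)))
       = (LINT t:{0..T}|lborel. (c * cis (ivec k \<bullet> \<phi>)) * cis (t * (ivec k \<bullet> v)))"
      by (simp add: inner_add_right mult.assoc flip: cis_mult)
    then show ?thesis by (simp add: time_mult_def)
  qed
  then show ?case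
    using tendsto_mult[OF tendsto_const time_mult_tendsto[of "ivec k \<bullet> v"]] by auto
next
  case (add p q)
  then obtain L L' where L: "((\<lambda>T. (1 / T) *\<^sub>R (LINT t:{0..T}|lborel. p (\<phi> + t *\<^sub>R v))) \<longlongrightarrow> L) at_top"
    "((\<lambda>T. (1 / T) *\<^sub>R (LINT t:{0..T}|lborel. q (\<phi> + t *\<^sub>R v))) \<longlongrightarrow> L') at_top" by blast
  have "(LINT t:{0..T}|lborel. p (\<phi> + t *\<^sub>R v) + q (\<phi> + t *\<^sub>R v))
      = (LINT t:{0..T}|lborel. p (\<phi> + t *\<^sub>R v)) + (LINT t:{0..T}|lborel. q (\<phi> + t *\<^sub>R v))" for T
    using add.hyps
    by (intro set_integral_add set_integrable_continuous_Icc continuous_on_compose2[OF trig_poly_continuous[of _ UNIV]])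
      (auto intro!: continuous_intros)
  then show ?case using tendsto_add[OF L] by (auto simp: scaleR_add_right)
qed

definition time_mean :: "(real^'n \<Rightarrow> real) \<Rightarrow> real^'n \<Rightarrow> real \<Rightarrow> real^'n \<Rightarrow> real" where
  "time_mean F v T \<phi> = (1 / T) * (LINT t:{0..T}|lborel. F (\<phi> + t *\<^sub>R v))"

text \<open>For a trigonometric polynomial the means converge harmonic by harmonic. Averaging does
  not increase the sup distance, so uniform approximation carries the convergence over to F.\<close>

lemma time_mean_convergent:
  fixes F :: "real^'n \<Rightarrow> real"
  assumes per: "periodic F" and cont: "continuous_on UNIV F"
  shows "\<exists>L. ((\<lambda>T. time_mean F v T \<phi>) \<longlongrightarrow> L) at_top"
proof -
  let ?F = "\<lambda>t. complex_of_real (F (\<phi> + t *\<^sub>R v))"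
  have "\<exists>p. trig_poly p \<and> (\<forall>\<phi>. cmod (complex_of_real (F \<phi>) - p \<phi>) < 1 / Suc n)" for n
    using trig_poly_approx[OF per cont, of "1 / Suc n"] by (metis of_nat_0_less_iff zero_less_Suc zero_less_divide_1_iff)
  then obtain p where p: "\<And>n. trig_poly (p n)" "\<And>n \<phi>. cmod (complex_of_real (F \<phi>) - p n \<phi>) < 1 / Suc n"
    by metis
  let ?p = "\<lambda>n t. p n (\<phi> + t *\<^sub>R v)"
  define m where "m n T = (1 / T) *\<^sub>R (LINT t:{0..T}|lborel. ?p n t)" for n T
  define h where "h T = complex_of_real (time_mean F v T \<phi>)" for T
  \<comment> \<open>The estimate is uniform in T, which permits the exchange of the limits in n and
    T.\<close>
  have close: "cmod (m n T - h T) \<le> 1 / Suc n" if "T > 0" for n T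
  proof -
    have i1: "set_integrable lborel {0..T} (\<lambda>t. ?p n t)"
      by (intro set_integrable_continuous_Icc continuous_on_compose2[OF trig_poly_continuous[OF p(1)[of n], of UNIV]])
        (auto intro!: continuous_intros)
    have i2: "set_integrable lborel {0..T} (\<lambda>t. ?F t)"
      by (intro set_integrable_continuous_Icc continuous_on_of_real continuous_on_compose2[OF cont])
        (auto intro!: continuous_intros)
    have "h T = (1 / T) *\<^sub>R (LINT t:{0..T}|lborel. ?F t)"
      by (simp add: h_def time_mean_def set_integral_complex_of_real scaleR_conv_of_real)
    then have "m n T - h T = (1 / T) *\<^sub>R (LINT t:{0..T}|lborel. ?p n t - ?F t)"
      by (simp add: m_def set_integral_diff[OF i1 i2] scaleR_diff_right)
    also have "cmod \<dots> \<le> (1 / T) * (LINT t:{0..T}|lborel. 1 / Suc n)"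
    proof -
      have "cmod (LINT t:{0..T}|lborel. ?p n t - ?F t)
         \<le> (LINT t:{0..T}|lborel. cmod (?p n t - ?F t))"
        using set_integral_diff(1)[OF i1 i2] by (rule set_integral_norm_bound)
      also have "\<dots> \<le> (LINT t:{0..T}|lborel. 1 / Suc n)"
      proof (rule set_integral_mono)
        show "set_integrable lborel {0..T} (\<lambda>t. cmod (?p n t - ?F t))"
          using set_integral_diff(1)[OF i1 i2] by (rule set_integrable_norm)
        show "set_integrable lborel {0..T} (\<lambda>t. 1 / real (Suc n))"
          by (rule set_integrable_continuous_Icc) simp
        show "cmod (?p n t - ?F t) \<le> 1 / real (Suc n)" for t
          using p(2)[of "\<phi> + t *\<^sub>R v" n] by (simp add: norm_minus_commute)
      qed
      finally show ?thesis using that unfolding norm_scaleR by (intro mult_mono) auto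
    qed
    also have "\<dots> = 1 / Suc n" using that by (simp add: set_integral_const)
    finally show ?thesis .
  qed
  obtain L where L: "\<And>n. (m n \<longlongrightarrow> L n) at_top"
  proof -
    have "\<forall>n. \<exists>L. (m n \<longlongrightarrow> L) at_top"
      unfolding m_def using trig_poly_mean[OF p(1)] by blast
    from choice[OF this] show ?thesis using that by blast
  qed
  \<comment> \<open>Letting T tend to infinity in the distance of two approximating means shows that
    their limits form a Cauchy sequence.\<close>
  have LL: "cmod (L a - L b) \<le> 1 / Suc a + 1 / Suc b" for a b
  proof (rule tendsto_upperbound)
    show "((\<lambda>T. cmod (m a T - m b T)) \<longlongrightarrow> cmod (L a - L b)) at_top"
      by (intro tendsto_intros L)
    show "\<forall>\<^sub>F T in at_top. cmod (m a T - m b T) \<le> 1 / Suc a + 1 / Suc b"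
      using eventually_gt_at_top[of 0]
    proof eventually_elim
      case (elim T)
      show ?case
        using norm_triangle_ineq4[of "m a T - h T" "m b T - h T"] close[OF elim, of a] close[OF elim, of b]
        by simp
    qed
  qed simp
  have inv: "\<exists>N. \<forall>n\<ge>N. 1 / real (Suc n) < e" if "e > 0" for e
  proof -
    obtain N where "1 / real (Suc N) < e"
      using reals_Archimedean[OF \<open>e > 0\<close>] by (auto simp: inverse_eq_divide)
    moreover have "1 / real (Suc n) \<le> 1 / real (Suc N)" if "n \<ge> N" for n
      using that by (simp add: frac_le)
    ultimately show ?thesis by (meson le_less_trans)
  qed
  have "Cauchy L"
  proof (rule metric_CauchyI)
    fix e :: real assume "e > 0"
    then obtain N where N: "\<forall>n\<ge>N. 1 / real (Suc n) < e / 2" using inv[of "e / 2"] by auto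
    have "dist (L a) (L b) < e" if "a \<ge> N" "b \<ge> N" for a b
      using LL[of a b] N that by (smt (verit) dist_norm field_sum_of_halves)
    then show "\<exists>N. \<forall>a\<ge>N. \<forall>b\<ge>N. dist (L a) (L b) < e" by blast
  qed
  then obtain l where "L \<longlonglongrightarrow> l" using convergent_eq_Cauchy convergent_def by blast
  moreover have "uniform_limit {0<..} m h sequentially"
  proof (rule uniform_limitI)
    fix e :: real assume "e > 0"
    then obtain N where N: "\<forall>n\<ge>N. 1 / real (Suc n) < e" using inv by blast
    then have "\<forall>n\<ge>N. \<forall>T\<in>{0<..}. dist (m n T) (h T) < e"
      using close by (metis dist_norm greaterThan_iff le_less_trans)
    then show "\<forall>\<^sub>F n in sequentially. \<forall>T\<in>{0<..}. dist (m n T) (h T) < e"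
      by (auto simp: eventually_sequentially)
  qed
  ultimately have "(h \<longlongrightarrow> l) at_top"
    using L by (intro swap_uniform_limit'[of m L at_top sequentially l "{0<..}" h])
      (auto simp: eventually_gt_at_top)
  from tendsto_Re[OF this] show ?thesis by (auto simp: h_def)
qed

section \<open>Fourier coefficients of averaged functions of the angle\<close>

definition torus_coeff :: "(real^'n \<Rightarrow> real) \<Rightarrow> int^'n \<Rightarrow> complex" where
  "torus_coeff F k = (1 / (2 * pi) ^ CARD('n)) *\<^sub>R
     (LINT \<phi>:cube|lborel. complex_of_real (F \<phi>) * cis (- (ivec k \<bullet> \<phi>)))"

lemma fourier_coeff_eq: "fourier_coeff u k I = torus_coeff (\<lambda>\<phi>. u (I, \<phi>)) k"
  by (simp add: fourier_coeff_def torus_coeff_def cube_def)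

lemma sets_cube [measurable]: "cube \<in> sets (borel :: (real^'n) measure)"
  by (simp add: cube_def)

lemma periodic_cis: "periodic (\<lambda>\<phi>. cis (- (ivec k \<bullet> \<phi>)))"
  unfolding periodic_def
proof (intro allI)
  fix \<phi> :: "real^'a" and j
  have "cis (- (2 * pi * real_of_int (k $ j))) = 1"
    using cis_multiple_2pi[of "- real_of_int (k $ j)"] by simp
  then show "cis (- (ivec k \<bullet> (\<phi> + (2 * pi) *\<^sub>R axis j 1))) = cis (- (ivec k \<bullet> \<phi>))"
    using cis_mult[of "- (ivec k \<bullet> \<phi>)" "- (2 * pi * real_of_int (k $ j))"]
    by (simp add: inner_add_right inner_axis ivec_def)
qed

text \<open>After Fubini, the angle is shifted by X y: the integral over a period does not change,
  and the harmonic releases the factor \<open>cis (ivec k \<bullet> X y)\<close>. The distribution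
  of X stays arbitrary, so one argument covers all averages.\<close>

lemma torus_coeff_average:
  fixes F :: "real^'n \<Rightarrow> real"
  assumes N: "finite_measure N" and X [measurable]: "X \<in> borel_measurable N"
    and per: "periodic F" and cont: "continuous_on UNIV F"
  shows "torus_coeff (\<lambda>\<phi>. \<integral>y. F (\<phi> + X y) \<partial>N) k = (\<integral>y. cis (ivec k \<bullet> X y) \<partial>N) * torus_coeff F k"
proof -
  let ?k = "\<lambda>\<phi>. cis (- (ivec k \<bullet> \<phi>))"
  interpret N: finite_measure N by fact
  interpret pair_sigma_finite lborel N ..
  obtain M where M: "\<And>\<phi>. \<bar>F \<phi>\<bar> \<le> M"
    using periodic_continuous_bounded[OF per cont] by auto
  have [measurable]: "F \<in> borel_measurable borel"
    using cont by (rule borel_measurable_continuous_onI)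
  define H where "H \<phi> = complex_of_real (F \<phi>) * ?k \<phi>" for \<phi>
  have H: "periodic H" "continuous_on UNIV H"
    using per periodic_cis[of k] cont unfolding H_def periodic_def
    by (auto intro!: continuous_intros)
  define K where "K \<phi> y = indicator cube \<phi> *\<^sub>R (complex_of_real (F (\<phi> + X y)) * ?k \<phi>)" for \<phi> y
  have "integrable (lborel \<Otimes>\<^sub>M N) (case_prod K)"
  proof (rule integrableI_bounded_set[where A = "cube \<times> space N" and B = M])
    show "cube \<times> space N \<in> sets (lborel \<Otimes>\<^sub>M N)" by measurable
    show "case_prod K \<in> borel_measurable (lborel \<Otimes>\<^sub>M N)"
      unfolding K_def cis_conv_exp by measurable
    have "emeasure lborel (cube :: (real^'n) set) < \<infinity>"
      by (rule emeasure_bounded_finite) (simp add: compact_imp_bounded compact_cube)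
    moreover have "emeasure N (space N) < \<infinity>"
      using N.emeasure_finite[of "space N"] unfolding infinity_ennreal_def less_top .
    moreover have "emeasure (lborel \<Otimes>\<^sub>M N) ((cube :: (real^'n) set) \<times> space N)
        = emeasure lborel (cube :: (real^'n) set) * emeasure N (space N)"
      by (rule N.emeasure_pair_measure_Times) auto
    ultimately show "emeasure (lborel \<Otimes>\<^sub>M N) ((cube :: (real^'n) set) \<times> space N) < \<infinity>"
      unfolding infinity_ennreal_def by (simp only: ennreal_mult_less_top simp_thms)
    show "AE x\<in>cube \<times> space N in lborel \<Otimes>\<^sub>M N. norm (case x of (\<phi>, y) \<Rightarrow> K \<phi> y) \<le> M"
      using M by (auto simp: K_def norm_mult)
    show "AE x in lborel \<Otimes>\<^sub>M N. x \<notin> cube \<times> space N \<longrightarrow> (case x of (\<phi>, y) \<Rightarrow> K \<phi> y) = 0"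
      by (rule AE_I2) (auto simp: K_def space_pair_measure indicator_def)
  qed
  from Fubini_integral[OF this]
  have "(\<integral>\<phi>. \<integral>y. K \<phi> y \<partial>N \<partial>lborel) = (\<integral>y. \<integral>\<phi>. K \<phi> y \<partial>lborel \<partial>N)" ..
  also have "(\<lambda>\<phi>. \<integral>y. K \<phi> y \<partial>N) = (\<lambda>\<phi>. indicator cube \<phi> *\<^sub>R (complex_of_real (\<integral>y. F (\<phi> + X y) \<partial>N) * ?k \<phi>))"
    unfolding K_def by simp
  also have "(\<lambda>y. \<integral>\<phi>. K \<phi> y \<partial>lborel) = (\<lambda>y. cis (ivec k \<bullet> X y) * (LINT \<phi>:cube|lborel. H \<phi>))"
  proof
    fix y
    have "(\<integral>\<phi>. K \<phi> y \<partial>lborel) = (LINT \<phi>:cube|lborel. cis (ivec k \<bullet> X y) * H (\<phi> + X y))"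
      unfolding set_lebesgue_integral_def K_def H_def
      by (rule Bochner_Integration.integral_cong)
        (auto simp: inner_add_right cis_mult)
    also have "\<dots> = cis (ivec k \<bullet> X y) * (LINT \<phi>:cube|lborel. H (\<phi> + X y))" by simp
    also have "(LINT \<phi>:cube|lborel. H (\<phi> + X y)) = (LINT \<phi>:cube|lborel. H \<phi>)"
      by (rule integral_cube_shift[OF H])
    finally show "(\<integral>\<phi>. K \<phi> y \<partial>lborel) = cis (ivec k \<bullet> X y) * (LINT \<phi>:cube|lborel. H \<phi>)" .
  qed
  finally show ?thesis
    unfolding torus_coeff_def H_def set_lebesgue_integral_def by simp
qed

text \<open>Boundedness and measurability survive pointwise limits, so the long-time average may be
  subtracted here.\<close>

lemma torus_coeff_diff:
  fixes F G :: "real^'n \<Rightarrow> real"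
  assumes "F \<in> borel_measurable borel" "\<And>\<phi>. \<bar>F \<phi>\<bar> \<le> M"
    and "G \<in> borel_measurable borel" "\<And>\<phi>. \<bar>G \<phi>\<bar> \<le> M'"
  shows "torus_coeff (\<lambda>\<phi>. F \<phi> - G \<phi>) k = torus_coeff F k - torus_coeff G k"
proof -
  have int: "set_integrable lborel cube (\<lambda>\<phi>. complex_of_real (F \<phi>) * cis (- (ivec k \<bullet> \<phi>)))"
    if "F \<in> borel_measurable borel" "\<And>\<phi>. \<bar>F \<phi>\<bar> \<le> M" for F M
  proof (rule set_integrable_bounded)
    show "(\<lambda>\<phi>. complex_of_real (F \<phi>) * cis (- (ivec k \<bullet> \<phi>))) \<in> borel_measurable borel"
      using that(1) unfolding cis_conv_exp by measurable
    show "norm (complex_of_real (F \<phi>) * cis (- (ivec k \<bullet> \<phi>))) \<le> M" for \<phi>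
      using that(2) by (simp add: norm_mult)
  qed (auto simp: compact_imp_bounded compact_cube)
  show ?thesis
    unfolding torus_coeff_def
    by (simp add: left_diff_distrib set_integral_diff(2)[OF int[OF assms(1,2)] int[OF assms(3,4)]] scaleR_diff_right)
qed

lemma average_bounded:
  fixes F :: "real^'n \<Rightarrow> real"
  assumes "prob_space N" "\<And>\<phi>. \<bar>F \<phi>\<bar> \<le> M"
  shows "\<bar>\<integral>y. F (\<phi> + X y) \<partial>N\<bar> \<le> M"
proof -
  interpret prob_space N by fact
  show ?thesis
  proof (cases "integrable N (\<lambda>y. F (\<phi> + X y))")
    case True
    have "\<bar>\<integral>y. F (\<phi> + X y) \<partial>N\<bar> \<le> (\<integral>y. \<bar>F (\<phi> + X y)\<bar> \<partial>N)"
      by (rule integral_abs_bound)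
    also have "\<dots> \<le> (\<integral>y. M \<partial>N)"
      using True assms(2) by (intro integral_mono) auto
    also have "\<dots> = M" by (simp add: prob_space)
    finally show ?thesis .
  next
    case False
    \<comment> \<open>A non-integrable function has integral 0 by convention, and 0 \<le> M because
      M bounds an absolute value.\<close>
    then show ?thesis using assms(2)[of 0] by (simp add: not_integrable_integral_eq)
  qed
qed

lemma average_measurable:
  fixes F :: "real^'n \<Rightarrow> real"
  assumes "prob_space N" and [measurable]: "X \<in> borel_measurable N" "F \<in> borel_measurable borel"
  shows "(\<lambda>\<phi>. \<integral>y. F (\<phi> + X y) \<partial>N) \<in> borel_measurable borel"
proof -
  interpret prob_space N by fact
  show ?thesis by measurable
qed

section \<open>The time average as an expectation over a uniform time, and its limit\<close>

definition unif :: "real \<Rightarrow> real measure" where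
  "unif T = density lborel (\<lambda>t. ennreal (indicator {0..T} t / T))"

lemma prob_space_unif: "T > 0 \<Longrightarrow> prob_space (unif T)"
proof (rule prob_spaceI)
  assume "T > 0"
  have "emeasure (unif T) (space (unif T)) = (\<integral>\<^sup>+t. ennreal (1 / T) * indicator {0..T} t \<partial>lborel)"
    unfolding unif_def by (subst emeasure_density) (auto intro!: nn_integral_cong simp: indicator_def)
  also have "\<dots> = 1"
    using \<open>T > 0\<close> by (simp add: nn_integral_cmult_indicator flip: ennreal_mult)
  finally show "emeasure (unif T) (space (unif T)) = 1" .
qed

lemma integral_unif:
  fixes F :: "real \<Rightarrow> 'b::{banach,second_countable_topology}"
  assumes "T > 0" "F \<in> borel_measurable borel"
  shows "(\<integral>t. F t \<partial>unif T) = (1 / T) *\<^sub>R (LINT t:{0..T}|lborel. F t)"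
proof -
  have "(\<integral>t. F t \<partial>unif T) = (\<integral>t. (indicator {0..T} t / T) *\<^sub>R F t \<partial>lborel)"
    unfolding unif_def using assms by (intro integral_density) auto
  also have "\<dots> = (\<integral>t. (1 / T) *\<^sub>R (indicator {0..T} t *\<^sub>R F t) \<partial>lborel)"
    by (simp add: divide_inverse mult.commute)
  also have "\<dots> = (1 / T) *\<^sub>R (\<integral>t. indicator {0..T} t *\<^sub>R F t \<partial>lborel)"
    by (rule integral_scaleR_right)
  finally show ?thesis unfolding set_lebesgue_integral_def .
qed

lemma sets_unif [measurable_cong]: "sets (unif T) = sets borel"
  by (simp add: unif_def)

lemma time_mean_eq_average:
  assumes "T > 0" "continuous_on UNIV F"
  shows "time_mean F v T \<phi> = (\<integral>t. F (\<phi> + t *\<^sub>R v) \<partial>unif T)"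
  unfolding time_mean_def using assms
  by (subst integral_unif) (auto intro!: borel_measurable_continuous_onI continuous_on_compose2[OF assms(2)] continuous_intros)

lemma torus_coeff_time_mean:
  assumes "T > 0" "periodic F" "continuous_on UNIV F"
  shows "torus_coeff (time_mean F v T) k = time_mult T (ivec k \<bullet> v) * torus_coeff F k"
proof -
  interpret prob_space "unif T" using prob_space_unif assms(1) .
  have "torus_coeff (time_mean F v T) k = torus_coeff (\<lambda>\<phi>. \<integral>t. F (\<phi> + t *\<^sub>R v) \<partial>unif T) k"
    using assms by (intro arg_cong2[where f = torus_coeff]) (auto simp: time_mean_eq_average)
  also have "\<dots> = (\<integral>t. cis (ivec k \<bullet> (t *\<^sub>R v)) \<partial>unif T) * torus_coeff F k"
    using assms by (intro torus_coeff_average) (auto intro: finite_measure_axioms)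
  also have "(\<integral>t. cis (ivec k \<bullet> (t *\<^sub>R v)) \<partial>unif T) = time_mult T (ivec k \<bullet> v)"
    using assms(1) by (subst integral_unif) (auto simp: time_mult_def cis_conv_exp)
  finally show ?thesis .
qed

definition long_mean :: "(real^'n \<Rightarrow> real) \<Rightarrow> real^'n \<Rightarrow> real^'n \<Rightarrow> real" where
  "long_mean F v \<phi> = Lim at_top (\<lambda>T. time_mean F v T \<phi>)"

lemma time_mean_tendsto_long_mean:
  assumes "periodic F" "continuous_on UNIV F"
  shows "((\<lambda>T. time_mean F v T \<phi>) \<longlongrightarrow> long_mean F v \<phi>) at_top"
  using time_mean_convergent[OF assms, of v \<phi>] unfolding long_mean_def
  by (metis tendsto_Lim trivial_limit_at_top_linorder)

lemma time_mean_props: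
  assumes "T > 0" "continuous_on UNIV F" "\<And>\<phi>. \<bar>F \<phi>\<bar> \<le> M"
  shows "time_mean F v T \<in> borel_measurable borel" "\<bar>time_mean F v T \<phi>\<bar> \<le> M"
proof -
  have eq: "time_mean F v T = (\<lambda>\<phi>. \<integral>t. F (\<phi> + t *\<^sub>R v) \<partial>unif T)"
    using time_mean_eq_average[OF assms(1,2)] by auto
  show "time_mean F v T \<in> borel_measurable borel"
    unfolding eq using assms by (intro average_measurable prob_space_unif borel_measurable_continuous_onI) auto
  show "\<bar>time_mean F v T \<phi>\<bar> \<le> M"
    unfolding eq using assms by (intro average_bounded prob_space_unif) auto
qed

lemma long_mean_props:
  assumes "periodic F" "continuous_on UNIV F" "\<And>\<phi>. \<bar>F \<phi>\<bar> \<le> M"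
  shows "long_mean F v \<in> borel_measurable borel" "\<bar>long_mean F v \<phi>\<bar> \<le> M"
proof -
  \<comment> \<open>Measurability passes to limits of sequences, so T runs through the positive
    integers.\<close>
  have "(\<lambda>n. time_mean F v (real (Suc n)) \<phi>) \<longlonglongrightarrow> long_mean F v \<phi>" for \<phi>
    by (rule filterlim_compose[OF time_mean_tendsto_long_mean[OF assms(1,2)]])
      (rule filterlim_compose[OF filterlim_real_sequentially filterlim_Suc])
  then show "long_mean F v \<in> borel_measurable borel"
  proof (rule borel_measurable_LIMSEQ_metric[rotated])
    show "time_mean F v (real (Suc n)) \<in> borel_measurable borel" for n
      by (rule time_mean_props(1)[OF _ assms(2,3)]) simp
  qed
  have "\<forall>\<^sub>F T in at_top. \<bar>time_mean F v T \<phi>\<bar> \<le> M"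
    using eventually_gt_at_top[of 0] by eventually_elim (rule time_mean_props(2)[OF _ assms(2,3)])
  then show "\<bar>long_mean F v \<phi>\<bar> \<le> M"
    by (rule tendsto_upperbound[OF tendsto_rabs[OF time_mean_tendsto_long_mean[OF assms(1,2), of v \<phi>]]]) simp
qed

text \<open>Dominated convergence along integer times moves the limit through the coefficient. What
  remains is the limit of the multiplier, the indicator of the resonance.\<close>

lemma torus_coeff_long_mean:
  fixes F :: "real^'n \<Rightarrow> real"
  assumes per: "periodic F" and cont: "continuous_on UNIV F"
  shows "torus_coeff (long_mean F v) k = of_bool (ivec k \<bullet> v = 0) * torus_coeff F k"
proof -
  let ?m = "\<lambda>n. time_mean F v (real (Suc n))"
  let ?k = "\<lambda>\<phi>. cis (- (ivec k \<bullet> \<phi>))"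
  obtain M where M: "\<And>\<phi>. \<bar>F \<phi>\<bar> \<le> M"
    using periodic_continuous_bounded[OF per cont] by auto
  have lim: "(\<lambda>n. G (real (Suc n))) \<longlonglongrightarrow> L" if "(G \<longlongrightarrow> L) at_top" for G :: "real \<Rightarrow> 'c::topological_space" and L
    by (rule filterlim_compose[OF that]) (rule filterlim_compose[OF filterlim_real_sequentially filterlim_Suc])
  have [measurable]: "long_mean F v \<in> borel_measurable borel" "\<And>n. ?m n \<in> borel_measurable borel"
    using time_mean_props(1)[OF _ cont M] long_mean_props(1)[OF per cont M] by auto
  have "(\<lambda>n. \<integral>\<phi>. indicator cube \<phi> *\<^sub>R (complex_of_real (?m n \<phi>) * ?k \<phi>) \<partial>lborel)
     \<longlonglongrightarrow> (\<integral>\<phi>. indicator cube \<phi> *\<^sub>R (complex_of_real (long_mean F v \<phi>) * ?k \<phi>) \<partial>lborel)"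
  proof (rule integral_dominated_convergence[where w = "\<lambda>\<phi>. indicator cube \<phi> * M"])
    show "integrable lborel (\<lambda>\<phi>::real^'n. indicator cube \<phi> * M :: real)"
      using borel_integrable_compact[of "cube :: (real^'n) set" "\<lambda>_. M"] compact_cube by simp
    show "AE \<phi> in lborel. (\<lambda>n. indicator cube \<phi> *\<^sub>R (complex_of_real (?m n \<phi>) * ?k \<phi>))
        \<longlonglongrightarrow> indicator cube \<phi> *\<^sub>R (complex_of_real (long_mean F v \<phi>) * ?k \<phi>)"
      by (intro AE_I2 tendsto_intros lim[OF time_mean_tendsto_long_mean[OF per cont]])
    show "AE \<phi> in lborel. norm (indicator cube \<phi> *\<^sub>R (complex_of_real (?m n \<phi>) * ?k \<phi>))
        \<le> indicator cube \<phi> * M" for n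
      using time_mean_props(2)[OF _ cont M, of "real (Suc n)" v] by (intro AE_I2) (auto simp: norm_mult indicator_def)
  qed (unfold cis_conv_exp, measurable)
  then have "(\<lambda>n. torus_coeff (?m n) k) \<longlonglongrightarrow> torus_coeff (long_mean F v) k"
    unfolding torus_coeff_def set_lebesgue_integral_def by (rule tendsto_scaleR[OF tendsto_const])
  moreover have "(\<lambda>n. torus_coeff (?m n) k) = (\<lambda>n. time_mult (real (Suc n)) (ivec k \<bullet> v) * torus_coeff F k)"
    by (rule ext, rule torus_coeff_time_mean[OF _ per cont]) simp
  moreover have "(\<lambda>n. time_mult (real (Suc n)) (ivec k \<bullet> v) * torus_coeff F k) \<longlonglongrightarrow> of_bool (ivec k \<bullet> v = 0) * torus_coeff F k"
    by (intro tendsto_intros lim[OF time_mult_tendsto])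
  ultimately show ?thesis using LIMSEQ_unique by metis
qed

text \<open>Applied below to a uniform time, to an exponential time, and to the product of the
  Wiener space with an exponential time.\<close>

lemma torus_coeff_average_diff:
  fixes F :: "real^'n \<Rightarrow> real"
  assumes N: "prob_space N" and X: "X \<in> borel_measurable N"
    and per: "periodic F" and cont: "continuous_on UNIV F"
  shows "torus_coeff (\<lambda>\<phi>. (\<integral>y. F (\<phi> + X y) \<partial>N) - long_mean F v \<phi>) k
    = ((\<integral>y. cis (ivec k \<bullet> X y) \<partial>N) - of_bool (ivec k \<bullet> v = 0)) * torus_coeff F k"
proof -
  interpret prob_space N by fact
  obtain M where M: "\<And>\<phi>. \<bar>F \<phi>\<bar> \<le> M"
    using periodic_continuous_bounded[OF per cont] by auto
  have "torus_coeff (\<lambda>\<phi>. (\<integral>y. F (\<phi> + X y) \<partial>N) - long_mean F v \<phi>) k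
     = torus_coeff (\<lambda>\<phi>. \<integral>y. F (\<phi> + X y) \<partial>N) k - torus_coeff (long_mean F v) k"
    by (rule torus_coeff_diff[OF average_measurable[OF N X] average_bounded[OF N M] long_mean_props(1)[OF per cont M]
        long_mean_props(2)[OF per cont M]]) (rule borel_measurable_continuous_onI[OF cont])
  then show ?thesis
    by (simp add: torus_coeff_average[OF finite_measure_axioms X per cont] torus_coeff_long_mean[OF per cont] left_diff_distrib)
qed

section \<open>Exponential clocks and the Wiener process\<close>

definition expo :: "real \<Rightarrow> real measure" where
  "expo \<mu> = density lborel (\<lambda>t. ennreal (exponential_density \<mu> t))"

lemma prob_space_expo: "\<mu> > 0 \<Longrightarrow> prob_space (expo \<mu>)"
  unfolding expo_def by (rule prob_space_exponential_density)

lemma sets_expo [measurable_cong]: "sets (expo \<mu>) = sets borel"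
  by (simp add: expo_def)

text \<open>The law of the Wiener process is prescribed through increments over intervals of
  positive length, so time 0 has to be excluded.\<close>

lemma AE_expo_pos: "AE t in expo \<mu>. t > 0"
  unfolding expo_def using AE_lborel_singleton[of "0::real"]
  by (subst AE_density) (auto simp: exponential_density_def)

lemma integral_expo:
  fixes F :: "real \<Rightarrow> 'b::{banach,second_countable_topology}"
  assumes "\<mu> > 0" "F \<in> borel_measurable borel"
  shows "(\<integral>t. F t \<partial>expo \<mu>) = \<mu> *\<^sub>R (LINT t:{0..}|lborel. exp (- \<mu> * t) *\<^sub>R F t)"
proof -
  have "(\<integral>t. F t \<partial>expo \<mu>) = (\<integral>t. exponential_density \<mu> t *\<^sub>R F t \<partial>lborel)"
    unfolding expo_def using assms
    by (intro integral_density) (auto simp: exponential_density_nonneg)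
  also have "\<dots> = (\<integral>t. \<mu> *\<^sub>R (indicator {0..} t *\<^sub>R (exp (- \<mu> * t) *\<^sub>R F t)) \<partial>lborel)"
    by (rule Bochner_Integration.integral_cong) (auto simp: exponential_density_def indicator_def mult.commute)
  also have "\<dots> = \<mu> *\<^sub>R (\<integral>t. indicator {0..} t *\<^sub>R (exp (- \<mu> * t) *\<^sub>R F t) \<partial>lborel)"
    by (rule integral_scaleR_right)
  finally show ?thesis unfolding set_lebesgue_integral_def .
qed

text \<open>The antiderivative is - exp(- z t) / z, which vanishes at infinity because Re z >
  0.\<close>

lemma integral_exp_complex:
  assumes "Re z > 0"
  shows "(LINT t:{0..}|lborel. exp (- (z * complex_of_real t))) = 1 / z"
proof -
  let ?e = "\<lambda>t. exp (- (z * complex_of_real t))"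
  have z: "z \<noteq> 0" using assms by auto
  have nrm: "norm (?e t) = exp (- Re z * t)" for t
    by (simp add: norm_exp_eq_Re)
  have "integrable lborel (exponential_density (Re z))"
  proof -
    interpret prob_space "density lborel (exponential_density (Re z))"
      using assms by (rule prob_space_exponential_density)
    have "integrable (density lborel (exponential_density (Re z))) (\<lambda>_. 1 :: real)"
      by simp
    then show ?thesis
      using assms by (subst (asm) integrable_density) (auto simp: exponential_density_nonneg)
  qed
  \<comment> \<open>The dominating function: exp(- z t) has modulus exp(- Re z t), which is the
    exponential density of rate Re z divided by Re z.\<close>
  then have "integrable lborel (\<lambda>t. (1 / Re z) * exponential_density (Re z) t)"
    by simp
  then have int: "set_integrable lborel {0<..} (\<lambda>t. ?e t)"
    unfolding set_integrable_def
  proof (rule Bochner_Integration.integrable_bound)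
    show "AE t in lborel. norm (indicator {0<..} t *\<^sub>R ?e t)
        \<le> norm (1 / Re z * exponential_density (Re z) t)"
      using assms by (intro AE_I2) (simp add: indicator_def exponential_density_def nrm mult.commute norm_mult)
  qed measurable
  have "(LBINT t=0..\<infinity>. ?e t) = 0 - (- (1 / z))"
  proof (rule interval_integral_FTC_integrable)
    show "((\<lambda>t. - ?e t / z) has_vector_derivative ?e t) (at t)" for t
    proof -
      have "((\<lambda>w. - exp (- (z * w)) / z) has_field_derivative ?e t) (at (complex_of_real t))"
        using z by (auto intro!: derivative_eq_intros)
      from has_vector_derivative_real_field[OF this] show ?thesis by simp
    qed
    show "isCont (\<lambda>t. ?e t) t" for t
      by (intro continuous_intros)
    show "set_integrable lborel (einterval 0 \<infinity>) (\<lambda>t. ?e t)"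
      using int by (simp add: zero_ereal_def)
    have "isCont (\<lambda>t. - ?e t / z) 0"
      using z by (intro continuous_intros) auto
    then have "((\<lambda>t. - ?e t / z) \<longlongrightarrow> - (1 / z)) (at_right 0)"
      unfolding isCont_def by (auto intro: tendsto_within_subset)
    then show "(((\<lambda>t. - ?e t / z) \<circ> real_of_ereal) \<longlongrightarrow> - (1 / z)) (at_right 0)"
      unfolding zero_ereal_def ereal_tendsto_simps .
    have "((\<lambda>t. - ?e t / z) \<longlongrightarrow> 0) at_top"
    proof (rule tendsto_norm_zero_cancel)
      have "((\<lambda>t. exp (- Re z * t) / cmod z) \<longlongrightarrow> 0) at_top"
        using assms z by real_asymp
      then show "((\<lambda>t. norm (- ?e t / z)) \<longlongrightarrow> 0) at_top"
        by (simp add: norm_divide nrm)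
    qed
    then show "(((\<lambda>t. - ?e t / z) \<circ> real_of_ereal) \<longlongrightarrow> 0) (at_left \<infinity>)"
      unfolding ereal_tendsto_simps .
  qed simp
  then have "(LINT t:{0<..}|lborel. ?e t) = 1 / z"
    by (simp add: zero_ereal_def interval_integral_to_infinity_eq)
  moreover have "(LINT t:{0..}|lborel. ?e t) = (LINT t:{0<..}|lborel. ?e t)"
    unfolding set_lebesgue_integral_def
  proof (rule integral_cong_AE)
    show "AE t in lborel. indicator {0..} t *\<^sub>R ?e t = indicator {0<..} t *\<^sub>R ?e t"
      using AE_lborel_singleton[of "0::real"] by eventually_elim (auto simp: indicator_def)
  qed measurable
  ultimately show ?thesis by simp
qed

text \<open>Discount, damping and oscillation combine into one exponential of rate z = \<mu> + c - i
  a. The case c = 0 serves the discounted average, c = \<nu> |k|^2 the noisy one.\<close>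

lemma integral_expo_damped_cis:
  assumes "\<mu> > 0" "c \<ge> 0"
  shows "(\<integral>t. cis (t * a) * complex_of_real (exp (- (c * t))) \<partial>expo \<mu>)
    = complex_of_real \<mu> / (complex_of_real (\<mu> + c) - \<i> * complex_of_real a)"
proof -
  let ?h = "\<lambda>t. cis (t * a) * complex_of_real (exp (- (c * t)))"
  define z where "z = complex_of_real (\<mu> + c) - \<i> * complex_of_real a"
  have Re: "Re z > 0" using assms by (simp add: z_def)
  have "(\<lambda>t. ?h t) \<in> borel_measurable borel"
    unfolding cis_conv_exp by measurable
  then have "(\<integral>t. ?h t \<partial>expo \<mu>)
     = \<mu> *\<^sub>R (LINT t:{0..}|lborel. exp (- \<mu> * t) *\<^sub>R (?h t))"
    using assms by (intro integral_expo) auto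
  also have "(\<lambda>t. exp (- \<mu> * t) *\<^sub>R (?h t)) = (\<lambda>t. exp (- (z * complex_of_real t)))"
    by (rule ext) (simp add: z_def cis_conv_exp scaleR_conv_of_real algebra_simps flip: exp_of_real exp_add)
  also have "(LINT t:{0..}|lborel. exp (- (z * complex_of_real t))) = 1 / z"
    using integral_exp_complex[OF Re] .
  finally show ?thesis by (simp add: z_def scaleR_conv_of_real)
qed

lemma integral_cis_normal:
  assumes "prob_space P" "\<sigma> > 0" "distributed P lborel X (normal_density 0 \<sigma>)"
  shows "(\<integral>\<omega>. cis (u * X \<omega>) \<partial>P) = complex_of_real (exp (- (u * \<sigma>)\<^sup>2 / 2))"
proof -
  interpret prob_space P by fact
  have D: "distributed P lborel (\<lambda>x. (X x - 0) / \<sigma>) std_normal_density"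
    using assms(3) by (subst (asm) normal_standard_normal_convert[OF assms(2)])
  then have d: "distr P lborel (\<lambda>x. X x / \<sigma>) = std_normal_distribution"
    and m [measurable]: "(\<lambda>x. X x / \<sigma>) \<in> borel_measurable P"
    by (auto simp: distributed_def)
  have "(\<integral>\<omega>. cis (u * X \<omega>) \<partial>P) = (\<integral>\<omega>. iexp ((u * \<sigma>) * (X \<omega> / \<sigma>)) \<partial>P)"
    using assms(2) by (simp add: cis_conv_exp)
  also have "\<dots> = (\<integral>x. iexp ((u * \<sigma>) * x) \<partial>distr P lborel (\<lambda>x. X x / \<sigma>))"
    by (subst integral_distr) auto
  also have "\<dots> = char std_normal_distribution (u * \<sigma>)"
    unfolding d by (simp add: char_def)
  finally show ?thesis by (simp add: char_std_normal_distribution)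
qed

lemma wiener_process_char:
  fixes w :: "real \<Rightarrow> 'w \<Rightarrow> real^'n"
  assumes W: "wiener_process P w" and t: "t > 0"
  shows "(\<integral>\<omega>. cis (u \<bullet> w t \<omega>) \<partial>P) = complex_of_real (exp (- ((norm u)\<^sup>2 * t / 2)))"
proof -
  interpret prob_space P using W by (simp add: wiener_process_def)
  \<comment> \<open>Only increments have prescribed distributions. Since \<open>w 0\<close> vanishes
    almost surely, passing to the increment from 0 changes the integrand on a null set only.\<close>
  define X where "X i \<omega> = (w t \<omega> - w 0 \<omega>) $ i" for i \<omega>
  have ind: "indep_vars (\<lambda>_. borel) X UNIV"
    and dist: "\<And>i. distributed P lborel (X i) (normal_density 0 (sqrt t))"
    and zero: "AE \<omega> in P. w 0 \<omega> = 0"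
    and meas [measurable]: "w t \<in> borel_measurable P" "w 0 \<in> borel_measurable P"
    using W t unfolding wiener_process_def X_def by (auto, force+)
  have Xm [measurable]: "X i \<in> borel_measurable P" for i
    unfolding X_def cart_eq_inner_axis by measurable
  have "(\<integral>\<omega>. cis (u \<bullet> w t \<omega>) \<partial>P) = (\<integral>\<omega>. (\<Prod>i\<in>UNIV. cis (u $ i * X i \<omega>)) \<partial>P)"
  proof (rule integral_cong_AE)
    show "(\<lambda>\<omega>. cis (u \<bullet> w t \<omega>)) \<in> borel_measurable P" "(\<lambda>\<omega>. \<Prod>i\<in>UNIV. cis (u $ i * X i \<omega>)) \<in> borel_measurable P"
      unfolding cis_conv_exp by measurable
    have prod: "(\<Prod>i\<in>J. cis (h i)) = cis (\<Sum>i\<in>J. h i)" if "finite J" for h and J :: "'n set"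
      using that by (induction J) (auto simp: cis_mult)
    show "AE \<omega> in P. cis (u \<bullet> w t \<omega>) = (\<Prod>i\<in>UNIV. cis (u $ i * X i \<omega>))"
      using zero by eventually_elim (simp add: prod X_def inner_vec_def)
  qed
  also have "\<dots> = (\<Prod>i\<in>UNIV. \<integral>\<omega>. cis (u $ i * X i \<omega>) \<partial>P)"
  proof (rule indep_vars_lebesgue_integral)
    show "indep_vars (\<lambda>_. borel) (\<lambda>i \<omega>. cis (u $ i * X i \<omega>)) UNIV"
      by (rule indep_vars_compose2[OF ind]) (unfold cis_conv_exp, measurable)
    have "(\<lambda>\<omega>. cis (u $ i * X i \<omega>)) \<in> borel_measurable P" for i
      unfolding cis_conv_exp by measurable
    then show "integrable P (\<lambda>\<omega>. cis (u $ i * X i \<omega>))" for i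
      by (intro integrable_const_bound[where B = 1]) auto
  qed simp
  also have "\<dots> = (\<Prod>i\<in>UNIV. complex_of_real (exp (- (u $ i * sqrt t)\<^sup>2 / 2)))"
    using t by (intro prod.cong refl integral_cis_normal[OF prob_space_axioms _ dist]) auto
  also have "\<dots> = complex_of_real (exp (\<Sum>i\<in>UNIV. - (u $ i * sqrt t)\<^sup>2 / 2))"
    by (simp add: exp_sum)
  also have "(\<Sum>i\<in>UNIV. - (u $ i * sqrt t)\<^sup>2 / 2) = - ((norm u)\<^sup>2 * t / 2)"
  proof -
    have "(norm u)\<^sup>2 = (\<Sum>i\<in>UNIV. (u $ i)\<^sup>2)"
      unfolding power2_norm_eq_inner by (simp add: inner_vec_def power2_eq_square)
    then show ?thesis
      using t by (simp add: power_mult_distrib sum_distrib_right sum_divide_distrib sum_negf)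
  qed
  finally show ?thesis .
qed

text \<open>The clock is \<open>max 0 t\<close> because nothing is assumed about \<open>w t\<close> for \<open>t < 0\<close>. By continuity of the
  paths the process is a limit of processes that are piecewise constant in time.\<close>

lemma wiener_process_jointly_measurable:
  fixes w :: "real \<Rightarrow> 'w \<Rightarrow> real^'n"
  assumes W: "wiener_process P w"
  shows "(\<lambda>(\<omega>, t). w (max 0 t) \<omega>) \<in> borel_measurable (P \<Otimes>\<^sub>M borel)"
proof -
  have meas: "\<And>t. t \<ge> 0 \<Longrightarrow> w t \<in> borel_measurable P"
    and cont: "\<And>\<omega>. \<omega> \<in> space P \<Longrightarrow> continuous_on {0..} (\<lambda>t. w t \<omega>)"
    using W by (auto simp: wiener_process_def)
  \<comment> \<open>Index of the grid point below t for mesh 1 / (n + 1). It takes countably many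
    values, and for each of them the process is measurable in \<omega>; so the step process is
    jointly measurable.\<close>
  define i where "i n t = nat \<lfloor>max 0 t * real (Suc n)\<rfloor>" for n and t :: real
  define W' where "W' n = (\<lambda>(\<omega>, t). w (real (i n t) / real (Suc n)) \<omega>)" for n
  have "W' n \<in> borel_measurable (P \<Otimes>\<^sub>M borel)" for n
  proof -
    have "(\<lambda>x. w (real j / real (Suc n)) (fst x)) \<in> borel_measurable (P \<Otimes>\<^sub>M borel)" for j
      using meas[of "real j / real (Suc n)"] by (intro measurable_compose[OF measurable_fst]) auto
    moreover have "(\<lambda>x. i n (snd x)) \<in> measurable (P \<Otimes>\<^sub>M borel) (count_space UNIV)"
      unfolding i_def by measurable
    ultimately have "(\<lambda>x. w (real (i n (snd x)) / real (Suc n)) (fst x)) \<in> borel_measurable (P \<Otimes>\<^sub>M borel)"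
      by (rule measurable_compose_countable)
    then show ?thesis by (simp add: W'_def case_prod_beta')
  qed
  then show ?thesis
  proof (rule borel_measurable_LIMSEQ_metric)
    fix x assume "x \<in> space (P \<Otimes>\<^sub>M (borel :: real measure))"
    then obtain \<omega> t where x: "x = (\<omega>, t)" "\<omega> \<in> space P" by (auto simp: space_pair_measure)
    define s where "s = max 0 t"
    have s: "s \<ge> 0" by (simp add: s_def)
    have "(\<lambda>n. real (i n t) / real (Suc n)) \<longlonglongrightarrow> s"
    proof (rule real_tendsto_sandwich)
      have *: "s * real (Suc n) - 1 \<le> real (i n t)" "real (i n t) \<le> s * real (Suc n)" for n
        using s unfolding i_def s_def[symmetric] by (simp_all add: of_nat_nat)
      show "\<forall>\<^sub>F n in sequentially. s - 1 / real (Suc n) \<le> real (i n t) / real (Suc n)"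
      proof (intro always_eventually allI)
        show "s - 1 / real (Suc n) \<le> real (i n t) / real (Suc n)" for n
          using divide_right_mono[OF *(1)[of n], of "real (Suc n)"] by (simp add: diff_divide_distrib)
      qed
      show "\<forall>\<^sub>F n in sequentially. real (i n t) / real (Suc n) \<le> s"
      proof (intro always_eventually allI)
        show "real (i n t) / real (Suc n) \<le> s" for n
          using divide_right_mono[OF *(2)[of n], of "real (Suc n)"] by simp
      qed
      have "(\<lambda>n. s - inverse (real (Suc n))) \<longlonglongrightarrow> s - 0"
        by (intro tendsto_intros LIMSEQ_inverse_real_of_nat)
      then show "(\<lambda>n. s - 1 / real (Suc n)) \<longlonglongrightarrow> s" by (simp add: inverse_eq_divide)
    qed simp
    then have "(\<lambda>n. w (real (i n t) / real (Suc n)) \<omega>) \<longlonglongrightarrow> w s \<omega>"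
      using s by (intro continuous_on_tendsto_compose[OF cont[OF x(2)]]) auto
    then show "(\<lambda>n. W' n x) \<longlonglongrightarrow> (case x of (\<omega>, t) \<Rightarrow> w (max 0 t) \<omega>)"
      by (simp add: x W'_def s_def)
  qed
qed

section \<open>Regularity of the Fourier coefficients\<close>

lemma line_has_vector_derivative:
  fixes F :: "'a::euclidean_space \<Rightarrow> 'b::real_normed_vector"
  assumes "F differentiable (at (x + s *\<^sub>R b))"
  shows "((\<lambda>t. F (x + t *\<^sub>R b)) has_vector_derivative frechet_derivative F (at (x + s *\<^sub>R b)) b) (at s within S)"
proof -
  have F: "(F has_derivative frechet_derivative F (at (x + s *\<^sub>R b))) (at (x + s *\<^sub>R b))"
    using assms by (simp add: frechet_derivative_works)
  interpret bounded_linear "frechet_derivative F (at (x + s *\<^sub>R b))"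
    using F by (rule has_derivative_bounded_linear)
  have "((\<lambda>t. x + t *\<^sub>R b) has_derivative (\<lambda>h. h *\<^sub>R b)) (at s within S)"
    by (auto intro!: derivative_eq_intros)
  from has_derivative_compose[OF this F] show ?thesis
    by (simp add: has_vector_derivative_def scaleR)
qed

text \<open>The Fourier coefficient of an action derivative of f, which on A is the action
  derivative of the coefficient. As a parameter integral it is continuous in I.\<close>

definition coeff_deriv :: "((real^'n) \<times> (real^'n) \<Rightarrow> real) \<Rightarrow> int^'n \<Rightarrow> 'n \<Rightarrow> real^'n \<Rightarrow> complex" where
  "coeff_deriv f k j I = torus_coeff (\<lambda>\<phi>. frechet_derivative f (at (I, \<phi>)) (axis j 1, 0)) k"

text \<open>The gauge integral is the form in which continuity and Leibniz's rule for parameter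
  integrals apply.\<close>

lemma torus_coeff_eq_integral:
  fixes F :: "real^'n \<Rightarrow> real"
  assumes "continuous_on UNIV F"
  shows "torus_coeff F k = (1 / (2 * pi) ^ CARD('n)) *\<^sub>R
    integral (cbox 0 (\<chi> i. 2 * pi)) (\<lambda>\<phi>. complex_of_real (F \<phi>) * cis (- (ivec k \<bullet> \<phi>)))"
proof -
  have "set_integrable lborel cube (\<lambda>\<phi>. complex_of_real (F \<phi>) * cis (- (ivec k \<bullet> \<phi>)))"
    unfolding set_integrable_def using assms
    by (intro borel_integrable_compact compact_cube continuous_intros) (auto intro: continuous_on_subset)
  from set_borel_integral_eq_integral(2)[OF this] show ?thesis
    by (simp add: torus_coeff_def cube_def)
qed

lemma continuous_on_fiber:
  assumes "continuous_on (A \<times> UNIV) F" "I \<in> A"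
  shows "continuous_on UNIV (\<lambda>\<phi>. F (I, \<phi>))"
  by (rule continuous_on_compose2[OF assms(1)]) (use assms(2) in \<open>auto intro!: continuous_intros\<close>)

lemma continuous_on_torus_coeff:
  fixes F :: "(real^'n) \<times> (real^'n) \<Rightarrow> real"
  assumes "continuous_on (A \<times> UNIV) F"
  shows "continuous_on A (\<lambda>I. torus_coeff (\<lambda>\<phi>. F (I, \<phi>)) k)"
proof -
  have "continuous_on A (\<lambda>I. (1 / (2 * pi) ^ CARD('n)) *\<^sub>R
      integral (cbox 0 (\<chi> i. 2 * pi)) (\<lambda>\<phi>. complex_of_real (F (I, \<phi>)) * cis (- (ivec k \<bullet> \<phi>))))"
    unfolding case_prod_beta'
    by (intro continuous_on_scaleR continuous_on_const integral_continuous_on_param)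
      (auto simp: case_prod_beta' intro!: continuous_intros continuous_on_compose2[OF assms])
  then show ?thesis
    by (rule continuous_on_eq) (simp add: torus_coeff_eq_integral[OF continuous_on_fiber[OF assms]])
qed

lemma smooth_on_props:
  fixes f :: "(real^'n) \<times> (real^'n) \<Rightarrow> real"
  assumes "smooth_on (A \<times> UNIV) f"
  shows "I \<in> A \<Longrightarrow> f differentiable (at (I, \<phi>))"
    and "continuous_on (A \<times> UNIV) f"
    and "continuous_on (A \<times> UNIV) (\<lambda>x. frechet_derivative f (at x) (axis j 1, 0))"
proof -
  have C: "Ck_on (Suc 0) (A \<times> UNIV) f" and "Ck_on 0 (A \<times> UNIV) f"
    using assms by (auto simp only: smooth_on_def)
  then show "continuous_on (A \<times> UNIV) f" by simp
  show "I \<in> A \<Longrightarrow> f differentiable (at (I, \<phi>))"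
    using C by simp
  have "(axis j 1, 0) \<in> (Basis :: ((real^'n) \<times> (real^'n)) set)"
    by (simp add: Basis_prod_def axis_in_Basis_iff)
  then show "continuous_on (A \<times> UNIV) (\<lambda>x. frechet_derivative f (at x) (axis j 1, 0))"
    using C by simp
qed

text \<open>Differentiation under the integral over the cube. The point s on the line is arbitrary
  because the lower bound later integrates along segments.\<close>

lemma coeff_line_derivative:
  fixes f :: "(real^'n) \<times> (real^'n) \<Rightarrow> real"
  assumes "open A" and f: "smooth_on (A \<times> UNIV) f" and s: "I + s *\<^sub>R axis j 1 \<in> A"
  shows "((\<lambda>t. fourier_coeff f k (I + t *\<^sub>R axis j 1)) has_vector_derivative
      coeff_deriv f k j (I + s *\<^sub>R axis j 1)) (at s)"
proof -
  let ?J = "\<lambda>H :: real^'n \<Rightarrow> complex. (1 / (2 * pi) ^ CARD('n)) *\<^sub>R integral (cbox 0 (\<chi> i. 2 * pi)) H"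
  define p where "p t = I + t *\<^sub>R axis j 1" for t
  have "continuous_on UNIV p" unfolding p_def by (intro continuous_intros)
  then have "open (p -` A)" using \<open>open A\<close> by (simp add: continuous_on_open_vimage)
  moreover have "s \<in> p -` A" using s by (simp add: p_def)
  \<comment> \<open>Leibniz's rule wants a convex parameter set; an interval around s inside the
    preimage of A provides one.\<close>
  ultimately obtain e where e: "e > 0" "ball s e \<subseteq> p -` A"
    unfolding open_contains_ball by blast
  define U where "U = ball s e"
  have U: "p t \<in> A" if "t \<in> U" for t using e that by (auto simp: U_def)
  define D where "D t \<phi> = complex_of_real (frechet_derivative f (at (p t, \<phi>)) (axis j 1, 0)) * cis (- (ivec k \<bullet> \<phi>))" for t \<phi>
  define E where "E t \<phi> = complex_of_real (f (p t, \<phi>)) * cis (- (ivec k \<bullet> \<phi>))" for t \<phi>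
  have "((\<lambda>t. integral (cbox 0 (\<chi> i. 2 * pi)) (E t)) has_vector_derivative
      integral (cbox 0 (\<chi> i. 2 * pi)) (D s)) (at s within U)"
  proof (rule leibniz_rule_vector_derivative)
    show "((\<lambda>t. E t \<phi>) has_vector_derivative D t \<phi>) (at t within U)" if "t \<in> U" for t \<phi>
    proof -
      have "f differentiable (at ((I, \<phi>) + t *\<^sub>R (axis j 1, 0)))"
        using smooth_on_props(1)[OF f] U[OF that] by (simp add: p_def)
      from line_has_vector_derivative[OF this, of U]
      have "((\<lambda>t. f (p t, \<phi>)) has_vector_derivative frechet_derivative f (at (p t, \<phi>)) (axis j 1, 0)) (at t within U)"
        by (simp add: p_def)
      then show ?thesis unfolding E_def D_def
        by (intro has_vector_derivative_mult_left has_vector_derivative_of_real)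
          (simp add: has_real_derivative_iff_has_vector_derivative)
    qed
    show "E t integrable_on cbox 0 (\<chi> i. 2 * pi)" if "t \<in> U" for t
      unfolding E_def using continuous_on_fiber[OF smooth_on_props(2)[OF f] U[OF that]]
      by (intro integrable_continuous continuous_intros) (auto intro: continuous_on_subset)
    show "continuous_on (U \<times> cbox 0 (\<chi> i. 2 * pi)) (\<lambda>(t, \<phi>). D t \<phi>)"
      unfolding D_def case_prod_beta'
      by (intro continuous_intros continuous_on_compose2[OF smooth_on_props(3)[OF f, of j]])
        (auto simp: p_def[abs_def] U intro!: continuous_intros U[unfolded p_def])
    show "s \<in> U" "convex U" using e by (auto simp: U_def)
  qed
  then have "((\<lambda>t. ?J (E t)) has_vector_derivative
      ?J (D s)) (at s)"
    using e(1) by (intro bounded_linear.has_vector_derivative[OF bounded_linear_scaleR_right])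
      (simp add: U_def at_within_open[of s "ball s e"])
  moreover have "?J (D s) = coeff_deriv f k j (p s)"
    unfolding coeff_deriv_def D_def
    using continuous_on_fiber[OF smooth_on_props(3)[OF f, of j], of "p s"] s
    by (simp add: torus_coeff_eq_integral p_def)
  ultimately have deriv: "((\<lambda>t. ?J (E t)) has_vector_derivative
      coeff_deriv f k j (p s)) (at s)" by simp
  have eq: "?J (E t) = fourier_coeff f k (p t)" if "t \<in> U" for t
    using continuous_on_fiber[OF smooth_on_props(2)[OF f] U[OF that]]
    by (simp add: fourier_coeff_eq E_def[abs_def] torus_coeff_eq_integral)
  show ?thesis
    unfolding p_def[symmetric]
    by (rule has_vector_derivative_transform_within_open[OF deriv, of U]) (use e eq in \<open>auto simp: U_def\<close>)
qed

lemma continuous_on_coeff: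
  assumes "smooth_on (A \<times> UNIV) f"
  shows "continuous_on A (fourier_coeff f k)" "continuous_on A (coeff_deriv f k j)"
  using continuous_on_torus_coeff[OF smooth_on_props(2)[OF assms], of k]
    continuous_on_torus_coeff[OF smooth_on_props(3)[OF assms], of j k]
  by (auto simp: fourier_coeff_eq[abs_def] coeff_deriv_def[abs_def])

lemma partial_eqI:
  assumes "((\<lambda>t. v (I + t *\<^sub>R axis j 1)) has_vector_derivative d) (at 0)"
  shows "partial j v I = d"
  using assms unfolding partial_def by (rule vector_derivative_at)

lemma partial_coeff:
  assumes "open A" "smooth_on (A \<times> UNIV) f" "I \<in> A"
  shows "partial j (fourier_coeff f k) I = coeff_deriv f k j I"
  using coeff_line_derivative[OF assms(1,2), of I 0 j k] assms(3) by (intro partial_eqI) simp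

text \<open>The derivative of the resonance function k \<bullet> g in the j-th action, equivalently
  the j-th entry of the transposed Jacobian applied to k.\<close>

definition freq_deriv :: "(real^'n \<Rightarrow> real^'n) \<Rightarrow> int^'n \<Rightarrow> 'n \<Rightarrow> real^'n \<Rightarrow> real" where
  "freq_deriv g k j I = ivec k \<bullet> frechet_derivative g (at I) (axis j 1)"

lemma freq_line_derivative:
  assumes "g differentiable (at (I + s *\<^sub>R axis j 1))"
  shows "((\<lambda>t. ivec k \<bullet> g (I + t *\<^sub>R axis j 1)) has_vector_derivative freq_deriv g k j (I + s *\<^sub>R axis j 1)) (at s)"
  unfolding freq_deriv_def
  by (rule bounded_linear.has_vector_derivative[OF bounded_linear_inner_right line_has_vector_derivative[OF assms]])

text \<open>Product and chain rule for f_k \<sigma>(k \<bullet> g). No indicator of the resonance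
  occurs, so the formula holds on the resonance too; the lower bound integrates across it.\<close>

lemma modulated_coeff_line_derivative:
  fixes f :: "(real^'n) \<times> (real^'n) \<Rightarrow> real"
  assumes A: "open A" and f: "smooth_on (A \<times> UNIV) f" and s: "I + s *\<^sub>R axis j 1 \<in> A"
    and g: "g differentiable (at (I + s *\<^sub>R axis j 1))"
    and \<sigma>: "(\<sigma> has_vector_derivative d) (at (ivec k \<bullet> g (I + s *\<^sub>R axis j 1)))"
  shows "((\<lambda>t. fourier_coeff f k (I + t *\<^sub>R axis j 1) * \<sigma> (ivec k \<bullet> g (I + t *\<^sub>R axis j 1))) has_vector_derivative
      coeff_deriv f k j (I + s *\<^sub>R axis j 1) * \<sigma> (ivec k \<bullet> g (I + s *\<^sub>R axis j 1))
      + fourier_coeff f k (I + s *\<^sub>R axis j 1) * (of_real (freq_deriv g k j (I + s *\<^sub>R axis j 1)) * d)) (at s)"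
proof -
  let ?s = "I + s *\<^sub>R axis j 1"
  have "(\<sigma> \<circ> (\<lambda>t. ivec k \<bullet> g (I + t *\<^sub>R axis j 1)) has_vector_derivative
      freq_deriv g k j (?s) *\<^sub>R d) (at s)"
    by (rule vector_diff_chain_at[OF freq_line_derivative[OF g]]) (use \<sigma> in simp)
  from has_vector_derivative_mult[OF coeff_line_derivative[OF A f s] this]
  show ?thesis by (simp add: o_def scaleR_conv_of_real add.commute)
qed

section \<open>Fourier coefficients of the three averages\<close>

lemma periodic_fiber: "angle_periodic_on A f \<Longrightarrow> I \<in> A \<Longrightarrow> periodic (\<lambda>\<phi>. f (I, \<phi>))"
  by (simp add: angle_periodic_on_def periodic_def)

lemma time_average_eq: "time_average g f T (I, \<phi>) = time_mean (\<lambda>\<phi>. f (I, \<phi>)) (g I) T \<phi>"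
  by (simp add: time_average_def time_mean_def free_flow_def)

lemma limit_average_eq: "limit_average g f (I, \<phi>) = long_mean (\<lambda>\<phi>. f (I, \<phi>)) (g I) \<phi>"
  by (simp add: limit_average_def long_mean_def time_average_eq)

lemma time_average_coeff:
  fixes f :: "(real^'n) \<times> (real^'n) \<Rightarrow> real"
  assumes f: "smooth_on (A \<times> UNIV) f" "angle_periodic_on A f" and "I \<in> A" "T > 0"
  shows "fourier_coeff (\<lambda>x. time_average g f T x - limit_average g f x) k I
    = fourier_coeff f k I * (time_mult T (ivec k \<bullet> g I) - of_bool (ivec k \<bullet> g I = 0))"
proof -
  note per = periodic_fiber[OF f(2) \<open>I \<in> A\<close>]
  note cont = continuous_on_fiber[OF smooth_on_props(2)[OF f(1)] \<open>I \<in> A\<close>]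
  have "fourier_coeff (\<lambda>x. time_average g f T x - limit_average g f x) k I
     = torus_coeff (\<lambda>\<phi>. (\<integral>t. f (I, \<phi> + t *\<^sub>R g I) \<partial>unif T) - long_mean (\<lambda>\<phi>. f (I, \<phi>)) (g I) \<phi>) k"
    by (simp add: fourier_coeff_eq time_average_eq limit_average_eq time_mean_eq_average[OF \<open>T > 0\<close> cont])
  also have "\<dots> = ((\<integral>t. cis (ivec k \<bullet> (t *\<^sub>R g I)) \<partial>unif T) - of_bool (ivec k \<bullet> g I = 0)) * torus_coeff (\<lambda>\<phi>. f (I, \<phi>)) k"
    by (rule torus_coeff_average_diff[OF prob_space_unif[OF \<open>T > 0\<close>] _ per cont]) measurable
  also have "(\<integral>t. cis (ivec k \<bullet> (t *\<^sub>R g I)) \<partial>unif T) = time_mult T (ivec k \<bullet> g I)"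
    using \<open>T > 0\<close> by (subst integral_unif) (auto simp: time_mult_def cis_conv_exp)
  finally show ?thesis by (simp add: fourier_coeff_eq)
qed

text \<open>The multiplier of a flow observed at rate \<mu> with total decay rate s: s = \<mu>
  without noise, s = \<mu> + \<nu> |k|^2 with noise. Its value at a = 0 is \<mu> / s, so noise
  lowers exactly the peak that obstructs convergence.\<close>

definition disc_mult :: "real \<Rightarrow> real \<Rightarrow> real \<Rightarrow> complex" where
  "disc_mult \<mu> s a = complex_of_real \<mu> / (complex_of_real s - \<i> * complex_of_real a)"

lemma discounted_average_coeff:
  fixes f :: "(real^'n) \<times> (real^'n) \<Rightarrow> real"
  assumes f: "smooth_on (A \<times> UNIV) f" "angle_periodic_on A f" and "I \<in> A" "\<mu> > 0"
  shows "fourier_coeff (\<lambda>x. discounted_average g f \<mu> x - limit_average g f x) k I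
    = fourier_coeff f k I * (disc_mult \<mu> \<mu> (ivec k \<bullet> g I) - of_bool (ivec k \<bullet> g I = 0))"
proof -
  note per = periodic_fiber[OF f(2) \<open>I \<in> A\<close>]
  note cont = continuous_on_fiber[OF smooth_on_props(2)[OF f(1)] \<open>I \<in> A\<close>]
  have eq: "discounted_average g f \<mu> (I, \<phi>) = (\<integral>t. f (I, \<phi> + t *\<^sub>R g I) \<partial>expo \<mu>)" for \<phi>
  proof -
    have "(\<lambda>t. f (I, \<phi> + t *\<^sub>R g I)) \<in> borel_measurable borel"
      by (rule borel_measurable_continuous_onI, rule continuous_on_compose2[OF cont]) (auto intro!: continuous_intros)
    then show ?thesis
      using \<open>\<mu> > 0\<close> by (subst integral_expo) (simp_all add: discounted_average_def free_flow_def mult.commute)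
  qed
  have "fourier_coeff (\<lambda>x. discounted_average g f \<mu> x - limit_average g f x) k I
     = torus_coeff (\<lambda>\<phi>. (\<integral>t. f (I, \<phi> + t *\<^sub>R g I) \<partial>expo \<mu>) - long_mean (\<lambda>\<phi>. f (I, \<phi>)) (g I) \<phi>) k"
    by (simp add: fourier_coeff_eq eq limit_average_eq)
  also have "\<dots> = ((\<integral>t. cis (ivec k \<bullet> (t *\<^sub>R g I)) \<partial>expo \<mu>) - of_bool (ivec k \<bullet> g I = 0)) * torus_coeff (\<lambda>\<phi>. f (I, \<phi>)) k"
    by (rule torus_coeff_average_diff[OF prob_space_expo[OF \<open>\<mu> > 0\<close>] _ per cont]) measurable
  also have "(\<integral>t. cis (ivec k \<bullet> (t *\<^sub>R g I)) \<partial>expo \<mu>) = disc_mult \<mu> \<mu> (ivec k \<bullet> g I)"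
    using integral_expo_damped_cis[OF \<open>\<mu> > 0\<close>, of 0 "ivec k \<bullet> g I"] by (simp add: disc_mult_def)
  finally show ?thesis by (simp add: fourier_coeff_eq)
qed

lemma noisy_average_coeff:
  fixes f :: "(real^'n) \<times> (real^'n) \<Rightarrow> real" and w :: "real \<Rightarrow> 'w \<Rightarrow> real^'n"
  assumes f: "smooth_on (A \<times> UNIV) f" "angle_periodic_on A f" and "I \<in> A" "\<mu> > 0" "\<nu> > 0"
    and W: "wiener_process P w"
  shows "fourier_coeff (\<lambda>x. noisy_average P w g f \<mu> \<nu> x - limit_average g f x) k I
    = fourier_coeff f k I * (disc_mult \<mu> (\<mu> + \<nu> * (norm (ivec k))\<^sup>2) (ivec k \<bullet> g I) - of_bool (ivec k \<bullet> g I = 0))"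
proof -
  let ?N = "\<lambda>\<phi> \<omega>. LINT t:{0..}|lborel. f (noisy_flow g w \<nu> t (I, \<phi>) \<omega>) * exp (- \<mu> * t)"
  let ?PE = "P \<Otimes>\<^sub>M expo \<mu>"
  let ?a = "ivec k \<bullet> g I"
  let ?c = "\<nu> * (norm (ivec k))\<^sup>2"
  let ?E = "\<lambda>t. cis (t * (ivec k \<bullet> g I)) * complex_of_real (exp (- (\<nu> * (norm (ivec k))\<^sup>2 * t)))"
  \<comment> \<open>The noise adds \<open>?s \<bullet> w t \<omega>\<close> to the phase of the
    harmonic. Its variance is 2 \<nu> |k|^2 t, and half of it is the damping exponent.\<close>
  let ?s = "sqrt (2 * \<nu>) *\<^sub>R ivec k"
  note per = periodic_fiber[OF f(2) \<open>I \<in> A\<close>]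
  note cont = continuous_on_fiber[OF smooth_on_props(2)[OF f(1)] \<open>I \<in> A\<close>]
  have Fm [measurable]: "(\<lambda>\<phi>. f (I, \<phi>)) \<in> borel_measurable borel"
    by (rule borel_measurable_continuous_onI[OF cont])
  obtain M where M: "\<And>\<phi>. \<bar>f (I, \<phi>)\<bar> \<le> M"
    using periodic_continuous_bounded[OF per cont] by auto
  interpret P: prob_space P using W by (simp add: wiener_process_def)
  interpret E: prob_space "expo \<mu>" using prob_space_expo[OF \<open>\<mu> > 0\<close>] .
  interpret PE: pair_prob_space P "expo \<mu>" ..
  \<comment> \<open>Path and exponential time are independent, so the displacement lives on a
    product space. The \<open>max 0\<close> changes nothing for t \<ge> 0 and secures joint
    measurability.\<close>
  define X where "X = (\<lambda>(\<omega>, t). t *\<^sub>R g I + sqrt (2 * \<nu>) *\<^sub>R w (max 0 t) \<omega>)"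
  have wm [measurable]: "(\<lambda>(\<omega>, t). w (max 0 t) \<omega>) \<in> borel_measurable ?PE"
    using wiener_process_jointly_measurable[OF W]
    by (subst measurable_cong_sets[OF sets_pair_measure_cong[OF refl sets_expo] refl])
  have Xm [measurable]: "X \<in> borel_measurable ?PE"
    unfolding X_def using wm by (simp add: case_prod_beta')
  have int: "integrable ?PE (\<lambda>y. f (I, \<phi> + X y))" for \<phi>
  proof (rule PE.P.integrable_const_bound[where B = M])
    have "(\<lambda>y. \<phi> + X y) \<in> borel_measurable ?PE" by measurable
    from measurable_compose[OF this Fm]
    show "(\<lambda>y. f (I, \<phi> + X y)) \<in> borel_measurable ?PE" .
  qed (use M in auto)
  have intc: "integrable ?PE (\<lambda>y. cis (ivec k \<bullet> X y))"
    by (rule PE.P.integrable_const_bound[where B = 1]) (auto simp: cis_conv_exp)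
  have eq: "noisy_average P w g f \<mu> \<nu> (I, \<phi>) = (\<integral>y. f (I, \<phi> + X y) \<partial>?PE)" for \<phi>
  proof -
    have "\<mu> * (?N \<phi> \<omega>) = (\<integral>t. f (I, \<phi> + X (\<omega>, t)) \<partial>expo \<mu>)"
      if "\<omega> \<in> space P" for \<omega>
    proof -
      have "(\<lambda>t. w (max 0 t) \<omega>) \<in> borel_measurable borel"
        using measurable_Pair2[OF wiener_process_jointly_measurable[OF W] that] by simp
      then have "(\<lambda>t. \<phi> + X (\<omega>, t)) \<in> borel_measurable borel"
        unfolding X_def by simp
      from measurable_compose[OF this Fm]
      have "(\<integral>t. f (I, \<phi> + X (\<omega>, t)) \<partial>expo \<mu>) = \<mu> *\<^sub>R (LINT t:{0..}|lborel. exp (- \<mu> * t) *\<^sub>R f (I, \<phi> + X (\<omega>, t)))"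
        by (rule integral_expo[OF \<open>\<mu> > 0\<close>])
      also have "(LINT t:{0..}|lborel. exp (- \<mu> * t) *\<^sub>R f (I, \<phi> + X (\<omega>, t)))
          = (?N \<phi> \<omega>)"
        by (rule set_lebesgue_integral_cong) (auto simp: X_def noisy_flow_def max_def add.assoc mult.commute)
      finally show ?thesis by simp
    qed
    then have "(\<integral>\<omega>. \<mu> * (?N \<phi> \<omega>) \<partial>P)
        = (\<integral>\<omega>. (\<integral>t. f (I, \<phi> + X (\<omega>, t)) \<partial>expo \<mu>) \<partial>P)"
      by (intro Bochner_Integration.integral_cong refl)
    also have "\<dots> = (\<integral>y. f (I, \<phi> + X y) \<partial>?PE)"
      using PE.integral_fst'[OF int] .
    finally show ?thesis by (simp add: noisy_average_def)
  qed
  have "fourier_coeff (\<lambda>x. noisy_average P w g f \<mu> \<nu> x - limit_average g f x) k I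
     = torus_coeff (\<lambda>\<phi>. (\<integral>y. f (I, \<phi> + X y) \<partial>?PE) - long_mean (\<lambda>\<phi>. f (I, \<phi>)) (g I) \<phi>) k"
    by (simp add: fourier_coeff_eq eq limit_average_eq)
  also have "\<dots> = ((\<integral>y. cis (ivec k \<bullet> X y) \<partial>?PE) - of_bool (?a = 0)) * torus_coeff (\<lambda>\<phi>. f (I, \<phi>)) k"
    by (rule torus_coeff_average_diff[OF PE.P.prob_space_axioms Xm per cont])
  \<comment> \<open>Integrating over the paths first leaves a Gaussian characteristic function at a
    fixed time, hence a damped oscillation in t.\<close>
  also have "(\<integral>y. cis (ivec k \<bullet> X y) \<partial>?PE) = (\<integral>t. \<integral>\<omega>. cis (ivec k \<bullet> X (\<omega>, t)) \<partial>P \<partial>expo \<mu>)"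
    using PE.integral_snd[of "\<lambda>\<omega> t. cis (ivec k \<bullet> X (\<omega>, t))"] intc by (simp add: case_prod_beta')
  also have "\<dots> = (\<integral>t. ?E t \<partial>expo \<mu>)"
  proof (rule integral_cong_AE)
    show "(\<lambda>t. \<integral>\<omega>. cis (ivec k \<bullet> X (\<omega>, t)) \<partial>P) \<in> borel_measurable (expo \<mu>)"
      unfolding cis_conv_exp by measurable
    show "(\<lambda>t. ?E t) \<in> borel_measurable (expo \<mu>)"
      unfolding cis_conv_exp by measurable
    show "AE t in expo \<mu>. (\<integral>\<omega>. cis (ivec k \<bullet> X (\<omega>, t)) \<partial>P)
        = ?E t"
      using AE_expo_pos
    proof eventually_elim
      case (elim t)
      have "(\<integral>\<omega>. cis (ivec k \<bullet> X (\<omega>, t)) \<partial>P) = (\<integral>\<omega>. cis (t * (?a)) * cis (?s \<bullet> w t \<omega>) \<partial>P)"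
        using elim by (simp add: X_def inner_add_right cis_mult)
      also have "\<dots> = cis (t * (?a)) * (\<integral>\<omega>. cis (?s \<bullet> w t \<omega>) \<partial>P)"
        by (rule integral_mult_right_zero)
      also have "(\<integral>\<omega>. cis (?s \<bullet> w t \<omega>) \<partial>P) = complex_of_real (exp (- ((norm ?s)\<^sup>2 * t / 2)))"
        by (rule wiener_process_char[OF W elim])
      also have "(norm ?s)\<^sup>2 * t / 2 = ?c * t"
        using \<open>\<nu> > 0\<close> by (simp add: power_mult_distrib)
      finally show ?case .
    qed
  qed
  also have "\<dots> = disc_mult \<mu> (\<mu> + ?c) (?a)"
    using integral_expo_damped_cis[OF \<open>\<mu> > 0\<close>, of "?c" "?a"] \<open>\<nu> > 0\<close>
    by (simp add: disc_mult_def mult.assoc)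
  finally show ?thesis by (simp add: fourier_coeff_eq)
qed

section \<open>Change of variables and slices of the ball\<close>

text \<open>The change of variables theorem of the library needs a well-ordered index type, so vectors are
  reindexed by a well-ordered copy of the index type.\<close>

typedef 'a wo = "UNIV :: 'a set" by simp

lemma bij_Rep_wo: "bij Rep_wo" and bij_Abs_wo: "bij Abs_wo"
  by (rule bij_betw_byWitness[where f' = Abs_wo], auto simp: Rep_wo_inverse Abs_wo_inverse)
    (rule bij_betw_byWitness[where f' = Rep_wo], auto simp: Rep_wo_inverse Abs_wo_inverse)

instance wo :: (finite) finite
proof
  have "(UNIV :: 'a wo set) = range Abs_wo"
    using bij_is_surj[OF bij_Abs_wo] ..
  then show "finite (UNIV :: 'a wo set)"
    by (metis finite finite_imageI)
qed

definition wo_index :: "'a::finite wo \<Rightarrow> nat" where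
  "wo_index = (SOME f. inj f)"

lemma inj_wo_index: "inj (wo_index :: 'a::finite wo \<Rightarrow> nat)"
proof -
  have "\<exists>f :: 'a wo \<Rightarrow> nat. inj f"
    using finite_imp_inj_to_nat_seg[OF finite[of UNIV]] by metis
  then show ?thesis unfolding wo_index_def by (rule someI_ex)
qed

instantiation wo :: (finite) wellorder
begin

definition less_eq_wo :: "'a wo \<Rightarrow> 'a wo \<Rightarrow> bool" where
  "x \<le> y \<longleftrightarrow> wo_index x \<le> wo_index y"

definition less_wo :: "'a wo \<Rightarrow> 'a wo \<Rightarrow> bool" where
  "x < y \<longleftrightarrow> wo_index x < wo_index y"

instance
proof
  fix P :: "'a wo \<Rightarrow> bool" and a :: "'a wo"
  assume step: "\<And>x. (\<And>y. y < x \<Longrightarrow> P y) \<Longrightarrow> P x"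
  show "P a"
    by (induction a rule: measure_induct[of wo_index]) (use step in \<open>auto simp: less_wo_def\<close>)
qed (auto simp: less_eq_wo_def less_wo_def dest: injD[OF inj_wo_index])

end

definition to_wo :: "'a^'n \<Rightarrow> 'a^'n wo" where
  "to_wo x = (\<chi> i. x $ Rep_wo i)"

definition of_wo :: "'a^'n wo \<Rightarrow> 'a^'n" where
  "of_wo x = (\<chi> i. x $ Abs_wo i)"

lemma of_to_wo [simp]: "of_wo (to_wo x) = x" and to_of_wo [simp]: "to_wo (of_wo y) = y"
  by (simp_all add: of_wo_def to_wo_def vec_eq_iff Rep_wo_inverse Abs_wo_inverse)

lemma linear_to_wo: "linear (to_wo :: real^'n \<Rightarrow> real^'n wo)"
  and linear_of_wo: "linear (of_wo :: real^'n wo \<Rightarrow> real^'n)"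
  by (auto intro!: linearI simp: to_wo_def of_wo_def vec_eq_iff)

lemma has_derivative_to_wo: "(to_wo has_derivative to_wo) (at (x :: real^'n) within S)"
  and has_derivative_of_wo: "(of_wo has_derivative of_wo) (at (y :: real^'n wo) within S')"
  by (auto intro!: bounded_linear_imp_has_derivative linear_conv_bounded_linear[THEN iffD1] linear_to_wo linear_of_wo)

lemma continuous_on_to_wo: "continuous_on S (to_wo :: real^'n \<Rightarrow> _)"
  and continuous_on_of_wo: "continuous_on S' (of_wo :: real^'n wo \<Rightarrow> _)"
  by (auto intro!: linear_continuous_on linear_conv_bounded_linear[THEN iffD1] linear_to_wo linear_of_wo)

lemma measurable_to_wo [measurable]: "(to_wo :: real^'n \<Rightarrow> real^'n wo) \<in> borel_measurable borel"
  and measurable_of_wo [measurable]: "(of_wo :: real^'n wo \<Rightarrow> real^'n) \<in> borel_measurable borel"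
  by (auto intro!: borel_measurable_continuous_onI continuous_on_to_wo continuous_on_of_wo)

text \<open>The permutation and its conjugate act on different types, so the sign is followed
  through a product of transpositions.\<close>

lemma sign_conj_wo:
  fixes p :: "'n::finite wo \<Rightarrow> 'n wo"
  assumes "p permutes UNIV"
  shows "sign (Rep_wo \<circ> p \<circ> Abs_wo) = sign p \<and> Rep_wo \<circ> p \<circ> Abs_wo permutes UNIV"
  using assms finite
proof (induction rule: permutes_induct)
  case id
  have "Rep_wo \<circ> id \<circ> Abs_wo = (id :: 'n \<Rightarrow> 'n)"
    by (auto simp: Abs_wo_inverse)
  then show ?case by (simp only: permutes_id sign_id simp_thms)
next
  case (swap a b p)
  let ?q = "Rep_wo \<circ> p \<circ> Abs_wo"
  have eq: "Rep_wo \<circ> (Transposition.transpose a b \<circ> p) \<circ> Abs_wo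
      = Transposition.transpose (Rep_wo a) (Rep_wo b) \<circ> ?q"
    by (auto simp: fun_eq_iff Transposition.transpose_def Rep_wo_inject)
  have pp: "permutation p" "permutation ?q"
    using swap permutation_permutes finite by blast+
  show ?case
  proof
    show "sign (Rep_wo \<circ> (Transposition.transpose a b \<circ> p) \<circ> Abs_wo) = sign (Transposition.transpose a b \<circ> p)"
      unfolding eq using pp conjunct1[OF swap.IH]
      by (simp only: sign_compose permutation_swap_id sign_swap_id Rep_wo_inject)
    show "Rep_wo \<circ> (Transposition.transpose a b \<circ> p) \<circ> Abs_wo permutes UNIV"
      unfolding eq by (intro permutes_compose permutes_swap_id conjunct2[OF swap.IH]) auto
  qed
qed

text \<open>Relabelling rows and columns by the same bijection permutes the terms of the Leibniz sum
  and keeps their signs.\<close>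

lemma det_reindex_wo:
  fixes M :: "real^'n^'n"
  shows "det ((\<chi> i j. M $ Rep_wo i $ Rep_wo j) :: real^'n wo^'n wo) = det M"
proof -
  let ?T = "\<lambda>p. Rep_wo \<circ> p \<circ> Abs_wo :: 'n \<Rightarrow> 'n"
  have bij: "bij_betw ?T {p. p permutes UNIV} {p. p permutes UNIV}"
  proof (rule bij_betw_byWitness[where f' = "\<lambda>q. Abs_wo \<circ> q \<circ> Rep_wo"])
    show "?T ` {p. p permutes UNIV} \<subseteq> {p. p permutes UNIV}"
      using sign_conj_wo by auto
    show "(\<lambda>q. Abs_wo \<circ> q \<circ> Rep_wo) ` {p. p permutes (UNIV :: 'n set)} \<subseteq> {p. p permutes UNIV}"
      using bij_Rep_wo bij_Abs_wo by (auto intro!: bij_imp_permutes bij_comp permutes_bij)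
  qed (auto simp: fun_eq_iff Rep_wo_inverse Abs_wo_inverse)
  have "det M = (\<Sum>q | q permutes UNIV. of_int (sign q) * (\<Prod>i\<in>UNIV. M $ i $ q i))"
    by (simp add: det_def)
  also have "\<dots> = (\<Sum>p | p permutes UNIV. of_int (sign (?T p)) * (\<Prod>i\<in>UNIV. M $ i $ ?T p i))"
    by (rule sum.reindex_bij_betw[OF bij, symmetric])
  also have "\<dots> = (\<Sum>p | p permutes UNIV. of_int (sign p) * (\<Prod>i\<in>UNIV. M $ Rep_wo i $ Rep_wo (p i)))"
  proof (rule sum.cong)
    fix p :: "'n wo \<Rightarrow> 'n wo" assume "p \<in> {p. p permutes UNIV}"
    moreover have "(\<Prod>i\<in>UNIV. M $ i $ ?T p i) = (\<Prod>i\<in>UNIV. M $ Rep_wo i $ Rep_wo (p i))"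
      using prod.reindex_bij_betw[OF bij_Rep_wo, of "\<lambda>i. M $ i $ ?T p i"] by (simp add: Rep_wo_inverse)
    ultimately show "of_int (sign (?T p)) * (\<Prod>i\<in>UNIV. M $ i $ ?T p i)
        = of_int (sign p) * (\<Prod>i\<in>UNIV. M $ Rep_wo i $ Rep_wo (p i))"
      using sign_conj_wo[of p] by simp
  qed simp
  finally show ?thesis by (simp add: det_def)
qed

lemma prod_Basis_vec: "(\<Prod>b\<in>Basis. (x :: real^'n) \<bullet> b) = (\<Prod>i\<in>UNIV. x $ i)"
proof -
  have B: "Basis = range (\<lambda>i. axis i 1 :: real^'n)"
    by (auto simp: Basis_vec_def)
  have "inj (\<lambda>i. axis i 1 :: real^'n)"
    by (auto simp: inj_on_def axis_eq_axis)
  from prod.reindex[OF this, of "\<lambda>b. x \<bullet> b"] show ?thesis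
    unfolding B by (simp add: inner_axis o_def)
qed

lemma distr_to_wo: "distr lborel borel to_wo = (lborel :: (real^('n::finite) wo) measure)"
proof (rule lborel_eqI[symmetric])
  fix l u :: "real^('n::finite) wo"
  assume le: "\<And>b. b \<in> Basis \<Longrightarrow> l \<bullet> b \<le> u \<bullet> b"
  have le': "l $ i \<le> u $ i" for i
    using le[of "axis i 1"] by (simp add: inner_axis axis_in_Basis_iff)
  have "to_wo -` box l u = box (of_wo l) (of_wo u)"
    by (auto simp: mem_box_cart to_wo_def of_wo_def) (metis Abs_wo_inverse Rep_wo_inverse UNIV_I)+
  then have "emeasure (distr lborel borel to_wo) (box l u) = emeasure lborel (box (of_wo l) (of_wo u))"
    by (subst emeasure_distr) auto
  also have "\<dots> = (\<Prod>b\<in>Basis. (of_wo u - of_wo l) \<bullet> b)"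
  proof (rule emeasure_lborel_box)
    fix b :: "real^'n" assume "b \<in> Basis"
    then obtain i where "b = axis i 1" by (auto simp: Basis_vec_def)
    then show "of_wo l \<bullet> b \<le> of_wo u \<bullet> b" using le' by (simp add: inner_axis of_wo_def)
  qed
  also have "(\<Prod>b\<in>Basis. (of_wo u - of_wo l) \<bullet> b) = (\<Prod>i\<in>UNIV. (u - l) $ Abs_wo i)"
    by (simp add: prod_Basis_vec of_wo_def)
  also have "\<dots> = (\<Prod>i\<in>UNIV. (u - l) $ i)"
    by (rule prod.reindex_bij_betw[OF bij_Abs_wo])
  finally show "emeasure (distr lborel borel to_wo) (box l u) = (\<Prod>b\<in>Basis. (u - l) \<bullet> b)"
    by (simp add: prod_Basis_vec)
qed simp

text \<open>The exact formula has the Jacobian factor on one side and the image of S on the other.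
  Bounding the factor below by m and enlarging the image to the ball leaves an estimate free of the
  shape of the image.\<close>

lemma change_of_variables_ineq_wellorder:
  fixes G :: "real^'m::{finite,wellorder} \<Rightarrow> real^'m::_" and h :: "real^'m::_ \<Rightarrow> real"
  assumes S: "open S" and GS: "open (G ` S)" "G ` S \<subseteq> cball 0 C"
    and der: "\<And>x. x \<in> S \<Longrightarrow> (G has_derivative G' x) (at x)" and inj: "inj_on G S"
    and det: "\<And>x. x \<in> S \<Longrightarrow> m \<le> \<bar>det (matrix (G' x))\<bar>"
    and h: "continuous_on UNIV h" "\<And>y. 0 \<le> h y"
  shows "(\<integral>\<^sup>+x\<in>S. ennreal (m * h (G x)) \<partial>lborel) \<le> (\<integral>\<^sup>+y\<in>cball 0 C. ennreal (h y) \<partial>lborel)"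
proof -
  let ?d = "\<lambda>x. \<bar>det (matrix (G' x))\<bar>"
  define D where "D x = ?d x * h (G x)" for x
  obtain a b :: "real^'m::_" where ab: "G ` S \<subseteq> cbox a b"
    using bounded_subset_cbox_symmetric[OF bounded_subset[OF bounded_cball GS(2)]] by blast
  have "h absolutely_integrable_on (cbox a b)"
    using h(1) by (intro absolutely_integrable_continuous) (auto intro: continuous_on_subset)
  then have hGS: "h absolutely_integrable_on (G ` S)"
    using set_integrable_subset[of lebesgue "cbox a b" h "G ` S"] GS ab by simp
  \<comment> \<open>The change of variables is stated for vector values; \<open>real^1\<close>
    carries the scalar integrand.\<close>
  have "(\<lambda>x. ?d x *\<^sub>R (vec (h (G x)) :: real^1)) absolutely_integrable_on S \<and>
       integral S (\<lambda>x. ?d x *\<^sub>R (vec (h (G x)) :: real^1)) = vec (integral (G ` S) h)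
     \<longleftrightarrow> (\<lambda>y. vec (h y) :: real^1) absolutely_integrable_on (G ` S) \<and> integral (G ` S) (\<lambda>y. vec (h y) :: real^1) = vec (integral (G ` S) h)"
    using S der inj
    by (intro has_absolute_integral_change_of_variables) (auto intro: has_derivative_at_withinI)
  then have "D absolutely_integrable_on S \<and> integral S D = integral (G ` S) h"
    using hGS by (simp add: absolutely_integrable_on_1_iff integral_on_1_eq D_def[abs_def])
  then have "(D has_integral integral (G ` S) h) S"
    using absolutely_integrable_on_def has_integral_iff by blast
  then have "(\<integral>\<^sup>+x\<in>S. ennreal (D x) \<partial>lborel) = ennreal (integral (G ` S) h)"
    by (rule nn_integral_has_integral_lebesgue'[rotated]) (simp add: D_def h(2))
  also have "\<dots> = (\<integral>\<^sup>+y\<in>G ` S. ennreal (h y) \<partial>lborel)"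
    using hGS h by (intro nn_integral_has_integral_lebesgue'[symmetric])
      (auto simp: has_integral_iff absolutely_integrable_on_def)
  also have "\<dots> \<le> (\<integral>\<^sup>+y\<in>cball 0 C. ennreal (h y) \<partial>lborel)"
    using GS by (intro nn_integral_mono) (auto simp: indicator_def)
  finally show ?thesis
  proof (rule order_trans[rotated])
    show "(\<integral>\<^sup>+x\<in>S. ennreal (m * h (G x)) \<partial>lborel) \<le> (\<integral>\<^sup>+x\<in>S. ennreal (D x) \<partial>lborel)"
      using det h by (intro nn_integral_mono) (auto simp: indicator_def D_def intro!: ennreal_leI mult_right_mono)
  qed
qed

text \<open>All data are conjugated by the relabelling of coordinates, an isometry that preserves
  Lebesgue measure and the Jacobian determinant.\<close>

lemma change_of_variables_ineq:
  fixes G :: "real^'n \<Rightarrow> real^'n" and h :: "real^'n \<Rightarrow> real"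
  assumes S: "open S" and GS: "open (G ` S)" "G ` S \<subseteq> cball 0 C"
    and der: "\<And>x. x \<in> S \<Longrightarrow> (G has_derivative G' x) (at x)" and inj: "inj_on G S"
    and det: "\<And>x. x \<in> S \<Longrightarrow> m \<le> \<bar>det (matrix (G' x))\<bar>"
    and h: "continuous_on UNIV h" "\<And>y. 0 \<le> h y"
  shows "(\<integral>\<^sup>+x\<in>S. ennreal (m * h (G x)) \<partial>lborel) \<le> (\<integral>\<^sup>+y\<in>cball 0 C. ennreal (h y) \<partial>lborel)"
proof -
  define S' where "S' = (of_wo -` S :: (real^'n wo) set)"
  define H where "H = to_wo \<circ> G \<circ> of_wo"
  define H' where "H' y = to_wo \<circ> G' (of_wo y) \<circ> of_wo" for y :: "real^'n wo"
  define h' where "h' = h \<circ> of_wo"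
  have open_vim: "open (of_wo -` U)" if "open U" for U :: "(real^'n) set"
    by (rule open_vimage[OF that continuous_on_of_wo])
  have nrm: "norm (of_wo y) = norm y" for y :: "real^'n wo"
  proof -
    have "(\<Sum>i\<in>UNIV. (y $ Abs_wo i)\<^sup>2) = (\<Sum>i\<in>UNIV. (y $ i)\<^sup>2)"
      by (rule sum.reindex_bij_betw[OF bij_Abs_wo])
    then show ?thesis by (simp add: norm_vec_def L2_set_def of_wo_def)
  qed
  have HS: "H ` S' = of_wo -` (G ` S)"
  proof (intro equalityI subsetI)
    fix z assume "z \<in> of_wo -` (G ` S)"
    then obtain x where x: "x \<in> S" "of_wo z = G x" by auto
    then have "z = H (to_wo x)" by (metis H_def comp_apply of_to_wo to_of_wo)
    moreover have "to_wo x \<in> S'" using x by (simp add: S'_def)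
    ultimately show "z \<in> H ` S'" by blast
  qed (auto simp: H_def S'_def)
  have "(\<integral>\<^sup>+y\<in>S'. ennreal (m * h' (H y)) \<partial>lborel) \<le> (\<integral>\<^sup>+y\<in>cball 0 C. ennreal (h' y) \<partial>lborel)"
  proof (rule change_of_variables_ineq_wellorder)
    show "open S'" "open (H ` S')" unfolding HS unfolding S'_def using S GS open_vim by auto
    show "H ` S' \<subseteq> cball 0 C" unfolding HS
    proof
      fix y assume "y \<in> of_wo -` (G ` S)"
      then have "of_wo y \<in> cball 0 C" using GS(2) by blast
      then show "y \<in> cball 0 C" by (simp add: nrm)
    qed
    show "(H has_derivative H' y) (at y)" if "y \<in> S'" for y
      unfolding H_def H'_def using der that
      by (intro diff_chain_at has_derivative_to_wo has_derivative_of_wo) (auto simp: S'_def)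
    show "inj_on H S'"
      unfolding H_def S'_def using inj
      by (auto simp: inj_on_def dest!: arg_cong[where f = of_wo]) (metis to_of_wo)
    show "m \<le> \<bar>det (matrix (H' y))\<bar>" if "y \<in> S'" for y
    proof -
      have ax: "of_wo (axis j 1 :: real^'n wo) = axis (Rep_wo j) 1" for j
        by (auto simp: of_wo_def vec_eq_iff axis_def Abs_wo_inverse Rep_wo_inverse)
      have "matrix (H' y) = (\<chi> i j. matrix (G' (of_wo y)) $ Rep_wo i $ Rep_wo j)"
        by (simp add: vec_eq_iff matrix_def H'_def ax) (simp add: to_wo_def)
      then show ?thesis using det[of "of_wo y"] that by (simp add: det_reindex_wo S'_def)
    qed
    show "continuous_on UNIV h'"
      unfolding h'_def using h(1) by (intro continuous_on_compose continuous_on_of_wo) (auto intro: continuous_on_subset)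
    show "0 \<le> h' y" for y using h(2) by (simp add: h'_def)
  qed
  moreover have "(\<integral>\<^sup>+y\<in>S'. ennreal (m * h' (H y)) \<partial>lborel) = (\<integral>\<^sup>+x\<in>S. ennreal (m * h (G x)) \<partial>lborel)"
  proof -
    have "continuous_on S G"
      using der by (meson continuous_at_imp_continuous_on has_derivative_continuous)
    then have "continuous_on S (\<lambda>x. m * h (G x))"
      by (intro continuous_intros continuous_on_compose2[OF h(1)]) auto
    then have "(\<lambda>x. indicator S x *\<^sub>R (m * h (G x))) \<in> borel_measurable borel"
      using S by (intro borel_measurable_continuous_on_indicator) auto
    moreover have "(\<lambda>x. ennreal (m * h (G x)) * indicator S x) = (\<lambda>x. ennreal (indicator S x *\<^sub>R (m * h (G x))))"
      by (auto simp: indicator_def)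
    ultimately have m: "(\<lambda>x. ennreal (m * h (G x)) * indicator S x) \<in> borel_measurable borel"
      by simp
    have "(\<integral>\<^sup>+y\<in>S'. ennreal (m * h' (H y)) \<partial>lborel)
        = (\<integral>\<^sup>+y. ennreal (m * h (G (of_wo y))) * indicator S (of_wo y) \<partial>distr lborel borel to_wo)"
      unfolding distr_to_wo by (simp add: h'_def H_def S'_def indicator_def)
    also have "\<dots> = (\<integral>\<^sup>+x\<in>S. ennreal (m * h (G x)) \<partial>lborel)"
      using measurable_compose[OF measurable_of_wo m] by (subst nn_integral_distr) simp_all
    finally show ?thesis .
  qed
  moreover have "(\<integral>\<^sup>+y\<in>cball 0 C. ennreal (h' y) \<partial>lborel) = (\<integral>\<^sup>+x\<in>cball 0 C. ennreal (h x) \<partial>lborel)"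
  proof -
    have [measurable]: "h \<in> borel_measurable borel" using h(1) by (rule borel_measurable_continuous_onI)
    have [measurable]: "cball (0 :: real^'n) C \<in> sets borel" by simp
    have m: "(\<lambda>x. ennreal (h x) * indicator (cball 0 C) x) \<in> borel_measurable borel"
      by measurable
    have "(\<integral>\<^sup>+y\<in>cball 0 C. ennreal (h' y) \<partial>lborel)
        = (\<integral>\<^sup>+y. ennreal (h (of_wo y)) * indicator (cball 0 C) (of_wo y) \<partial>distr lborel borel to_wo)"
      unfolding distr_to_wo by (simp add: h'_def indicator_def nrm)
    also have "\<dots> = (\<integral>\<^sup>+x\<in>cball 0 C. ennreal (h x) \<partial>lborel)"
      using measurable_compose[OF measurable_of_wo m] by (subst nn_integral_distr) simp_all
    finally show ?thesis .
  qed
  ultimately show ?thesis by simp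
qed

text \<open>The slice of the ball at height x has radius sqrt (C^2 - x^2) \<le> C, so the volume of
  an (n-1)-ball of radius C bounds all slices. For n = 1 the slice is a point, counted with volume
  1.\<close>

lemma nn_integral_ball_slices:
  fixes \<psi> :: "real \<Rightarrow> real"
  assumes [measurable]: "\<psi> \<in> borel_measurable borel" and "C > 0"
  shows "(\<integral>\<^sup>+y\<in>cball 0 C. ennreal (\<psi> (y $ i)) \<partial>(lborel :: (real^'n) measure))
    \<le> ennreal (unit_ball_vol (real (CARD('n) - 1)) * C ^ (CARD('n) - 1)) * (\<integral>\<^sup>+x\<in>{-C..C}. ennreal (\<psi> x) \<partial>lborel)"
proof -
  interpret product_sigma_finite "\<lambda>_. lborel :: real measure" ..
  define b :: "real^'n" where "b = axis i 1"
  define J where "J = Basis - {b}"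
  have b: "b \<in> Basis" by (simp add: b_def axis_in_Basis_iff)
  have BJ: "Basis = insert b J" "b \<notin> J" "finite J" using b by (auto simp: J_def)
  have card: "card J = CARD('n) - 1"
    unfolding J_def using b by simp
  define F where "F y = ennreal (\<psi> (y \<bullet> b)) * indicator (cball 0 C) y" for y :: "real^'n"
  have [measurable]: "cball (0 :: real^'n) C \<in> sets borel" by simp
  have [measurable]: "F \<in> borel_measurable borel" unfolding F_def by measurable
  let ?s = "\<lambda>f. \<Sum>b\<in>Basis. f b *\<^sub>R b :: real^'n"
  let ?V = "unit_ball_vol (real (CARD('n) - 1)) * C ^ (CARD('n) - 1)"
  let ?z = "\<lambda>f y. ?s (f(b := y))"
  let ?M = "\<Pi>\<^sub>M b\<in>J. (lborel :: real measure)"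
  have "(\<integral>\<^sup>+y\<in>cball 0 C. ennreal (\<psi> (y $ i)) \<partial>(lborel :: (real^'n) measure)) = (\<integral>\<^sup>+y. F y \<partial>lborel)"
    by (simp add: F_def b_def inner_axis)
  also have "\<dots> = (\<integral>\<^sup>+f. F (?s f) \<partial>(\<Pi>\<^sub>M b\<in>Basis. lborel))"
    by (subst lborel_eq, subst nn_integral_distr) auto
  also have "\<dots> = (\<integral>\<^sup>+y. \<integral>\<^sup>+f. F (?z f y) \<partial>?M \<partial>lborel)"
    unfolding BJ(1) by (rule product_nn_integral_insert_rev[OF BJ(3,2)]) (simp add: BJ(1)[symmetric])
  also have "\<dots> \<le> (\<integral>\<^sup>+y. ennreal (?V) * (ennreal (\<psi> y) * indicator {-C..C} y) \<partial>lborel)"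
  proof (rule nn_integral_mono)
    fix y :: real
    \<comment> \<open>A ball in the remaining coordinates, chosen independently of \<open>y\<close>
      so that its measure is a constant.\<close>
    let ?B = "{f. sqrt (\<Sum>b\<in>J. (f b)\<^sup>2) \<le> C} \<inter> space ?M"
    have B [measurable]: "?B \<in> sets ?M"
    proof -
      have "{f \<in> space ?M. sqrt (\<Sum>b\<in>J. (f b)\<^sup>2) \<le> C} \<in> sets ?M"
        by measurable
      then show ?thesis by (simp add: Int_def conj_commute)
    qed
    have "(\<integral>\<^sup>+f. F (?z f y) \<partial>?M)
       \<le> (\<integral>\<^sup>+f. (ennreal (\<psi> y) * indicator {-C..C} y) * indicator ?B f \<partial>?M)"
    proof (rule nn_integral_mono)
      fix f assume f: "f \<in> space ?M"
      have inner: "(?z f y) \<bullet> c = (f(b := y)) c" if "c \<in> Basis" for c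
        using that by (rule inner_sum_left_Basis)
      have "(norm (?z f y))\<^sup>2 = (\<Sum>c\<in>Basis. ((f(b := y)) c)\<^sup>2)"
        unfolding power2_norm_eq_inner
        by (subst euclidean_inner) (rule sum.cong, simp_all only: inner power2_eq_square)
      also have "\<dots> = y\<^sup>2 + (\<Sum>c\<in>J. (f c)\<^sup>2)"
        unfolding BJ(1) using BJ(2,3) by (subst sum.insert) (auto intro!: sum.cong)
      finally have N: "(norm (?z f y))\<^sup>2 = y\<^sup>2 + (\<Sum>c\<in>J. (f c)\<^sup>2)" .
      show "F (?z f y) \<le> (ennreal (\<psi> y) * indicator {-C..C} y) * indicator ?B f"
      proof (cases "(?z f y) \<in> cball 0 C")
        case True
        then have "(norm (?z f y))\<^sup>2 \<le> C\<^sup>2" by (intro power_mono) auto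
        then have "y\<^sup>2 \<le> C\<^sup>2" "(\<Sum>c\<in>J. (f c)\<^sup>2) \<le> C\<^sup>2"
          unfolding N using sum_nonneg[of J "\<lambda>c. (f c)\<^sup>2"] zero_le_power2[of y] by - (simp, smt (verit) zero_le_power2)
        then have "\<bar>y\<bar> \<le> C" "sqrt (\<Sum>c\<in>J. (f c)\<^sup>2) \<le> C"
          using \<open>C > 0\<close> by (auto simp: abs_le_square_iff[symmetric] intro: real_le_lsqrt sum_nonneg)
        then show ?thesis using f inner[OF b] by (auto simp: F_def indicator_def)
      qed (simp add: F_def)
    qed
    also have "\<dots> = (ennreal (\<psi> y) * indicator {-C..C} y) * emeasure ?M ?B"
      by (rule nn_integral_cmult_indicator[OF B])
    also have "emeasure ?M ?B = ennreal (?V)"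
      using emeasure_cball_aux[OF BJ(3) \<open>C > 0\<close>] by (simp add: card)
    finally show "(\<integral>\<^sup>+f. F (?z f y) \<partial>?M)
       \<le> ennreal (?V) * (ennreal (\<psi> y) * indicator {-C..C} y)"
      by (simp add: mult.commute)
  qed
  also have "\<dots> = ennreal (?V) * (\<integral>\<^sup>+x\<in>{-C..C}. ennreal (\<psi> x) \<partial>lborel)"
    by (rule nn_integral_cmult) measurable
  finally show ?thesis .
qed

text \<open>Only the length of v survives: in rotated coordinates v \<bullet> g is |v| times one
  coordinate, and the slices of the ball orthogonal to it give the constant.\<close>

lemma nn_integral_resonant_direction:
  fixes g :: "real^'n \<Rightarrow> real^'n" and \<psi> :: "real \<Rightarrow> real"
  assumes A: "open A" "open (g ` A)" "inj_on g A" and "C > 0" "m > 0"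
    and C: "\<And>I. I \<in> A \<Longrightarrow> norm (g I) \<le> C"
    and g: "\<And>I. I \<in> A \<Longrightarrow> g differentiable (at I)"
    and det: "\<And>I. I \<in> A \<Longrightarrow> m \<le> \<bar>det (jacobian g (at I))\<bar>"
    and \<psi>: "continuous_on UNIV \<psi>" "\<And>x. 0 \<le> \<psi> x"
  shows "(\<integral>\<^sup>+I\<in>A. ennreal (\<psi> (v \<bullet> g I)) \<partial>lborel)
    \<le> ennreal (unit_ball_vol (real (CARD('n) - 1)) * C ^ (CARD('n) - 1) / m) * (\<integral>\<^sup>+x\<in>{-C..C}. ennreal (\<psi> (norm v * x)) \<partial>lborel)"
proof -
  let ?V = "unit_ball_vol (real (CARD('n) - 1)) * C ^ (CARD('n) - 1)"
  let ?J = "\<integral>\<^sup>+x\<in>{-C..C}. ennreal (\<psi> (norm v * x)) \<partial>lborel"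
  let ?\<psi> = "\<lambda>I. m * \<psi> (v \<bullet> g I)"
  let ?g' = "\<lambda>I. frechet_derivative g (at I)"
  obtain i :: 'n where True by simp
  \<comment> \<open>The coordinate \<open>i\<close> is arbitrary. A rotation preserves the ball and
    the modulus of the Jacobian determinant, so the bounds C and m carry over.\<close>
  obtain R where R: "orthogonal_transformation R" "R v = norm v *\<^sub>R (axis i 1 :: real^'n)"
    using orthogonal_transformation_exists[of v "norm v *\<^sub>R axis i 1"] by auto
  define h where "h y = \<psi> (norm v * y $ i)" for y :: "real^'n"
  have "linear R" and Rinner: "\<And>x y. R x \<bullet> R y = x \<bullet> y" and Rnorm: "\<And>x. norm (R x) = norm x"
    using R(1) by (auto simp: orthogonal_transformation_def orthogonal_transformation_norm)
  have hR: "h (R (g I)) = \<psi> (v \<bullet> g I)" for I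
  proof -
    have "v \<bullet> g I = R v \<bullet> R (g I)" by (simp add: Rinner)
    also have "\<dots> = norm v * R (g I) $ i" by (simp add: R(2) inner_axis')
    finally show ?thesis by (simp add: h_def)
  qed
  have bl: "bounded_linear R" using \<open>linear R\<close> by (simp add: linear_conv_bounded_linear)
  have "(\<integral>\<^sup>+I\<in>A. ennreal (m * h ((R \<circ> g) I)) \<partial>lborel) \<le> (\<integral>\<^sup>+y\<in>cball 0 C. ennreal (h y) \<partial>lborel)"
  proof (rule change_of_variables_ineq[where G' = "\<lambda>I. R \<circ> ?g' I"])
    show "open A" by fact
    show "open ((R \<circ> g) ` A)"
      unfolding image_comp[symmetric]
      by (rule open_surjective_linear_image[OF A(2) \<open>linear R\<close> orthogonal_transformation_surj[OF R(1)]])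
    show "(R \<circ> g) ` A \<subseteq> cball 0 C" using C Rnorm by auto
    show "(R \<circ> g has_derivative R \<circ> ?g' I) (at I)" if "I \<in> A" for I
      using g[OF that] by (intro diff_chain_at bounded_linear_imp_has_derivative bl) (simp add: frechet_derivative_works[symmetric])
    show "inj_on (R \<circ> g) A"
      using A(3) orthogonal_transformation_inj[OF R(1)] by (auto intro: comp_inj_on inj_on_subset)
    show "m \<le> \<bar>det (matrix (R \<circ> ?g' I))\<bar>" if "I \<in> A" for I
    proof -
      have "linear (?g' I)" using g[OF that] by (rule linear_frechet_derivative)
      then have "det (matrix (R \<circ> ?g' I)) = det (matrix R) * det (jacobian g (at I))"
        using \<open>linear R\<close> by (simp add: matrix_compose det_mul jacobian_def)
      moreover have "\<bar>det (matrix R)\<bar> = 1"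
        using R(1) by (simp add: orthogonal_transformation_det)
      ultimately show ?thesis using det[OF that] by (simp add: abs_mult)
    qed
    show "continuous_on UNIV h"
      unfolding h_def by (intro continuous_on_compose2[OF \<psi>(1)] continuous_intros) auto
    show "0 \<le> h y" for y by (simp add: h_def \<psi>)
  qed
  also have "\<dots> \<le> ennreal (?V) * (?J)"
    unfolding h_def
    by (rule nn_integral_ball_slices[of "\<lambda>x. \<psi> (norm v * x)"])
      (auto intro!: \<open>C > 0\<close> borel_measurable_continuous_onI continuous_on_compose2[OF \<psi>(1)] continuous_intros)
  finally have main: "(\<integral>\<^sup>+I\<in>A. ennreal (?\<psi> I) \<partial>lborel)
    \<le> ennreal (?V) * (?J)"
    by (simp add: hR)
  have "continuous_on A g"
    using g by (meson continuous_at_imp_continuous_on differentiable_imp_continuous_within)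
  then have "continuous_on A (\<lambda>I. ?\<psi> I)"
    by (intro continuous_intros continuous_on_compose2[OF \<psi>(1)]) auto
  then have "(\<lambda>I. indicator A I *\<^sub>R (?\<psi> I)) \<in> borel_measurable borel"
    using A(1) by (intro borel_measurable_continuous_on_indicator) auto
  then have meas: "(\<lambda>I. ennreal (indicator A I *\<^sub>R (?\<psi> I))) \<in> borel_measurable lborel"
    by simp
  have "(\<integral>\<^sup>+I\<in>A. ennreal (\<psi> (v \<bullet> g I)) \<partial>lborel) = (\<integral>\<^sup>+I. ennreal (1 / m) * ennreal (indicator A I *\<^sub>R (?\<psi> I)) \<partial>lborel)"
    using \<open>m > 0\<close> \<psi>(2) by (intro nn_integral_cong) (auto simp: indicator_def simp flip: ennreal_mult)
  also have "\<dots> = ennreal (1 / m) * (\<integral>\<^sup>+I. ennreal (indicator A I *\<^sub>R (?\<psi> I)) \<partial>lborel)"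
    by (rule nn_integral_cmult[OF meas])
  also have "(\<integral>\<^sup>+I. ennreal (indicator A I *\<^sub>R (?\<psi> I)) \<partial>lborel) = (\<integral>\<^sup>+I\<in>A. ennreal (?\<psi> I) \<partial>lborel)"
    by (intro nn_integral_cong) (auto simp: indicator_def)
  also have "ennreal (1 / m) * \<dots> \<le> ennreal (1 / m) * (ennreal (?V) * (?J))"
    by (rule mult_left_mono[OF main]) simp
  also have "\<dots> = ennreal (?V / m) * (?J)"
  proof -
    have "ennreal (1 / m) * ennreal (?V)
        = ennreal (1 / m * (?V))"
      using \<open>m > 0\<close> \<open>C > 0\<close> by (intro ennreal_mult[symmetric]) auto
    then show ?thesis unfolding mult.assoc[symmetric] by simp
  qed
  finally show ?thesis .
qed

section \<open>Non-convergence in the resonant zones\<close>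

lemma norm_diff_le_nn_integral:
  fixes v :: "real \<Rightarrow> complex"
  assumes ab: "a \<le> b" and v: "\<And>s. s \<in> {a..b} \<Longrightarrow> (v has_vector_derivative W s) (at s)"
    and W: "continuous_on {a..b} W"
  shows "ennreal (cmod (v b - v a)) \<le> (\<integral>\<^sup>+s\<in>{a..b}. ennreal (cmod (W s)) \<partial>lborel)"
proof -
  have "integral\<^sup>L lborel (\<lambda>x. indicator {a..b} x *\<^sub>R W x) = v b - v a"
    using v by (intro integral_FTC_atLeastAtMost ab W) (auto intro: has_vector_derivative_at_within)
  moreover have "integrable lborel (\<lambda>x. indicator {a..b} x *\<^sub>R W x)"
    using W by (intro borel_integrable_compact) auto
  ultimately have "ennreal (cmod (v b - v a)) \<le> (\<integral>\<^sup>+s. ennreal (norm (indicator {a..b} s *\<^sub>R W s)) \<partial>lborel)"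
    using integral_norm_bound_ennreal by metis
  also have "\<dots> = (\<integral>\<^sup>+s\<in>{a..b}. ennreal (cmod (W s)) \<partial>lborel)"
    by (intro nn_integral_cong) (auto simp: indicator_def)
  finally show ?thesis .
qed

text \<open>Integrating over all translates of the segment, instead of slicing \<open>U\<close> along \<open>e\<close>, avoids splitting
  off a coordinate.\<close>

lemma nn_integral_directional_derivative_ge:
  fixes v W :: "real^'n \<Rightarrow> complex" and e :: "real^'n"
  assumes B: "open B" and U: "open U" and W: "continuous_on B W" and "\<delta> > 0"
    and line: "\<And>I s. I \<in> U \<Longrightarrow> \<bar>s\<bar> \<le> \<delta> \<Longrightarrow> I + s *\<^sub>R e \<in> B"
    and deriv: "\<And>I s. I \<in> U \<Longrightarrow> \<bar>s\<bar> \<le> \<delta> \<Longrightarrow> ((\<lambda>t. v (I + t *\<^sub>R e)) has_vector_derivative W (I + s *\<^sub>R e)) (at s)"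
    and osc: "\<And>I. I \<in> U \<Longrightarrow> \<exists>s. \<bar>s\<bar> \<le> \<delta> \<and> b \<le> cmod (v (I + \<delta> *\<^sub>R e) - v (I + s *\<^sub>R e))"
  shows "ennreal b * emeasure lborel U \<le> ennreal (2 * \<delta>) * (\<integral>\<^sup>+I\<in>B. ennreal (cmod (W I)) \<partial>lborel)"
proof -
  \<comment> \<open>Extended by zero outside B, the modulus of W is measurable on the whole space,
    where translations act.\<close>
  define N where "N I = ennreal (cmod (indicator B I *\<^sub>R W I))" for I
  have Wm: "(\<lambda>I. indicator B I *\<^sub>R W I) \<in> borel_measurable borel"
    using B W by (intro borel_measurable_continuous_on_indicator) auto
  have Nm [measurable]: "N \<in> borel_measurable borel"
    using Wm unfolding N_def by measurable
  have [measurable]: "U \<in> sets borel" using U by simp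
  have pt: "ennreal b \<le> (\<integral>\<^sup>+s\<in>{-\<delta>..\<delta>}. N (I + s *\<^sub>R e) \<partial>lborel)" if I: "I \<in> U" for I
  proof -
    obtain s where s: "\<bar>s\<bar> \<le> \<delta>" "b \<le> cmod (v (I + \<delta> *\<^sub>R e) - v (I + s *\<^sub>R e))"
      using osc[OF I] by blast
    have "ennreal b \<le> ennreal (cmod (v (I + \<delta> *\<^sub>R e) - v (I + s *\<^sub>R e)))"
      using s(2) by (rule ennreal_leI)
    also have "\<dots> \<le> (\<integral>\<^sup>+r\<in>{s..\<delta>}. ennreal (cmod (W (I + r *\<^sub>R e))) \<partial>lborel)"
    proof (rule norm_diff_le_nn_integral)
      show "s \<le> \<delta>" using s by simp
      show "((\<lambda>t. v (I + t *\<^sub>R e)) has_vector_derivative W (I + r *\<^sub>R e)) (at r)" if "r \<in> {s..\<delta>}" for r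
        using that s by (intro deriv[OF I]) auto
      show "continuous_on {s..\<delta>} (\<lambda>r. W (I + r *\<^sub>R e))"
        by (rule continuous_on_compose2[OF W]) (use s line[OF I] in \<open>auto intro!: continuous_intros\<close>)
    qed
    also have "\<dots> \<le> (\<integral>\<^sup>+r\<in>{-\<delta>..\<delta>}. N (I + r *\<^sub>R e) \<partial>lborel)"
      using s line[OF I] by (intro nn_integral_mono) (auto simp: N_def indicator_def)
    finally show ?thesis .
  qed
  have "ennreal b * emeasure lborel U = (\<integral>\<^sup>+I. ennreal b * indicator U I \<partial>lborel)"
    by (simp add: nn_integral_cmult_indicator)
  also have "\<dots> \<le> (\<integral>\<^sup>+I. \<integral>\<^sup>+s. indicator {-\<delta>..\<delta>} s * N (I + s *\<^sub>R e) \<partial>lborel \<partial>lborel)"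
    using pt by (intro nn_integral_mono) (auto simp: indicator_def mult.commute)
  also have "\<dots> = (\<integral>\<^sup>+s. \<integral>\<^sup>+I. indicator {-\<delta>..\<delta>} s * N (I + s *\<^sub>R e) \<partial>lborel \<partial>lborel)"
    by (rule lborel_pair.Fubini'[symmetric]) measurable
  \<comment> \<open>By translation invariance the inner integral does not depend on s, so the outer
    one contributes just the length 2 \<delta>.\<close>
  also have "\<dots> = (\<integral>\<^sup>+s. indicator {-\<delta>..\<delta>} s * (\<integral>\<^sup>+I. N I \<partial>lborel) \<partial>lborel)"
  proof (rule nn_integral_cong)
    fix s :: real
    have "(\<integral>\<^sup>+I. N I \<partial>lborel) = (\<integral>\<^sup>+I. N I \<partial>distr lborel borel ((+) (s *\<^sub>R e)))"
      by (simp add: lborel_distr_plus)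
    also have "\<dots> = (\<integral>\<^sup>+I. N (I + s *\<^sub>R e) \<partial>lborel)"
      by (subst nn_integral_distr) (auto simp: add.commute)
    finally show "(\<integral>\<^sup>+I. indicator {-\<delta>..\<delta>} s * N (I + s *\<^sub>R e) \<partial>lborel) = indicator {-\<delta>..\<delta>} s * (\<integral>\<^sup>+I. N I \<partial>lborel)"
      by (subst nn_integral_cmult) auto
  qed
  also have "\<dots> = ennreal (2 * \<delta>) * (\<integral>\<^sup>+I. N I \<partial>lborel)"
    using \<open>\<delta> > 0\<close> by (subst nn_integral_multc) auto
  also have "(\<integral>\<^sup>+I. N I \<partial>lborel) = (\<integral>\<^sup>+I\<in>B. ennreal (cmod (W I)) \<partial>lborel)"
    unfolding N_def by (intro nn_integral_cong) (auto simp: indicator_def)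
  finally show ?thesis .
qed

text \<open>Since a(h) / h tends to \<alpha>, the sign of a(h) near 0 is that of h \<alpha>. In the
  application a is the resonance function along a line.\<close>

lemma sign_change:
  fixes a :: "real \<Rightarrow> real"
  assumes "(a has_real_derivative \<alpha>) (at 0)" "a 0 = 0" "\<alpha> \<noteq> 0" "\<rho> > 0"
  obtains \<delta> where "0 < \<delta>" "\<delta> < \<rho>" "a \<delta> * a (- \<delta>) < 0"
proof -
  have "((\<lambda>h. a h / h) \<longlongrightarrow> \<alpha>) (at 0)"
    using assms(1,2) by (simp add: has_field_derivative_iff)
  then have "((\<lambda>h. (a h / h) * \<alpha>) \<longlongrightarrow> \<alpha> * \<alpha>) (at 0)"
    by (intro tendsto_intros)
  moreover have "\<alpha> * \<alpha> > 0" using \<open>\<alpha> \<noteq> 0\<close> by (auto simp: zero_less_mult_iff)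
  ultimately have "eventually (\<lambda>h. (a h / h) * \<alpha> > 0) (at 0)"
    by (rule order_tendstoD)
  then obtain d where d: "d > 0" "\<And>h. h \<noteq> 0 \<Longrightarrow> \<bar>h\<bar> < d \<Longrightarrow> (a h / h) * \<alpha> > 0"
    by (auto simp: eventually_at dist_real_def)
  define \<delta> where "\<delta> = min d \<rho> / 2"
  have \<delta>: "0 < \<delta>" "\<delta> < \<rho>" "\<delta> < d" using d \<open>\<rho> > 0\<close> by (auto simp: \<delta>_def min_def)
  have p: "(a \<delta> / \<delta>) * \<alpha> > 0" "(a (- \<delta>) / (- \<delta>)) * \<alpha> > 0"
    using \<delta> by (intro d(2); simp)+
  have "((a \<delta> / \<delta>) * \<alpha>) * ((a (- \<delta>) / (- \<delta>)) * \<alpha>) > 0"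
    by (rule mult_pos_pos[OF p])
  moreover have "((a \<delta> / \<delta>) * \<alpha>) * ((a (- \<delta>) / (- \<delta>)) * \<alpha>) = - (a \<delta> * a (- \<delta>)) * (\<alpha> / \<delta>)\<^sup>2"
    by (simp add: power2_eq_square)
  ultimately have "- (a \<delta> * a (- \<delta>)) * (\<alpha> / \<delta>)\<^sup>2 > 0" by simp
  then have "a \<delta> * a (- \<delta>) < 0"
    by (simp add: zero_less_mult_iff mult_less_0_iff)
  then show ?thesis using that \<delta> by blast
qed

text \<open>\<open>e\<close> is transversal to the hypersurface \<open>a = 0\<close> at \<open>I0\<close>, so short segments in direction \<open>e\<close> near
  \<open>I0\<close> cross it; the endpoint of each segment stays where \<open>\<sigma>\<close> is small.\<close>

lemma modulated_derivative_lower_bound: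
  fixes c dc :: "real^'n \<Rightarrow> complex" and a da :: "real^'n \<Rightarrow> real"
    and \<sigma> \<sigma>' :: "'x \<Rightarrow> real \<Rightarrow> complex"
  assumes B: "open B" and I0: "I0 \<in> B" "a I0 = 0" "c I0 \<noteq> 0" "da I0 \<noteq> 0"
    and cont: "continuous_on B c" "continuous_on B dc" "continuous_on B a" "continuous_on B da"
    and a: "\<And>I s. I + s *\<^sub>R e \<in> B \<Longrightarrow> ((\<lambda>t. a (I + t *\<^sub>R e)) has_vector_derivative da (I + s *\<^sub>R e)) (at s)"
    and v: "\<And>\<tau> I s. \<tau> \<in> X \<Longrightarrow> I + s *\<^sub>R e \<in> B \<Longrightarrow> ((\<lambda>t. c (I + t *\<^sub>R e) * \<sigma> \<tau> (a (I + t *\<^sub>R e))) has_vector_derivative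
      dc (I + s *\<^sub>R e) * \<sigma> \<tau> (a (I + s *\<^sub>R e)) + c (I + s *\<^sub>R e) * (of_real (da (I + s *\<^sub>R e)) * \<sigma>' \<tau> (a (I + s *\<^sub>R e)))) (at s)"
    and \<sigma>: "\<And>\<tau>. \<tau> \<in> X \<Longrightarrow> continuous_on UNIV (\<sigma> \<tau>)" "\<And>\<tau>. \<tau> \<in> X \<Longrightarrow> continuous_on UNIV (\<sigma>' \<tau>)" "\<And>\<tau>. \<tau> \<in> X \<Longrightarrow> \<sigma> \<tau> 0 = 1"
    and X: "eventually (\<lambda>\<tau>. \<tau> \<in> X) F"
    and decay: "\<And>\<eta> \<epsilon>. \<eta> > 0 \<Longrightarrow> \<epsilon> > 0 \<Longrightarrow> eventually (\<lambda>\<tau>. \<forall>x. \<bar>x\<bar> \<ge> \<eta> \<longrightarrow> cmod (\<sigma> \<tau> x) \<le> \<epsilon>) F"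
  obtains \<kappa> where "\<kappa> > 0" "eventually (\<lambda>\<tau>. ennreal \<kappa> \<le> (\<integral>\<^sup>+I\<in>B. ennreal (cmod
      (dc I * \<sigma> \<tau> (a I) + c I * (of_real (da I) * \<sigma>' \<tau> (a I)))) \<partial>lborel)) F"
proof -
  let ?p = "\<lambda>I s. I + s *\<^sub>R e"
  \<comment> \<open>With this choice b \<le> |c| \<le> 3 b wherever c is within b of its value at
    \<open>I0\<close>.\<close>
  define b where "b = cmod (c I0) / 2"
  have b: "b > 0" using I0 by (simp add: b_def)
  have at: "isCont c I0" "isCont a I0"
    using cont(1,3) B I0(1) by (auto simp: continuous_on_eq_continuous_at)
  have "eventually (\<lambda>I. dist (c I) (c I0) < b) (nhds I0)"
    using at(1) b unfolding isCont_def tendsto_iff eventually_at_filter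
    by (auto elim!: eventually_mono)
  moreover have "eventually (\<lambda>I. I \<in> B) (nhds I0)"
    using B I0(1) by (rule eventually_nhds_in_open)
  ultimately have "eventually (\<lambda>I. I \<in> B \<and> dist (c I) (c I0) < b) (nhds I0)"
    by eventually_elim simp
  then obtain \<rho> where \<rho>: "\<rho> > 0" "\<And>I. dist I I0 < \<rho> \<Longrightarrow> I \<in> B \<and> dist (c I) (c I0) < b"
    by (auto simp: eventually_nhds_metric)
  have c: "b \<le> cmod (c I)" "cmod (c I) \<le> 3 * b" if "dist I I0 < \<rho>" for I
    using \<rho>(2)[OF that] norm_triangle_ineq2[of "c I0" "c I"] norm_triangle_ineq2[of "c I" "c I0"]
    by (auto simp: b_def dist_norm norm_minus_commute)
  have "((\<lambda>t. a (?p I0 t)) has_real_derivative da I0) (at 0)"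
    using a[of I0 0] I0(1) by (simp add: has_real_derivative_iff_has_vector_derivative)
  \<comment> \<open>Segments of half-length \<delta> below this bound move points by less than
    \<rho> / 2, so those centred in the half ball stay in the ball. The summand 1 keeps the divisor
    positive for every e.\<close>
  moreover have "\<rho> / (2 * (1 + norm e)) > 0" using \<rho> by (simp add: add_pos_nonneg)
  ultimately obtain \<delta> where \<delta>: "0 < \<delta>" "\<delta> < \<rho> / (2 * (1 + norm e))" "a (?p I0 \<delta>) * a (?p I0 (- \<delta>)) < 0"
    using sign_change[of "\<lambda>t. a (?p I0 t)" "da I0"] I0 by auto
  have "\<delta> * (1 + norm e) < \<rho> / 2"
    using \<delta>(2) by (simp add: field_simps add_pos_nonneg)
  then have \<delta>e: "\<delta> * norm e < \<rho> / 2" using \<delta>(1) by (simp add: algebra_simps)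
  have near: "dist (?p I s) I0 < \<rho>" if "dist I I0 < \<rho> / 2" "\<bar>s\<bar> \<le> \<delta>" for I s
  proof -
    have "dist (?p I s) I0 \<le> dist I I0 + \<bar>s\<bar> * norm e"
      using norm_triangle_ineq[of "I - I0" "s *\<^sub>R e"] by (simp add: dist_norm algebra_simps)
    also have "\<bar>s\<bar> * norm e \<le> \<delta> * norm e" using that by (intro mult_right_mono) auto
    finally show ?thesis using that \<delta>e by linarith
  qed
  have conta: "isCont (\<lambda>I. a (?p I s)) I0" if "\<bar>s\<bar> \<le> \<delta>" for s
  proof -
    have "?p I0 s \<in> B" using near[of I0 s] that \<rho> by auto
    then have "isCont a (?p I0 s)" using cont(3) B by (auto simp: continuous_on_eq_continuous_at)
    moreover have "isCont (\<lambda>I. ?p I s) I0" by (intro continuous_intros)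
    ultimately show ?thesis using isCont_o2[where f = "\<lambda>I. ?p I s" and g = a and a = I0] by blast
  qed
  \<comment> \<open>\<open>q I < 0\<close> says that a has opposite signs at the two ends of the
    segment through I. This is an open condition, so all nearby segments cross the resonance, not
    only the one through \<open>I0\<close>.\<close>
  define q where "q I = a (?p I \<delta>) * a (?p I (- \<delta>))" for I
  define \<eta> where "\<eta> = \<bar>a (?p I0 \<delta>)\<bar> / 2"
  have \<eta>: "\<eta> > 0" using \<delta>(3) by (auto simp: \<eta>_def)
  have "isCont q I0" unfolding q_def using \<delta>(1) by (intro isCont_mult conta) auto
  have nh: "(p \<longlongrightarrow> p I0) (nhds I0)" if "isCont p I0" for p :: "real^'n \<Rightarrow> real"
    using that unfolding isCont_def tendsto_at_iff_tendsto_nhds .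
  have "(q \<longlongrightarrow> q I0) (nhds I0)" by (rule nh) fact
  moreover have "q I0 < 0" using \<delta>(3) by (simp add: q_def)
  ultimately have "eventually (\<lambda>I. q I < 0) (nhds I0)"
    by (rule order_tendstoD)
  moreover have "eventually (\<lambda>I. \<bar>a (?p I \<delta>)\<bar> > \<eta>) (nhds I0)"
  proof -
    have "((\<lambda>I. \<bar>a (?p I \<delta>)\<bar>) \<longlongrightarrow> \<bar>a (?p I0 \<delta>)\<bar>) (nhds I0)"
      using nh[OF conta[of \<delta>]] \<delta>(1) by (intro tendsto_rabs) simp
    moreover have "\<eta> < \<bar>a (?p I0 \<delta>)\<bar>" using \<eta> by (simp add: \<eta>_def)
    ultimately show ?thesis by (rule order_tendstoD)
  qed
  ultimately have "eventually (\<lambda>I. q I < 0 \<and> \<bar>a (?p I \<delta>)\<bar> > \<eta>) (nhds I0)"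
    by eventually_elim simp
  then obtain r where r: "r > 0" "\<And>I. dist I I0 < r \<Longrightarrow> q I < 0 \<and> \<bar>a (?p I \<delta>)\<bar> > \<eta>"
    by (auto simp: eventually_nhds_metric)
  define U where "U = ball I0 (min r (\<rho> / 2))"
  have U: "q I < 0" "\<bar>a (?p I \<delta>)\<bar> > \<eta>" "dist I I0 < \<rho> / 2" if "I \<in> U" for I
    using that r(2)[of I] by (auto simp: U_def dist_commute)
  define W where "W \<tau> I = dc I * \<sigma> \<tau> (a I) + c I * (of_real (da I) * \<sigma>' \<tau> (a I))" for \<tau> I
  let ?W = "\<lambda>\<tau>. \<integral>\<^sup>+I\<in>B. ennreal (cmod (W \<tau> I)) \<partial>lborel"
  let ?v = "\<lambda>\<tau> I s. c (I + s *\<^sub>R e) * \<sigma> \<tau> (a (I + s *\<^sub>R e))"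
  \<comment> \<open>At the crossing the modulus of c \<sigma> is at least b, at the end point at
    most 3 b / 6 = b / 2. The difference b / 2 is the oscillation that every segment must
    show.\<close>
  have key: "ennreal (b / 2) * emeasure lborel U \<le> ennreal (2 * \<delta>) * (?W \<tau>)"
    if \<tau>: "\<tau> \<in> X" and small: "\<And>x. \<bar>x\<bar> \<ge> \<eta> \<Longrightarrow> cmod (\<sigma> \<tau> x) \<le> 1 / 6" for \<tau>
  proof (rule nn_integral_directional_derivative_ge[where v = "\<lambda>I. c I * \<sigma> \<tau> (a I)"])
    show "open B" "open U" "\<delta> > 0" using B \<delta> by (auto simp: U_def)
    show "continuous_on B (W \<tau>)"
      unfolding W_def
      by (intro continuous_intros cont continuous_on_compose2[OF \<sigma>(1)[OF \<tau>]] continuous_on_compose2[OF \<sigma>(2)[OF \<tau>]]) auto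
    fix I assume I: "I \<in> U"
    show mem: "?p I s \<in> B" if "\<bar>s\<bar> \<le> \<delta>" for s
      using \<rho>(2) near[OF U(3)[OF I] that] by blast
    show "((\<lambda>t. c (?p I t) * \<sigma> \<tau> (a (?p I t))) has_vector_derivative W \<tau> (?p I s)) (at s)"
      if "\<bar>s\<bar> \<le> \<delta>" for s
      unfolding W_def using v[OF \<tau> mem[OF that]] .
    have ca: "continuous_on {-\<delta>..\<delta>} (\<lambda>s. a (?p I s))"
      by (rule continuous_on_compose2[OF cont(3)]) (use mem in \<open>auto intro!: continuous_intros\<close>)
    have "\<exists>s\<ge>- \<delta>. s \<le> \<delta> \<and> a (?p I s) = 0"
    proof (cases "a (?p I (- \<delta>)) \<le> 0")
      case True
      then have "0 \<le> a (?p I \<delta>)" using U(1)[OF I] by (auto simp: q_def mult_less_0_iff)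
      then show ?thesis using True ca \<delta>(1) by (intro IVT') auto
    next
      case False
      then have "a (?p I \<delta>) \<le> 0" using U(1)[OF I] by (auto simp: q_def mult_less_0_iff)
      then show ?thesis using False ca \<delta>(1) by (intro IVT2') auto
    qed
    then obtain s where "- \<delta> \<le> s" "s \<le> \<delta>" and s0: "a (?p I s) = 0" by blast
    then have s: "\<bar>s\<bar> \<le> \<delta>" "a (?p I s) = 0" by auto
    have "b \<le> cmod (?v \<tau> I s)"
      using c(1)[OF near[OF U(3)[OF I] s(1)]] s(2) \<sigma>(3)[OF \<tau>] by simp
    moreover have "cmod (?v \<tau> I \<delta>) \<le> (3 * b) * (1 / 6)"
      unfolding norm_mult using c(2)[OF near[OF U(3)[OF I], of \<delta>]] \<delta>(1) U(2)[OF I] b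
      by (intro mult_mono small) auto
    ultimately have "b / 2 \<le> cmod (?v \<tau> I \<delta> - ?v \<tau> I s)"
      using norm_triangle_ineq3[of "?v \<tau> I \<delta>" "?v \<tau> I s"]
      by linarith
    then show "\<exists>s. \<bar>s\<bar> \<le> \<delta> \<and> b / 2 \<le> cmod (?v \<tau> I \<delta> - ?v \<tau> I s)"
      using s(1) by blast
  qed
  define K where "K = measure lborel U"
  have K: "K > 0" unfolding K_def U_def using r \<rho> by (intro content_ball_pos) auto
  have fin: "emeasure lborel U = ennreal K"
    unfolding K_def U_def by (rule emeasure_eq_ennreal_measure)
      (use emeasure_lborel_ball_finite[of I0 "min r (\<rho> / 2)"] in auto)
  show ?thesis
  proof (rule that)
    show "b / 2 * K / (2 * \<delta>) > 0" using b K \<delta> by simp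
    have "eventually (\<lambda>\<tau>. \<forall>x. \<bar>x\<bar> \<ge> \<eta> \<longrightarrow> cmod (\<sigma> \<tau> x) \<le> 1 / 6) F"
      using decay[OF \<eta>, of "1 / 6"] by simp
    with X have "eventually (\<lambda>\<tau>. ennreal (b / 2 * K / (2 * \<delta>)) \<le> (?W \<tau>)) F"
    proof eventually_elim
      case (elim \<tau>)
      show ?case
      \<comment> \<open>An infinite integral satisfies the bound trivially; a finite one allows
        division by 2 \<delta> in the reals.\<close>
      proof (cases "?W \<tau>")
        case (real w)
        have "ennreal (b / 2) * ennreal K \<le> ennreal (2 * \<delta>) * ennreal w"
          using key[OF elim(1)] elim(2) unfolding fin real by blast
        moreover have "ennreal (b / 2) * ennreal K = ennreal (b / 2 * K)" "ennreal (2 * \<delta>) * ennreal w = ennreal (2 * \<delta> * w)"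
          using b K \<delta>(1) real by (intro ennreal_mult[symmetric]; simp)+
        ultimately have "ennreal (b / 2 * K) \<le> ennreal (2 * \<delta> * w)" by simp
        then have "b / 2 * K \<le> 2 * \<delta> * w"
          using real \<delta> by (subst (asm) ennreal_le_iff) auto
        then show ?thesis unfolding real using \<delta>(1) by (intro ennreal_leI) (simp add: field_simps)
      qed simp
    qed
    then show "eventually (\<lambda>\<tau>. ennreal (b / 2 * K / (2 * \<delta>)) \<le> (\<integral>\<^sup>+I\<in>B. ennreal (cmod
      (dc I * \<sigma> \<tau> (a I) + c I * (of_real (da I) * \<sigma>' \<tau> (a I)))) \<partial>lborel)) F"
      by (simp add: W_def)
  qed
qed

section \<open>Derivatives and decay of the multipliers\<close>

lemma time_mult_deriv:
  assumes "T > 0"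
  defines "d \<equiv> \<lambda>a. (1 / T) *\<^sub>R integral {0..T} (\<lambda>t. \<i> * complex_of_real t * cis (t * a))"
  shows "(time_mult T has_vector_derivative d a) (at a)" "continuous_on UNIV d"
proof -
  have tm: "time_mult T = (\<lambda>a. (1 / T) *\<^sub>R integral (cbox 0 T) (\<lambda>t. cis (t * a)))"
  proof
    fix a
    have "set_integrable lborel {0..T} (\<lambda>t. cis (t * a))"
      by (intro set_integrable_continuous_Icc continuous_intros)
    from set_borel_integral_eq_integral(2)[OF this]
    show "time_mult T a = (1 / T) *\<^sub>R integral (cbox 0 T) (\<lambda>t. cis (t * a))"
      by (simp add: time_mult_def)
  qed
  have "((\<lambda>a. integral (cbox 0 T) (\<lambda>t. cis (t * a))) has_vector_derivative
      integral (cbox 0 T) (\<lambda>t. \<i> * complex_of_real t * cis (t * a))) (at a within UNIV)"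
  proof (rule leibniz_rule_vector_derivative)
    show "((\<lambda>a. cis (t * a)) has_vector_derivative \<i> * complex_of_real t * cis (t * a)) (at a within UNIV)" for t a
    proof -
      have "((\<lambda>z. exp (\<i> * (complex_of_real t * z))) has_field_derivative
          \<i> * complex_of_real t * exp (\<i> * (complex_of_real t * complex_of_real a))) (at (complex_of_real a))"
        by (auto intro!: derivative_eq_intros)
      from has_vector_derivative_real_field[OF this] show ?thesis by (simp add: cis_conv_exp)
    qed
    show "(\<lambda>t. cis (t * a)) integrable_on cbox 0 T" for a
      by (intro integrable_continuous continuous_intros)
    show "continuous_on (UNIV \<times> cbox 0 T) (\<lambda>(a, t). \<i> * complex_of_real t * cis (t * a))"
      unfolding case_prod_beta' by (intro continuous_intros)
  qed auto
  then show "(time_mult T has_vector_derivative d a) (at a)"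
    unfolding tm d_def by (intro bounded_linear.has_vector_derivative[OF bounded_linear_scaleR_right]) simp
  have "continuous_on UNIV (\<lambda>a. integral (cbox 0 T) (\<lambda>t. \<i> * complex_of_real t * cis (t * a)))"
    by (rule integral_continuous_on_param) (unfold case_prod_beta', intro continuous_intros)
  then show "continuous_on UNIV d" unfolding d_def by (intro continuous_intros) simp
qed

lemma time_mult_decay:
  assumes "\<eta> > 0" "\<epsilon> > 0"
  shows "eventually (\<lambda>T. \<forall>x. \<bar>x\<bar> \<ge> \<eta> \<longrightarrow> cmod (time_mult T x) \<le> \<epsilon>) at_top"
  using eventually_ge_at_top[of "2 / (\<epsilon> * \<eta>)"] eventually_gt_at_top[of 0]
proof eventually_elim
  case (elim T)
  show ?case
  proof (intro allI impI)
    fix x assume x: "\<bar>x\<bar> \<ge> \<eta>"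
    then have "cmod (time_mult T x) \<le> 2 / (T * \<bar>x\<bar>)"
      using elim assms by (intro norm_time_mult_le) auto
    also have "\<dots> \<le> 2 / (T * \<eta>)"
      using x elim assms by (intro divide_left_mono mult_left_mono mult_pos_pos) auto
    also have "\<dots> \<le> \<epsilon>" using elim assms by (simp add: field_simps)
    finally show "cmod (time_mult T x) \<le> \<epsilon>" .
  qed
qed

definition disc_mult_deriv :: "real \<Rightarrow> real \<Rightarrow> real \<Rightarrow> complex" where
  "disc_mult_deriv \<mu> s a = complex_of_real \<mu> * \<i> / (complex_of_real s - \<i> * complex_of_real a)\<^sup>2"

lemma disc_mult_denom_nonzero: "s > 0 \<Longrightarrow> complex_of_real s - \<i> * complex_of_real a \<noteq> 0"
  by (simp add: complex_eq_iff)

lemma disc_mult_deriv: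
  assumes "s > 0"
  shows "(disc_mult \<mu> s has_vector_derivative disc_mult_deriv \<mu> s a) (at a)"
    and "continuous_on UNIV (disc_mult_deriv \<mu> s)"
proof -
  note nz = disc_mult_denom_nonzero[OF assms]
  have "((\<lambda>z. complex_of_real \<mu> / (complex_of_real s - \<i> * z)) has_field_derivative disc_mult_deriv \<mu> s a) (at (complex_of_real a))"
    unfolding disc_mult_deriv_def using nz[of a]
    by (auto intro!: derivative_eq_intros simp: power2_eq_square)
  from has_vector_derivative_real_field[OF this]
  show "(disc_mult \<mu> s has_vector_derivative disc_mult_deriv \<mu> s a) (at a)"
    by (simp add: disc_mult_def[abs_def])
  show "continuous_on UNIV (disc_mult_deriv \<mu> s)"
    unfolding disc_mult_deriv_def using nz by (intro continuous_intros) auto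
qed

lemma norm_disc_mult_denom: "cmod (complex_of_real s - \<i> * complex_of_real a) = sqrt (s\<^sup>2 + a\<^sup>2)"
  by (simp add: cmod_def)

lemma norm_disc_mult: "\<mu> > 0 \<Longrightarrow> cmod (disc_mult \<mu> s a) = \<mu> / sqrt (s\<^sup>2 + a\<^sup>2)"
  by (simp add: disc_mult_def norm_divide norm_disc_mult_denom)

lemma norm_disc_mult_deriv: "\<mu> > 0 \<Longrightarrow> cmod (disc_mult_deriv \<mu> s a) = \<mu> / (s\<^sup>2 + a\<^sup>2)"
  by (simp add: disc_mult_deriv_def norm_divide norm_mult norm_power norm_disc_mult_denom)

lemma disc_mult_decay:
  assumes "\<eta> > 0" "\<epsilon> > 0"
  shows "eventually (\<lambda>\<mu>. \<forall>x. \<bar>x\<bar> \<ge> \<eta> \<longrightarrow> cmod (disc_mult \<mu> \<mu> x) \<le> \<epsilon>) (at_right 0)"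
proof -
  have "eventually (\<lambda>\<mu>. \<mu> \<in> {0<..<\<epsilon> * \<eta>}) (at_right 0)"
    using assms by (intro eventually_at_right_real) simp
  then show ?thesis
  proof eventually_elim
    case (elim \<mu>)
    show ?case
    proof (intro allI impI)
      fix x assume x: "\<bar>x\<bar> \<ge> \<eta>"
      have "\<eta> \<le> sqrt (x\<^sup>2)" using x by simp
      also have "\<dots> \<le> sqrt (\<mu>\<^sup>2 + x\<^sup>2)" by simp
      finally have "\<mu> / sqrt (\<mu>\<^sup>2 + x\<^sup>2) \<le> \<mu> / \<eta>"
        using elim assms by (intro divide_left_mono mult_pos_pos) (auto simp: add_pos_nonneg)
      also have "\<dots> \<le> \<epsilon>" using elim assms by (simp add: field_simps)
      finally show "cmod (disc_mult \<mu> \<mu> x) \<le> \<epsilon>" using elim by (simp add: norm_disc_mult)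
    qed
  qed
qed

section \<open>Null sets of resonances and failure of convergence\<close>

lemma diffeomorphism_on_props:
  fixes g :: "real^'n \<Rightarrow> real^'n"
  assumes "diffeomorphism_on A g"
  shows "I \<in> A \<Longrightarrow> g differentiable (at I)" "continuous_on A g"
    "continuous_on A (freq_deriv g k j)"
    "inj_on g A" "open (g ` A)"
    "y \<in> g ` A \<Longrightarrow> inv_into A g differentiable (at y)"
proof -
  have g: "\<forall>x\<in>A. g differentiable (at x)" "\<forall>b\<in>Basis. continuous_on A (\<lambda>x. frechet_derivative g (at x) b)"
    using assms by (auto simp: diffeomorphism_on_def)
  show "I \<in> A \<Longrightarrow> g differentiable (at I)" using g by blast
  show "continuous_on A g"
    using g(1) by (meson continuous_at_imp_continuous_on differentiable_imp_continuous_within)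
  have "continuous_on A (\<lambda>x. frechet_derivative g (at x) (axis j 1))"
    using g(2) by (simp add: axis_in_Basis_iff)
  then show "continuous_on A (freq_deriv g k j)"
    unfolding freq_deriv_def by (intro continuous_intros)
  show "inj_on g A" "open (g ` A)" "y \<in> g ` A \<Longrightarrow> inv_into A g differentiable (at y)"
    using assms by (auto simp: diffeomorphism_on_def)
qed

lemma ivec_eq_0_iff: "ivec k = 0 \<longleftrightarrow> k = 0"
  by (simp add: ivec_def vec_eq_iff)

text \<open>The resonance is the image of part of a hyperplane under the differentiable inverse of
  g, and differentiable maps between spaces of equal dimension send null sets to null sets.\<close>

lemma resonance_null:
  fixes g :: "real^'n \<Rightarrow> real^'n"
  assumes A: "open A" and g: "diffeomorphism_on A g" and "k \<noteq> 0"
  shows "{I \<in> A. ivec k \<bullet> g I = 0} \<in> null_sets lborel"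
proof -
  let ?H = "{y \<in> g ` A. ivec k \<bullet> y = 0}"
  have "negligible {y. ivec k \<bullet> y = 0}"
    using \<open>k \<noteq> 0\<close> by (intro negligible_hyperplane) (simp add: ivec_eq_0_iff)
  then have "negligible ?H" by (rule negligible_subset) auto
  moreover have "inv_into A g differentiable_on ?H"
    using diffeomorphism_on_props(6)[OF g] by (auto simp: differentiable_on_def differentiable_at_withinI)
  ultimately have "negligible (inv_into A g ` ?H)"
    by (intro negligible_differentiable_image_negligible) auto
  moreover have "inv_into A g ` ?H = {I \<in> A. ivec k \<bullet> g I = 0}"
    using diffeomorphism_on_props(4)[OF g] by (force simp: image_iff)
  ultimately have "{I \<in> A. ivec k \<bullet> g I = 0} \<in> null_sets lebesgue"
    by (simp add: negligible_iff_null_sets)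
  \<comment> \<open>Nullity is first obtained for the completed measure. The resonance is relatively
    closed in the open set A, hence Borel.\<close>
  moreover have "{I \<in> A. ivec k \<bullet> g I = 0} \<in> sets lborel"
  proof -
    have "continuous_on A (\<lambda>I. ivec k \<bullet> g I)"
      by (intro continuous_intros diffeomorphism_on_props(2)[OF g])
    then have "open (A \<inter> (\<lambda>I. ivec k \<bullet> g I) -` (- {0}))"
      using A by (intro continuous_open_preimage) auto
    then have "A - (A \<inter> (\<lambda>I. ivec k \<bullet> g I) -` (- {0})) \<in> sets lborel"
      using A by (intro sets.Diff) auto
    moreover have "A - (A \<inter> (\<lambda>I. ivec k \<bullet> g I) -` (- {0})) = {I \<in> A. ivec k \<bullet> g I = 0}" by auto
    ultimately show ?thesis by simp
  qed
  ultimately show ?thesis by (metis null_sets_completion_iff)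
qed

lemma resonances_null:
  assumes "open A" "diffeomorphism_on A g"
  shows "resonances A g \<in> null_sets lborel"
  unfolding resonances_def
  using resonance_null[OF assms] by (intro null_sets_UN') auto

text \<open>The condition k \<bullet> g(I) \<noteq> 0 is open, so near I the indicator term vanishes
  identically and the coefficient coincides with f_k \<sigma>(k \<bullet> g).\<close>

lemma partial_average_coeff:
  fixes f u :: "(real^'n) \<times> (real^'n) \<Rightarrow> real" and g :: "real^'n \<Rightarrow> real^'n"
  assumes A: "open A" and f: "smooth_on (A \<times> UNIV) f" and g: "diffeomorphism_on A g"
    and u: "\<And>I. I \<in> A \<Longrightarrow> fourier_coeff u k I = fourier_coeff f k I * (\<sigma> (ivec k \<bullet> g I) - of_bool (ivec k \<bullet> g I = 0))"
    and \<sigma>: "(\<sigma> has_vector_derivative d) (at (ivec k \<bullet> g I))"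
    and I: "I \<in> A" "ivec k \<bullet> g I \<noteq> 0"
  shows "partial j (fourier_coeff u k) I
    = coeff_deriv f k j I * \<sigma> (ivec k \<bullet> g I) + fourier_coeff f k I * (of_real (freq_deriv g k j I) * d)"
proof (rule partial_eqI)
  let ?D = "coeff_deriv f k j I * \<sigma> (ivec k \<bullet> g I) + fourier_coeff f k I * (of_real (freq_deriv g k j I) * d)"
  let ?p = "\<lambda>t. I + t *\<^sub>R axis j 1"
  define S where "S = A \<inter> (\<lambda>I. ivec k \<bullet> g I) -` (- {0})"
  have "continuous_on A (\<lambda>I. ivec k \<bullet> g I)"
    by (intro continuous_intros diffeomorphism_on_props(2)[OF g])
  then have "open S" unfolding S_def using A by (intro continuous_open_preimage) auto
  then have oS: "open ((\<lambda>t. ?p t) -` S)"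
    by (intro open_vimage continuous_intros)
  have mem: "0 \<in> (\<lambda>t. ?p t) -` S" using I by (simp add: S_def)
  have deriv: "((\<lambda>t. fourier_coeff f k (?p t) * \<sigma> (ivec k \<bullet> g (?p t))) has_vector_derivative
      ?D) (at 0)"
    using modulated_coeff_line_derivative[OF A f, of I 0 j g \<sigma> d k] diffeomorphism_on_props(1)[OF g] I \<sigma> by simp
  show "((\<lambda>t. fourier_coeff u k (?p t)) has_vector_derivative
      ?D) (at 0)"
    by (rule has_vector_derivative_transform_within_open[OF deriv oS mem]) (auto simp: S_def u)
qed

lemma norm1_ge_partial:
  fixes u :: "(real^'n) \<times> (real^'n) \<Rightarrow> real"
  shows "(\<integral>\<^sup>+I\<in>S. ennreal (cmod (partial j (fourier_coeff u k) I)) \<partial>lborel) \<le> norm1 S u"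
proof -
  define G where "G k j = (\<integral>\<^sup>+I\<in>S. ennreal (cmod (partial j (fourier_coeff u k) I)
      + cmod (of_int (k $ j) * fourier_coeff u k I)) \<partial>lborel)" for k j
  have "(\<integral>\<^sup>+I\<in>S. ennreal (cmod (partial j (fourier_coeff u k) I)) \<partial>lborel) \<le> G k j"
    unfolding G_def by (intro nn_integral_mono mult_right_mono ennreal_leI) auto
  also have "\<dots> \<le> (\<Sum>j\<in>UNIV. G k j)"
    by (rule member_le_sum) auto
  also have "\<dots> = (\<Sum>\<^sub>\<infinity>k\<in>{k}. \<Sum>j\<in>UNIV. G k j)" by simp
  also have "\<dots> \<le> (\<Sum>\<^sub>\<infinity>k\<in>UNIV. \<Sum>j\<in>UNIV. G k j)"
    by (rule infsum_mono_neutral) (auto intro: nonneg_summable_on_complete)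
  also have "\<dots> \<le> norm1 S u"
    unfolding norm1_def G_def by simp
  finally show ?thesis .
qed

text \<open>The filter F, the multipliers \<sigma> and the admissible parameters X are left open, to
  serve both T \<rightarrow> \<infinity> and \<mu> \<rightarrow> 0. The conflict between \<sigma>(0)
  = 1 and uniform decay away from 0 is what prevents convergence.\<close>

lemma norm1_not_tendsto_0:
  fixes f :: "(real^'n) \<times> (real^'n) \<Rightarrow> real" and g :: "real^'n \<Rightarrow> real^'n"
    and \<sigma> \<sigma>' :: "'x \<Rightarrow> real \<Rightarrow> complex" and u :: "'x \<Rightarrow> (real^'n) \<times> (real^'n) \<Rightarrow> real"
  assumes A: "open A" and f: "smooth_on (A \<times> UNIV) f" and g: "diffeomorphism_on A g"
    and det: "\<And>I. I \<in> A \<Longrightarrow> det (jacobian g (at I)) \<noteq> 0"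
    and dense: "A \<subseteq> closure (active_resonances A g f)"
    and B: "open B" "B \<noteq> {}" "B \<subseteq> A"
    and u: "\<And>\<tau> k I. \<tau> \<in> X \<Longrightarrow> I \<in> A \<Longrightarrow> fourier_coeff (u \<tau>) k I
        = fourier_coeff f k I * (\<sigma> \<tau> (ivec k \<bullet> g I) - of_bool (ivec k \<bullet> g I = 0))"
    and \<sigma>: "\<And>\<tau> a. \<tau> \<in> X \<Longrightarrow> (\<sigma> \<tau> has_vector_derivative \<sigma>' \<tau> a) (at a)"
      "\<And>\<tau>. \<tau> \<in> X \<Longrightarrow> continuous_on UNIV (\<sigma>' \<tau>)" "\<And>\<tau>. \<tau> \<in> X \<Longrightarrow> \<sigma> \<tau> 0 = 1"
    and X: "eventually (\<lambda>\<tau>. \<tau> \<in> X) F"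
    and decay: "\<And>\<eta> \<epsilon>. \<eta> > 0 \<Longrightarrow> \<epsilon> > 0 \<Longrightarrow> eventually (\<lambda>\<tau>. \<forall>x. \<bar>x\<bar> \<ge> \<eta> \<longrightarrow> cmod (\<sigma> \<tau> x) \<le> \<epsilon>) F"
    and F: "F \<noteq> bot"
  shows "\<not> ((\<lambda>\<tau>. norm1 (B - resonances A g) (u \<tau>)) \<longlongrightarrow> 0) F"
proof
  assume lim: "((\<lambda>\<tau>. norm1 (B - resonances A g) (u \<tau>)) \<longlongrightarrow> 0) F"
  have "\<exists>I0\<in>B. I0 \<in> active_resonances A g f"
    using B dense open_Int_closure_eq_empty[OF B(1), of "active_resonances A g f"] by blast
  then obtain I0 k where I0: "I0 \<in> B" "k \<noteq> 0" "ivec k \<bullet> g I0 = 0" "fourier_coeff f k I0 \<noteq> 0"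
    by (auto simp: active_resonances_def)
  have "I0 \<in> A" using I0 B by auto
  \<comment> \<open>If all partial derivatives of k \<bullet> g vanished at \<open>I0\<close>, the
    transposed Jacobian would annihilate k \<noteq> 0, against its invertibility. So some coordinate
    direction is transversal to the resonance.\<close>
  have "\<exists>j. freq_deriv g k j I0 \<noteq> 0"
  proof (rule ccontr)
    assume "\<nexists>j. freq_deriv g k j I0 \<noteq> 0"
    moreover have "freq_deriv g k j I0 = (transpose (jacobian g (at I0)) *v ivec k) $ j" for j
      by (simp add: freq_deriv_def jacobian_def matrix_vector_mult_def transpose_def matrix_def inner_vec_def mult.commute)
    ultimately have "transpose (jacobian g (at I0)) *v ivec k = 0" by (simp add: vec_eq_iff)
    moreover have "invertible (transpose (jacobian g (at I0)))"
      using det[OF \<open>I0 \<in> A\<close>] by (simp add: invertible_det_nz)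
    ultimately have "ivec k = 0"
      by (metis invertible_def matrix_vector_mul_assoc matrix_vector_mul_lid matrix_vector_mult_0_right)
    then show False using I0(2) by (simp add: ivec_eq_0_iff)
  qed
  then obtain j where j: "freq_deriv g k j I0 \<noteq> 0" ..
  let ?p = "\<lambda>I s. I + s *\<^sub>R axis j 1"
  let ?a = "\<lambda>I. ivec k \<bullet> g I"
  \<comment> \<open>The derivative of f_k \<sigma>(k \<bullet> g), continuous across the resonance
    for admissible \<tau>. Off the null set of resonances it is the partial derivative that enters
    the norm.\<close>
  define W where "W \<tau> I = coeff_deriv f k j I * \<sigma> \<tau> (?a I)
      + fourier_coeff f k I * (of_real (freq_deriv g k j I) * \<sigma>' \<tau> (?a I))" for \<tau> I
  obtain \<kappa> where \<kappa>: "\<kappa> > 0" "eventually (\<lambda>\<tau>. ennreal \<kappa> \<le> (\<integral>\<^sup>+I\<in>B. ennreal (cmod (W \<tau> I)) \<partial>lborel)) F"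
    unfolding W_def
  proof (rule modulated_derivative_lower_bound[of B I0 "\<lambda>I. ?a I" "fourier_coeff f k" "freq_deriv g k j"
        "coeff_deriv f k j" "axis j 1" X \<sigma> \<sigma>' F])
    show "continuous_on B (fourier_coeff f k)" "continuous_on B (coeff_deriv f k j)"
      "continuous_on B (\<lambda>I. ?a I)" "continuous_on B (freq_deriv g k j)"
      by (intro continuous_on_inner continuous_on_const continuous_on_subset[OF _ B(3)]
          continuous_on_coeff[OF f] diffeomorphism_on_props(2,3)[OF g])+
    show "((\<lambda>t. ?a (?p I t)) has_vector_derivative freq_deriv g k j (?p I s)) (at s)"
      if "?p I s \<in> B" for I s
      using that B diffeomorphism_on_props(1)[OF g] by (intro freq_line_derivative) auto
    show "continuous_on UNIV (\<sigma> \<tau>)" if "\<tau> \<in> X" for \<tau>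
      using \<sigma>(1)[OF that] by (meson continuous_at_imp_continuous_on has_vector_derivative_continuous)
    show "((\<lambda>t. fourier_coeff f k (?p I t) * \<sigma> \<tau> (?a (?p I t))) has_vector_derivative
        coeff_deriv f k j (?p I s) * \<sigma> \<tau> (?a (?p I s)) +
        fourier_coeff f k (?p I s) *
        (complex_of_real (freq_deriv g k j (?p I s)) * \<sigma>' \<tau> (?a (?p I s)))) (at s)"
      if "\<tau> \<in> X" "?p I s \<in> B" for \<tau> I s
      using that B diffeomorphism_on_props(1)[OF g] \<sigma>(1)
      by (intro modulated_coeff_line_derivative[OF A f]) auto
  qed (use B I0 j \<sigma> X decay in auto)
  have "eventually (\<lambda>\<tau>. norm1 (B - resonances A g) (u \<tau>) < ennreal \<kappa>) F"
    using \<kappa>(1) by (intro order_tendstoD(2)[OF lim]) simp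
  with \<kappa>(2) X have "eventually (\<lambda>\<tau>. False) F"
  proof eventually_elim
    case (elim \<tau>)
    have "ennreal \<kappa> \<le> (\<integral>\<^sup>+I\<in>B. ennreal (cmod (W \<tau> I)) \<partial>lborel)" by fact
    also have "\<dots> = (\<integral>\<^sup>+I\<in>B - resonances A g. ennreal (cmod (W \<tau> I)) \<partial>lborel)"
      using AE_not_in[OF resonances_null[OF A g]]
      by (intro nn_integral_cong_AE) (auto elim!: eventually_mono simp: indicator_def)
    also have "\<dots> = (\<integral>\<^sup>+I\<in>B - resonances A g. ennreal (cmod (partial j (fourier_coeff (u \<tau>) k) I)) \<partial>lborel)"
    proof (rule nn_integral_cong)
      fix I
      show "ennreal (cmod (W \<tau> I)) * indicator (B - resonances A g) I
          = ennreal (cmod (partial j (fourier_coeff (u \<tau>) k) I)) * indicator (B - resonances A g) I"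
      proof (cases "I \<in> B - resonances A g")
        case True
        then have "I \<in> A" "?a I \<noteq> 0" using B I0(2) by (auto simp: resonances_def)
        then have "partial j (fourier_coeff (u \<tau>) k) I = W \<tau> I"
          unfolding W_def using elim by (intro partial_average_coeff[OF A f g u \<sigma>(1)]) auto
        then show ?thesis by simp
      qed simp
    qed
    also have "\<dots> \<le> norm1 (B - resonances A g) (u \<tau>)" by (rule norm1_ge_partial)
    finally show False using elim by auto
  qed
  then show False using F by (simp add: eventually_False)
qed

section \<open>Bounds for the noisy average\<close>

text \<open>With M = max 1 r the argument of the logarithm in arsinh r is at most M (1 + sqrt 2),
  and 1 + sqrt 2 \<le> 5/2 \<le> e.\<close>

lemma arsinh_le_log:
  fixes r :: real
  assumes "r > 0"
  shows "arsinh r \<le> 1 + max 0 (ln r)"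
proof -
  have "sqrt 2 \<le> 3 / 2" by (rule real_le_lsqrt) (simp_all add: power2_eq_square)
  moreover have "1 + 1 + 1 / 2 \<le> exp (1 :: real)"
    using exp_lower_Taylor_quadratic[of 1] by simp
  ultimately have e: "1 + sqrt 2 \<le> exp 1" by linarith
  define M where "M = max 1 r"
  have M: "M > 0" "1 \<le> M\<^sup>2" "r\<^sup>2 \<le> M\<^sup>2" "r \<le> M"
    using assms by (auto simp: M_def intro!: power_mono one_le_power)
  have "sqrt (r\<^sup>2 + 1) \<le> sqrt (M\<^sup>2 * 2)" using M by (intro real_sqrt_le_mono) simp
  also have "\<dots> = M * sqrt 2" using M by (simp add: real_sqrt_mult)
  finally have "r + sqrt (r\<^sup>2 + 1) \<le> M * (1 + sqrt 2)" using M by (simp add: algebra_simps)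
  also have "\<dots> \<le> M * exp 1" using M e by (intro mult_left_mono) auto
  finally have "ln (r + sqrt (r\<^sup>2 + 1)) \<le> ln (M * exp 1)"
    using assms by (intro ln_mono) (auto simp: add_pos_nonneg)
  also have "\<dots> = ln M + 1" using M by (simp add: ln_mult)
  also have "ln M = max 0 (ln r)" using assms by (auto simp: M_def max_def)
  finally show ?thesis by (simp add: arsinh_real_def)
qed

text \<open>The antiderivative is an arsinh in \<kappa> x / s; its oddness accounts for the factor
  2, and \<open>arsinh_le_log\<close> for the logarithm of the final bound.\<close>

lemma nn_integral_inverse_sqrt:
  fixes s \<kappa> C \<mu> :: real
  assumes "s > 0" "\<kappa> > 0" "C > 0" "\<mu> > 0"
  shows "(\<integral>\<^sup>+x\<in>{-C..C}. ennreal (\<mu> / sqrt (s\<^sup>2 + (\<kappa> * x)\<^sup>2)) \<partial>lborel)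
    \<le> ennreal (2 / \<kappa> * (\<mu> * (1 + max 0 (ln (\<kappa> * C / s)))))"
proof -
  let ?q = "\<lambda>x. s\<^sup>2 + (\<kappa> * x)\<^sup>2"
  have pos: "?q x > 0" for x using assms by (simp add: add_pos_nonneg)
  have eq: "(\<kappa> * x / s)\<^sup>2 + 1 = (?q x) / s\<^sup>2" for x
    using assms by (simp add: field_simps)
  have "(\<integral>\<^sup>+x\<in>{-C..C}. ennreal (\<mu> / sqrt (?q x)) \<partial>lborel)
      = ennreal (\<mu> / \<kappa> * arsinh (\<kappa> * C / s) - \<mu> / \<kappa> * arsinh (\<kappa> * (- C) / s))"
  proof (rule nn_integral_FTC_Icc)
    show "((\<lambda>x. \<mu> / \<kappa> * arsinh (\<kappa> * x / s)) has_real_derivative \<mu> / sqrt (?q x)) (at x)" for x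
    proof -
      have "\<mu> / \<kappa> * (1 / sqrt ((\<kappa> * x / s)\<^sup>2 + 1) * (\<kappa> / s)) = \<mu> / sqrt (?q x)"
        unfolding eq using assms pos[of x] by (simp add: real_sqrt_divide field_simps)
      moreover have "((\<lambda>x. \<kappa> * x / s) has_real_derivative \<kappa> / s) (at x)"
        using assms by (auto intro!: derivative_eq_intros)
      from DERIV_cmult[OF DERIV_chain2[OF arsinh_real_has_field_derivative this], of "\<mu> / \<kappa>"]
      have "((\<lambda>x. \<mu> / \<kappa> * arsinh (\<kappa> * x / s)) has_real_derivative \<mu> / \<kappa> * (1 / sqrt ((\<kappa> * x / s)\<^sup>2 + 1) * (\<kappa> / s))) (at x)" .
      ultimately show ?thesis by simp
    qed
  qed (use assms in auto)
  also have "\<mu> / \<kappa> * arsinh (\<kappa> * C / s) - \<mu> / \<kappa> * arsinh (\<kappa> * (- C) / s) = 2 / \<kappa> * (\<mu> * arsinh (\<kappa> * C / s))"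
    by simp
  also have "ennreal \<dots> \<le> ennreal (2 / \<kappa> * (\<mu> * (1 + max 0 (ln (\<kappa> * C / s)))))"
    using assms by (intro ennreal_leI mult_left_mono arsinh_le_log) auto
  finally show ?thesis .
qed

text \<open>The antiderivative is an arctangent, whose total variation is at most pi; so the
  estimate does not grow with C.\<close>

lemma nn_integral_inverse_square:
  fixes s \<kappa> C \<mu> :: real
  assumes "s > 0" "\<kappa> > 0" "C > 0" "\<mu> > 0"
  shows "(\<integral>\<^sup>+x\<in>{-C..C}. ennreal (\<mu> / (s\<^sup>2 + (\<kappa> * x)\<^sup>2)) \<partial>lborel) \<le> ennreal (\<mu> / (\<kappa> * s) * pi)"
proof -
  let ?q = "\<lambda>x. s\<^sup>2 + (\<kappa> * x)\<^sup>2"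
  let ?c = "\<mu> / (\<kappa> * s)"
  have pos: "?q x > 0" for x using assms by (simp add: add_pos_nonneg)
  have eq: "1 + (\<kappa> * x / s)\<^sup>2 = (?q x) / s\<^sup>2" for x
    using assms by (simp add: field_simps)
  have "(\<integral>\<^sup>+x\<in>{-C..C}. ennreal (\<mu> / (?q x)) \<partial>lborel)
      = ennreal (?c * arctan (\<kappa> * C / s) - ?c * arctan (\<kappa> * (- C) / s))"
  proof (rule nn_integral_FTC_Icc)
    show "((\<lambda>x. ?c * arctan (\<kappa> * x / s)) has_real_derivative \<mu> / (?q x)) (at x)" for x
    proof -
      have "?c * (inverse (1 + (\<kappa> * x / s)\<^sup>2) * (\<kappa> / s)) = \<mu> / (?q x)"
        unfolding eq using assms pos[of x] by (simp add: field_simps power2_eq_square)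
      moreover have "((\<lambda>x. ?c * arctan (\<kappa> * x / s)) has_real_derivative ?c * (inverse (1 + (\<kappa> * x / s)\<^sup>2) * (\<kappa> / s))) (at x)"
        using assms by (auto intro!: derivative_eq_intros)
      ultimately show ?thesis by simp
    qed
  qed (use assms in auto)
  also have "?c * arctan (\<kappa> * C / s) - ?c * arctan (\<kappa> * (- C) / s) = ?c * (2 * arctan (\<kappa> * C / s))"
    by (simp add: arctan_minus)
  also have "ennreal \<dots> \<le> ennreal (?c * pi)"
    using assms arctan_ubound[of "\<kappa> * C / s"] by (intro ennreal_leI mult_left_mono) auto
  finally show ?thesis .
qed

section \<open>Estimate of one harmonic and summation over the harmonics\<close>

lemma infsum_cmult_ennreal:
  fixes f :: "'a \<Rightarrow> ennreal"
  shows "(\<Sum>\<^sub>\<infinity>x\<in>A. c * f x) = c * (\<Sum>\<^sub>\<infinity>x\<in>A. f x)"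
proof -
  have "(\<Sum>\<^sub>\<infinity>x\<in>A. c * f x) = (SUP F\<in>{F. finite F \<and> F \<subseteq> A}. c * sum f F)"
    by (subst nonneg_infsum_complete) (simp_all add: sum_distrib_left)
  also have "\<dots> = c * (SUP F\<in>{F. finite F \<and> F \<subseteq> A}. sum f F)"
    by (rule SUP_mult_left_ennreal[symmetric])
  finally show ?thesis by (subst (2) nonneg_infsum_complete) simp_all
qed

lemma norm_ivec_ge_1:
  fixes k :: "int^'n"
  assumes "k \<noteq> 0"
  shows "norm (ivec k) \<ge> 1"
proof -
  obtain i where "k $ i \<noteq> 0" using assms by (auto simp: vec_eq_iff)
  then have "1 \<le> \<bar>real_of_int (k $ i)\<bar>" by linarith
  also have "\<dots> \<le> norm (ivec k)" using component_le_norm_cart[of "ivec k" i] by (simp add: ivec_def)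
  finally show ?thesis .
qed

text \<open>Each |k_i| is estimated by |k|, which costs a factor n. Summation over the n actions
  later brings the second factor of n^2.\<close>

lemma abs_freq_deriv_le:
  fixes g :: "real^'n \<Rightarrow> real^'n"
  assumes D: "\<And>i j. \<bar>jacobian g (at I) $ i $ j\<bar> \<le> D"
  shows "\<bar>freq_deriv g k j I\<bar> \<le> real CARD('n) * D * norm (ivec k)"
proof -
  have "freq_deriv g k j I = (\<Sum>i\<in>UNIV. ivec k $ i * jacobian g (at I) $ i $ j)"
    by (simp add: freq_deriv_def jacobian_def matrix_def inner_vec_def)
  also have "\<bar>\<dots>\<bar> \<le> (\<Sum>i\<in>UNIV. \<bar>ivec k $ i * jacobian g (at I) $ i $ j\<bar>)"
    by (rule sum_abs)
  also have "\<dots> \<le> (\<Sum>i\<in>(UNIV :: 'n set). norm (ivec k) * D)"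
    unfolding abs_mult by (intro sum_mono mult_mono component_le_norm_cart D) auto
  finally show ?thesis by (simp add: mult_ac)
qed

lemma ennreal_norm_le_sup_norm: "I \<in> A \<Longrightarrow> ennreal (cmod (v I)) \<le> sup_norm A v"
  unfolding sup_norm_def by (rule SUP_upper)

lemma borel_measurable_ennreal_on_open:
  fixes h :: "'a::euclidean_space \<Rightarrow> real"
  assumes "open A" "continuous_on A h"
  shows "(\<lambda>x. ennreal (h x) * indicator A x) \<in> borel_measurable lborel"
proof -
  have "(\<lambda>x. indicator A x *\<^sub>R h x) \<in> borel_measurable borel"
    using assms by (intro borel_measurable_continuous_on_indicator) auto
  then have "(\<lambda>x. ennreal (indicator A x *\<^sub>R h x)) \<in> borel_measurable lborel" by simp
  moreover have "(\<lambda>x. ennreal (indicator A x *\<^sub>R h x)) = (\<lambda>x. ennreal (h x) * indicator A x)"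
    by (auto simp: indicator_def)
  ultimately show ?thesis by simp
qed

text \<open>Off the resonances u_k = f_k \<sigma>. Terms with \<sigma> itself lead to the arsinh
  integral, those with its derivative to the arctan integral. The sup norms are pulled out in the
  extended reals and may be infinite.\<close>

lemma harmonic_norm_le:
  fixes f u :: "(real^'n) \<times> (real^'n) \<Rightarrow> real" and g :: "real^'n \<Rightarrow> real^'n"
  defines "K \<equiv> \<lambda>C m. 2 * (unit_ball_vol (real (CARD('n) - 1)) * C ^ (CARD('n) - 1)) / m"
  assumes A: "open A" and f: "smooth_on (A \<times> UNIV) f" and g: "diffeomorphism_on A g"
    and pos: "C > 0" "D > 0" "m > 0" "\<mu> > 0" "s > 0"
    and C: "\<And>I. I \<in> A \<Longrightarrow> norm (g I) \<le> C"
    and D: "\<And>I i j. I \<in> A \<Longrightarrow> \<bar>jacobian g (at I) $ i $ j\<bar> \<le> D"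
    and det: "\<And>I. I \<in> A \<Longrightarrow> m \<le> \<bar>det (jacobian g (at I))\<bar>"
    and k: "k \<noteq> 0"
    and u: "\<And>I. I \<in> A \<Longrightarrow> fourier_coeff u k I = fourier_coeff f k I * (disc_mult \<mu> s (ivec k \<bullet> g I) - of_bool (ivec k \<bullet> g I = 0))"
  shows "(\<integral>\<^sup>+I\<in>A - resonances A g. ennreal (cmod (fourier_coeff u k I)) \<partial>lborel)
      + (\<Sum>j\<in>UNIV. \<integral>\<^sup>+I\<in>A - resonances A g. ennreal (cmod (partial j (fourier_coeff u k) I)
          + cmod (of_int (k $ j) * fourier_coeff u k I)) \<partial>lborel)
    \<le> ennreal (K C m) * (ennreal (\<mu> * (1 + max 0 (ln (norm (ivec k) * C / s))))
          * (of_nat (1 + CARD('n)) * sup_norm A (fourier_coeff f k)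
             + (\<Sum>j\<in>UNIV. sup_norm A (partial j (fourier_coeff f k))))
        + ennreal (1/2 * (real CARD('n))\<^sup>2 * pi * D * (\<mu> / s)) * sup_norm A (fourier_coeff f k))"
proof -
  let ?pu = "\<lambda>j. partial j (fourier_coeff u k)"
  let ?u = "fourier_coeff u k"
  let ?c = "fourier_coeff f k"
  let ?d = "coeff_deriv f k"
  let ?b = "freq_deriv g k"
  let ?p = "\<lambda>I. \<mu> / sqrt (s\<^sup>2 + (ivec k \<bullet> g I)\<^sup>2)"
  let ?r = "\<lambda>I. \<mu> / (s\<^sup>2 + (ivec k \<bullet> g I)\<^sup>2)"
  let ?ku = "\<lambda>j I. of_int (k $ j) * fourier_coeff u k I"
  define \<kappa> where "\<kappa> = norm (ivec k)"
  have \<kappa>: "\<kappa> \<ge> 1" using norm_ivec_ge_1[OF k] by (simp add: \<kappa>_def)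
  define n where "n = real CARD('n)"
  \<comment> \<open>The constant of the change of variables. \<open>K\<close> is twice this because
    of the factor 2 in the arsinh integral, which is why the pi term of the bound carries
    1/2.\<close>
  define V where "V = unit_ball_vol (real (CARD('n) - 1)) * C ^ (CARD('n) - 1) / m"
  have V: "V \<ge> 0" using pos by (simp add: V_def)
  have KV: "K C m = 2 * V" by (simp add: K_def V_def)
  define \<Lambda> where "\<Lambda> = \<mu> * (1 + max 0 (ln (\<kappa> * C / s)))"
  have \<Lambda>: "\<Lambda> \<ge> 0" using pos by (simp add: \<Lambda>_def)
  define S where "S = A - resonances A g"
  define N where "N = sup_norm A (fourier_coeff f k)"
  define N' where "N' j = sup_norm A (partial j (fourier_coeff f k))" for j
  define l where "l I = ennreal (?p I) * indicator A I" for I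
  define q where "q I = ennreal (?r I) * indicator A I" for I
  let ?L = "\<integral>\<^sup>+I. l I \<partial>lborel"
  let ?Q = "\<integral>\<^sup>+I. q I \<partial>lborel"
  let ?e = "ennreal (n * D * \<kappa>)"
  let ?E = "ennreal (2 * V * \<Lambda>)"
  let ?G = "ennreal (n * D * V * (\<mu> / s) * pi)"
  let ?t = "1/2 * n\<^sup>2 * pi * D * (\<mu> / s)"
  have den: "s\<^sup>2 + x\<^sup>2 > 0" for x :: real using pos by (simp add: add_pos_nonneg)
  note gp = diffeomorphism_on_props[OF g]
  have ca: "continuous_on A (\<lambda>I. ivec k \<bullet> g I)" by (intro continuous_intros gp(2))
  have lm [measurable]: "l \<in> borel_measurable lborel"
    unfolding l_def using den less_imp_neq[OF den]
    by (intro borel_measurable_ennreal_on_open A continuous_intros ca) auto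
  have qm [measurable]: "q \<in> borel_measurable lborel"
    unfolding q_def using den less_imp_neq[OF den]
    by (intro borel_measurable_ennreal_on_open A continuous_intros ca) auto
  \<comment> \<open>The factor 1 / \<kappa> is kept: it compensates the factor |k_j| \<le> \<kappa>
    of the angular derivatives.\<close>
  have L: "(?L) \<le> ennreal (2 * V / \<kappa> * \<Lambda>)"
  proof -
    have "(?L) \<le> ennreal V * (\<integral>\<^sup>+x\<in>{-C..C}. ennreal (\<mu> / sqrt (s\<^sup>2 + (\<kappa> * x)\<^sup>2)) \<partial>lborel)"
      unfolding l_def V_def \<kappa>_def using den less_imp_neq[OF den] pos
      by (intro nn_integral_resonant_direction[where \<psi> = "\<lambda>x. \<mu> / sqrt (s\<^sup>2 + x\<^sup>2)"] A gp C det continuous_intros) (auto simp: less_imp_le)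
    also have "\<dots> \<le> ennreal V * ennreal (2 / \<kappa> * \<Lambda>)"
      unfolding \<Lambda>_def using pos \<kappa> by (intro mult_left_mono nn_integral_inverse_sqrt) auto
    also have "\<dots> = ennreal (2 * V / \<kappa> * \<Lambda>)"
      using V \<kappa> \<Lambda> by (subst ennreal_mult[symmetric]) (auto simp: mult_ac)
    finally show ?thesis .
  qed
  have Q: "(?Q) \<le> ennreal (V * (\<mu> / (\<kappa> * s) * pi))"
  proof -
    have "(?Q) \<le> ennreal V * (\<integral>\<^sup>+x\<in>{-C..C}. ennreal (\<mu> / (s\<^sup>2 + (\<kappa> * x)\<^sup>2)) \<partial>lborel)"
      unfolding q_def V_def \<kappa>_def using den less_imp_neq[OF den] pos
      by (intro nn_integral_resonant_direction[where \<psi> = "\<lambda>x. \<mu> / (s\<^sup>2 + x\<^sup>2)"] A gp C det continuous_intros) (auto simp: less_imp_le)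
    also have "\<dots> \<le> ennreal V * ennreal (\<mu> / (\<kappa> * s) * pi)"
      using pos \<kappa> by (intro mult_left_mono nn_integral_inverse_square) auto
    also have "\<dots> = ennreal (V * (\<mu> / (\<kappa> * s) * pi))"
      using V \<kappa> pos by (subst ennreal_mult[symmetric]) auto
    finally show ?thesis .
  qed
  have nonres: "I \<in> A" "ivec k \<bullet> g I \<noteq> 0" if "I \<in> S" for I
    using that k by (auto simp: S_def resonances_def)
  have fc: "ennreal (cmod (?c I)) \<le> N" if "I \<in> A" for I
    unfolding N_def using that by (rule ennreal_norm_le_sup_norm)
  have coeff: "ennreal (cmod (?u I)) \<le> N * l I" if I: "I \<in> S" for I
  proof -
    have "cmod (?u I) = cmod (?c I) * (?p I)"
      using u[OF nonres(1)[OF I]] nonres(2)[OF I] pos by (simp add: norm_mult norm_disc_mult)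
    then have "ennreal (cmod (?u I))
        = ennreal (cmod (?c I)) * ennreal (?p I)"
      using pos by (simp only:) (intro ennreal_mult, auto)
    also have "\<dots> \<le> N * ennreal (?p I)"
      by (intro mult_right_mono fc nonres(1) I) simp
    finally show ?thesis using nonres(1)[OF I] by (simp add: l_def)
  qed
  \<comment> \<open>By the product rule, \<sigma> multiplies the derivative of f_k (weight
    \<open>l\<close>), and the derivative of \<sigma> multiplies f_k and a frequency derivative of
    size at most n D \<kappa> (weight \<open>q\<close>).\<close>
  have deriv: "ennreal (cmod (?pu j I)) \<le> N' j * l I + N * ?e * q I"
    if I: "I \<in> S" for I j
  proof -
    let ?a = "ivec k \<bullet> g I"
    note IA = nonres(1)[OF I]
    have "?pu j I
        = ?d j I * disc_mult \<mu> s ?a + ?c I * (of_real (?b j I) * disc_mult_deriv \<mu> s ?a)"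
      by (rule partial_average_coeff[OF A f g u disc_mult_deriv(1)[OF pos(5)] nonres[OF I]])
    then have "cmod (?pu j I)
        \<le> cmod (?d j I) * (?p I) + cmod (?c I) * (\<bar>?b j I\<bar> * (?r I))"
      using norm_triangle_ineq[of "?d j I * disc_mult \<mu> s ?a"
          "?c I * (of_real (?b j I) * disc_mult_deriv \<mu> s ?a)"] pos
      by (simp add: norm_mult norm_disc_mult norm_disc_mult_deriv)
    also have "\<dots> \<le> cmod (?d j I) * (?p I) + cmod (?c I) * ((n * D * \<kappa>) * (?r I))"
      using abs_freq_deriv_le[OF D[OF IA], of k j] pos den[of ?a]
      by (intro add_left_mono mult_left_mono mult_right_mono) (auto simp: n_def \<kappa>_def)
    finally have "ennreal (cmod (?pu j I))
        \<le> ennreal (cmod (?d j I) * (?p I) + cmod (?c I) * ((n * D * \<kappa>) * (?r I)))"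
      by (rule ennreal_leI)
    also have "\<dots> = ennreal (cmod (?d j I)) * ennreal (?p I)
        + ennreal (cmod (?c I)) * (?e * ennreal (?r I))"
    proof -
      have "0 \<le> n * D * \<kappa>" "0 \<le> ?r I" "0 \<le> ?p I"
        using pos \<kappa> by (auto simp: n_def)
      moreover have "ennreal (x * y + z * (v * w)) = ennreal x * ennreal y + ennreal z * (ennreal v * ennreal w)"
        if "0 \<le> x" "0 \<le> y" "0 \<le> z" "0 \<le> v" "0 \<le> w" for x y z v w :: real
        using that by (subst ennreal_plus) (auto simp: ennreal_mult)
      ultimately show ?thesis by (metis norm_ge_zero)
    qed
    also have "ennreal (cmod (?d j I)) = ennreal (cmod (partial j (fourier_coeff f k) I))"
      by (simp add: partial_coeff[OF A f IA])
    also have "ennreal (cmod (partial j (fourier_coeff f k) I)) * ennreal (?p I)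
        + ennreal (cmod (?c I)) * (?e * ennreal (?r I))
      \<le> N' j * ennreal (?p I) + N * (?e * ennreal (?r I))"
      unfolding N'_def by (intro add_mono mult_right_mono fc IA ennreal_norm_le_sup_norm) auto
    finally show ?thesis using IA by (simp add: l_def q_def mult.assoc)
  qed
  have kj: "\<bar>real_of_int (k $ j)\<bar> \<le> \<kappa>" for j
    using component_le_norm_cart[of "ivec k" j] by (simp add: ivec_def \<kappa>_def)
  have i1: "(\<integral>\<^sup>+I\<in>S. ennreal (cmod (?u I)) \<partial>lborel) \<le> N * ?E"
  proof -
    have "(\<integral>\<^sup>+I\<in>S. ennreal (cmod (?u I)) \<partial>lborel) \<le> (\<integral>\<^sup>+I. N * l I \<partial>lborel)"
      using coeff by (intro nn_integral_mono) (auto simp: indicator_def)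
    also have "\<dots> = N * (?L)" by (rule nn_integral_cmult) measurable
    also have "\<dots> \<le> N * ?E"
    proof (intro mult_left_mono order_trans[OF L] ennreal_leI)
      show "2 * V / \<kappa> * \<Lambda> \<le> 2 * V * \<Lambda>"
        using V \<kappa> \<Lambda> by (intro mult_right_mono) (auto simp: divide_le_eq mult_le_cancel_left1)
    qed simp
    finally show ?thesis .
  qed
  have i2: "(\<integral>\<^sup>+I\<in>S. ennreal (cmod (?pu j I) + cmod (?ku j I)) \<partial>lborel)
      \<le> (N' j + N) * ?E + N * ?G" for j
  proof -
    have "(\<integral>\<^sup>+I\<in>S. ennreal (cmod (?pu j I) + cmod (?ku j I)) \<partial>lborel)
       \<le> (\<integral>\<^sup>+I. (N' j * l I + N * ?e * q I) + N * ennreal \<kappa> * l I \<partial>lborel)"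
    proof (rule nn_integral_mono)
      fix I
      show "ennreal (cmod (?pu j I) + cmod (?ku j I)) * indicator S I
          \<le> (N' j * l I + N * ?e * q I) + N * ennreal \<kappa> * l I"
      proof (cases "I \<in> S")
        case True
        have "ennreal (cmod (?ku j I)) \<le> ennreal (\<kappa> * cmod (?u I))"
          unfolding norm_mult using kj[of j] by (intro ennreal_leI mult_right_mono) auto
        also have "\<dots> = ennreal \<kappa> * ennreal (cmod (?u I))"
          using \<kappa> by (intro ennreal_mult) auto
        also have "\<dots> \<le> ennreal \<kappa> * (N * l I)" by (intro mult_left_mono coeff True) simp
        finally have "ennreal (cmod (?ku j I)) \<le> N * ennreal \<kappa> * l I"
          by (simp add: mult_ac)
        then show ?thesis using deriv[OF True, of j] True by (simp add: ennreal_plus add_mono del: ennreal_plus[symmetric])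
      qed simp
    qed
    also have "\<dots> = N' j * (?L) + N * ?e * (?Q) + N * ennreal \<kappa> * (?L)"
      by (subst nn_integral_add; (subst nn_integral_add)?; (subst nn_integral_cmult)?; measurable?) (simp_all add: nn_integral_cmult)
    also have "\<dots> \<le> N' j * ?E + N * ?G + N * ?E"
    proof (intro add_mono)
      show "N' j * (?L) \<le> N' j * ?E"
      proof (intro mult_left_mono order_trans[OF L] ennreal_leI)
        show "2 * V / \<kappa> * \<Lambda> \<le> 2 * V * \<Lambda>"
          using V \<kappa> \<Lambda> by (intro mult_right_mono) (auto simp: divide_le_eq mult_le_cancel_left1)
      qed simp
      have "N * ?e * (?Q) \<le> N * ?e * ennreal (V * (\<mu> / (\<kappa> * s) * pi))"
        by (intro mult_left_mono Q) simp
      \<comment> \<open>The \<kappa> of the frequency derivative cancels the 1 / \<kappa> of the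
        arctan integral, so k survives only in s.\<close>
      also have "\<dots> = N * ?G"
      proof -
        have "?e * ennreal (V * (\<mu> / (\<kappa> * s) * pi)) = ennreal ((n * D * \<kappa>) * (V * (\<mu> / (\<kappa> * s) * pi)))"
          using pos \<kappa> V by (intro ennreal_mult[symmetric]) (auto simp: n_def)
        also have "(n * D * \<kappa>) * (V * (\<mu> / (\<kappa> * s) * pi)) = n * D * V * (\<mu> / s) * pi"
          using \<kappa> pos by (simp add: field_simps)
        finally show ?thesis by (simp add: mult.assoc)
      qed
      finally show "N * ?e * (?Q) \<le> N * ?G" .
      have "N * ennreal \<kappa> * (?L) \<le> N * ennreal \<kappa> * ennreal (2 * V / \<kappa> * \<Lambda>)"
        by (intro mult_left_mono L) simp
      also have "\<dots> = N * ?E"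
      proof -
        have "ennreal \<kappa> * ennreal (2 * V / \<kappa> * \<Lambda>) = ennreal (\<kappa> * (2 * V / \<kappa> * \<Lambda>))"
          using V \<kappa> \<Lambda> by (intro ennreal_mult[symmetric]) auto
        also have "\<kappa> * (2 * V / \<kappa> * \<Lambda>) = 2 * V * \<Lambda>" using \<kappa> by simp
        finally show ?thesis by (simp add: mult.assoc)
      qed
      finally show "N * ennreal \<kappa> * (?L) \<le> N * ?E" .
    qed
    finally show ?thesis by (simp add: distrib_right add_ac)
  qed
  have "(\<integral>\<^sup>+I\<in>S. ennreal (cmod (?u I)) \<partial>lborel)
      + (\<Sum>j\<in>UNIV. \<integral>\<^sup>+I\<in>S. ennreal (cmod (?pu j I) + cmod (?ku j I)) \<partial>lborel)
    \<le> N * ?E + (\<Sum>j\<in>(UNIV :: 'n set). (N' j + N) * ?E + N * ?G)"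
    by (intro add_mono i1 sum_mono i2)
  \<comment> \<open>The 1 + n copies of N: one from u_k itself, one from each k_j u_k.\<close>
  also have "\<dots> = ?E * (of_nat (1 + CARD('n)) * N + (\<Sum>j\<in>UNIV. N' j)) + N * (of_nat CARD('n) * ?G)"
    by (simp add: sum.distrib sum_distrib_right[symmetric] algebra_simps)
  also have "of_nat CARD('n) * ?G = ennreal (2 * V) * ennreal (?t)"
  proof -
    have "of_nat CARD('n) * ?G = ennreal (n * (n * D * V * (\<mu> / s) * pi))"
      unfolding ennreal_of_nat_eq_real_of_nat n_def[symmetric]
      using pos V by (intro ennreal_mult[symmetric]) (auto simp: n_def)
    also have "n * (n * D * V * (\<mu> / s) * pi) = (2 * V) * (?t)"
      by (simp add: power2_eq_square)
    also have "ennreal \<dots> = ennreal (2 * V) * ennreal (?t)"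
      using pos V by (intro ennreal_mult) auto
    finally show ?thesis .
  qed
  also have "?E = ennreal (2 * V) * ennreal \<Lambda>"
    using V \<Lambda> by (intro ennreal_mult) auto
  finally show ?thesis
    unfolding KV S_def N_def N'_def \<Lambda>_def \<kappa>_def n_def
    by (simp only: distrib_left mult_ac)
qed

lemma norm1_noisy_average_le:
  fixes f :: "(real^'n) \<times> (real^'n) \<Rightarrow> real" and g :: "real^'n \<Rightarrow> real^'n"
    and w :: "real \<Rightarrow> 'w \<Rightarrow> real^'n"
  assumes A: "open A" and f: "smooth_on (A \<times> UNIV) f" "angle_periodic_on A f" and g: "diffeomorphism_on A g"
    and pos: "C > 0" "D > 0" "m > 0" "\<mu> > 0" "\<nu> > 0"
    and C: "\<And>I. I \<in> A \<Longrightarrow> norm (g I) \<le> C"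
    and D: "\<And>I i j. I \<in> A \<Longrightarrow> \<bar>jacobian g (at I) $ i $ j\<bar> \<le> D"
    and det: "\<And>I. I \<in> A \<Longrightarrow> m \<le> \<bar>det (jacobian g (at I))\<bar>"
    and W: "wiener_process P w"
  shows "norm1 (A - resonances A g) (\<lambda>x. noisy_average P w g f \<mu> \<nu> x - limit_average g f x)
    \<le> noisy_average_bound A f C D m \<mu> \<nu>"
proof -
  define u where "u = (\<lambda>x. noisy_average P w g f \<mu> \<nu> x - limit_average g f x)"
  define S where "S = A - resonances A g"
  define s where "s k = \<mu> + \<nu> * (norm (ivec k))\<^sup>2" for k :: "int^'n"
  have s: "s k > 0" for k using pos by (simp add: s_def add_pos_nonneg)
  have coeff: "fourier_coeff u k I = fourier_coeff f k I * (disc_mult \<mu> (s k) (ivec k \<bullet> g I) - of_bool (ivec k \<bullet> g I = 0))"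
    if "I \<in> A" for k I
    unfolding u_def s_def by (rule noisy_average_coeff[OF f that pos(4,5) W])
  define G where "G k = (\<integral>\<^sup>+I\<in>S. ennreal (cmod (fourier_coeff u k I)) \<partial>lborel)
      + (\<Sum>j\<in>UNIV. \<integral>\<^sup>+I\<in>S. ennreal (cmod (partial j (fourier_coeff u k) I)
          + cmod (of_int (k $ j) * fourier_coeff u k I)) \<partial>lborel)" for k
  \<comment> \<open>For k = 0 there is no damping, and the multiplier \<mu> / \<mu> equals the
    indicator at a = 0. Hence the angular mean drops out and only k \<noteq> 0 contributes.\<close>
  have zero: "fourier_coeff u 0 I = 0" if "I \<in> A" for I
    using coeff[OF that, of 0] pos by (simp add: disc_mult_def s_def)
  have pzero: "partial j (fourier_coeff u 0) I = 0" if "I \<in> A" for I j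
  proof (rule partial_eqI)
    have oA: "open ((\<lambda>t. I + t *\<^sub>R axis j 1) -` A)" by (intro open_vimage A continuous_intros)
    show "((\<lambda>t. fourier_coeff u 0 (I + t *\<^sub>R axis j 1)) has_vector_derivative 0) (at 0)"
      by (rule has_vector_derivative_transform_within_open[OF has_vector_derivative_const[of 0] oA])
        (use that zero in auto)
  qed
  have z1: "ennreal (cmod (fourier_coeff u 0 I)) * indicator S I = 0" for I
    by (cases "I \<in> S") (auto simp: S_def zero)
  have z2: "ennreal (cmod (partial j (fourier_coeff u 0) I) + cmod (of_int (0 $ j) * fourier_coeff u 0 I)) * indicator S I = 0" for I j
    by (cases "I \<in> S") (auto simp: S_def zero pzero)
  have G0: "G 0 = 0" unfolding G_def z1 z2 by simp
  have "norm1 S u = (\<Sum>\<^sub>\<infinity>k\<in>UNIV. G k)"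
    unfolding norm1_def G_def by (rule infsum_add[symmetric]) (auto intro: nonneg_summable_on_complete)
  also have "\<dots> = (\<Sum>\<^sub>\<infinity>k\<in>- {0}. G k)"
    by (rule infsum_cong_neutral) (auto simp: G0)
  also have "\<dots> \<le> noisy_average_bound A f C D m \<mu> \<nu>"
    unfolding noisy_average_bound_def infsum_cmult_ennreal[symmetric]
  proof (rule infsum_mono)
    fix k :: "int^'n" assume "k \<in> - {0}"
    then have "k \<noteq> 0" by simp
    from harmonic_norm_le[OF A f(1) g pos(1-4) s C D det this coeff]
    show "G k \<le> ennreal (2 * (unit_ball_vol (real (CARD('n) - 1)) * C ^ (CARD('n) - 1)) / m) *
        (ennreal (\<mu> * (1 + max 0 (ln (norm (ivec k) * C / (\<mu> + \<nu> * (norm (ivec k))\<^sup>2)))))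
          * (of_nat (1 + CARD('n)) * sup_norm A (fourier_coeff f k)
             + (\<Sum>j\<in>UNIV. sup_norm A (partial j (fourier_coeff f k))))
        + ennreal (1/2 * (real CARD('n))\<^sup>2 * pi * D * (\<mu> / (\<mu> + \<nu> * (norm (ivec k))\<^sup>2)))
          * sup_norm A (fourier_coeff f k))"
      by (simp add: G_def S_def s_def)
  qed (auto intro: nonneg_summable_on_complete)
  finally show ?thesis by (simp add: u_def S_def)
qed

text \<open>Separates the parameters from f: the logarithm and \<mu> / s are bounded uniformly in k,
  which leaves a scalar times a series that does not depend on \<mu> and \<nu>.\<close>

lemma noisy_average_bound_le:
  fixes f :: "(real^'n) \<times> (real^'n) \<Rightarrow> real"
  assumes pos: "C > 0" "D > 0" "m > 0" "\<mu> > 0" "\<nu> > 0"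
  shows "noisy_average_bound A f C D m \<mu> \<nu>
    \<le> ennreal (2 * (unit_ball_vol (real (CARD('n) - 1)) * C ^ (CARD('n) - 1)) / m) *
      (ennreal ((1 + real CARD('n)) * (\<mu> + C * (\<mu> / \<nu>)) + 1/2 * (real CARD('n))\<^sup>2 * pi * D * (\<mu> / \<nu>)) *
      (\<Sum>\<^sub>\<infinity>k\<in>- {0}. sup_norm A (fourier_coeff f k) + (\<Sum>j\<in>UNIV. sup_norm A (partial j (fourier_coeff f k)))))"
  unfolding noisy_average_bound_def infsum_cmult_ennreal[symmetric, of "ennreal (_ + _)"]
proof (intro mult_left_mono infsum_mono)
  fix k :: "int^'n" assume "k \<in> - {0}"
  then have k: "norm (ivec k) \<ge> 1" by (intro norm_ivec_ge_1) simp
  define \<kappa> where "\<kappa> = norm (ivec k)"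
  define n where "n = real CARD('n)"
  define N where "N = sup_norm A (fourier_coeff f k)"
  define N' where "N' = (\<Sum>j\<in>UNIV. sup_norm A (partial j (fourier_coeff f k)))"
  let ?s = "\<mu> + \<nu> * \<kappa>\<^sup>2"
  let ?t = "1/2 * n\<^sup>2 * pi * D * (\<mu> / \<nu>)"
  let ?q = "\<mu> * (1 + C / \<nu>)"
  have \<kappa>: "\<kappa> \<ge> 1" using k by (simp add: \<kappa>_def)
  have den: "\<nu> * \<kappa> \<le> ?s" "\<nu> \<le> ?s" "?s > 0"
  proof -
    have "\<kappa> \<le> \<kappa>\<^sup>2" using \<kappa> by (simp add: power2_eq_square)
    then have "\<nu> * \<kappa> \<le> \<nu> * \<kappa>\<^sup>2" using pos by simp
    moreover have "\<nu> * 1 \<le> \<nu> * \<kappa>" using \<kappa> pos by (intro mult_left_mono) auto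
    ultimately show "\<nu> * \<kappa> \<le> ?s" "\<nu> \<le> ?s" "?s > 0" using pos by linarith+
  qed
  have "\<kappa> * C / (?s) \<le> \<kappa> * C / (\<nu> * \<kappa>)"
    using den \<kappa> pos by (intro divide_left_mono) auto
  then have r: "\<kappa> * C / (?s) \<le> C / \<nu>" using \<kappa> by simp
  \<comment> \<open>Uses ln x \<le> x for x = \<kappa> C / s; the \<kappa> cancels because s \<ge>
    \<nu> \<kappa>^2 \<ge> \<nu> \<kappa>.\<close>
  have "max 0 (ln (\<kappa> * C / (?s))) \<le> C / \<nu>"
    using ln_bound[of "\<kappa> * C / (?s)"] r den \<kappa> pos by auto
  then have 1: "\<mu> * (1 + max 0 (ln (\<kappa> * C / (?s)))) \<le> ?q"
    using pos by (intro mult_left_mono) auto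
  have "\<mu> / (?s) \<le> \<mu> / \<nu>"
    using den pos by (intro divide_left_mono) auto
  then have 2: "1/2 * n\<^sup>2 * pi * D * (\<mu> / (?s)) \<le> ?t"
    using pos by (intro mult_left_mono) auto
  \<comment> \<open>The derivative terms are given the factor 1 + n as well, so that the common sum
    N + N' factors out.\<close>
  have "of_nat (1 + CARD('n)) * N + N' \<le> of_nat (1 + CARD('n)) * (N + N')"
    by (simp add: distrib_left distrib_right add_mono add_increasing2)
  then have "ennreal (\<mu> * (1 + max 0 (ln (\<kappa> * C / (?s))))) * (of_nat (1 + CARD('n)) * N + N')
        + ennreal (1/2 * n\<^sup>2 * pi * D * (\<mu> / (?s))) * N
     \<le> ennreal (?q) * (of_nat (1 + CARD('n)) * (N + N')) + ennreal (?t) * (N + N')"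
    by (intro add_mono mult_mono ennreal_leI 1 2) auto
  also have "\<dots> = (ennreal (?q) * ennreal (1 + n) + ennreal (?t)) * (N + N')"
    unfolding ennreal_of_nat_eq_real_of_nat n_def by (simp add: distrib_right mult.assoc)
  also have "ennreal (?q) * ennreal (1 + n) + ennreal (?t)
     = ennreal ((1 + n) * (\<mu> + C * (\<mu> / \<nu>)) + ?t)"
  proof -
    have "ennreal (?q) * ennreal (1 + n) = ennreal (?q * (1 + n))"
      using pos by (intro ennreal_mult[symmetric]) (auto simp: n_def)
    also have "?q * (1 + n) = (1 + n) * (\<mu> + C * (\<mu> / \<nu>))"
      by (simp add: algebra_simps)
    finally show ?thesis using pos by (subst ennreal_plus) (auto simp: n_def)
  qed
  finally show "ennreal (\<mu> * (1 + max 0 (ln (norm (ivec k) * C / (\<mu> + \<nu> * (norm (ivec k))\<^sup>2)))))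
          * (of_nat (1 + CARD('n)) * sup_norm A (fourier_coeff f k)
             + (\<Sum>j\<in>UNIV. sup_norm A (partial j (fourier_coeff f k))))
        + ennreal (1/2 * (real CARD('n))\<^sup>2 * pi * D * (\<mu> / (\<mu> + \<nu> * (norm (ivec k))\<^sup>2)))
          * sup_norm A (fourier_coeff f k)
      \<le> ennreal ((1 + real CARD('n)) * (\<mu> + C * (\<mu> / \<nu>)) + 1/2 * (real CARD('n))\<^sup>2 * pi * D * (\<mu> / \<nu>)) *
        (sup_norm A (fourier_coeff f k) + (\<Sum>j\<in>UNIV. sup_norm A (partial j (fourier_coeff f k))))"
    by (simp add: \<kappa>_def n_def N_def N'_def)
qed (auto intro: nonneg_summable_on_complete)

text \<open>The separated bound reduces the limit of a series to the limit of a scalar, without an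
  exchange of limit and sum.\<close>

lemma noisy_average_bound_tendsto_0:
  fixes f :: "(real^'n) \<times> (real^'n) \<Rightarrow> real" and \<mu>s \<nu>s :: "nat \<Rightarrow> real"
  assumes pos: "C > 0" "D > 0" "m > 0" "\<And>i. \<mu>s i > 0" "\<And>i. \<nu>s i > 0"
    and lim: "\<mu>s \<longlonglongrightarrow> 0" "(\<lambda>i. \<mu>s i / \<nu>s i) \<longlonglongrightarrow> 0"
    and fin: "(\<Sum>\<^sub>\<infinity>k\<in>- {0}. sup_norm A (fourier_coeff f k)
                        + (\<Sum>j\<in>UNIV. sup_norm A (partial j (fourier_coeff f k)))) < \<infinity>"
  shows "(\<lambda>i. noisy_average_bound A f C D m (\<mu>s i) (\<nu>s i)) \<longlonglongrightarrow> 0"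
proof -
  define K where "K = 2 * (unit_ball_vol (real (CARD('n) - 1)) * C ^ (CARD('n) - 1)) / m"
  obtain R where R: "R \<ge> 0" "(\<Sum>\<^sub>\<infinity>k\<in>- {0}. sup_norm A (fourier_coeff f k)
                        + (\<Sum>j\<in>UNIV. sup_norm A (partial j (fourier_coeff f k)))) = ennreal R"
    using fin by (cases "\<Sum>\<^sub>\<infinity>k\<in>- {0}. sup_norm A (fourier_coeff f k)
                        + (\<Sum>j\<in>UNIV. sup_norm A (partial j (fourier_coeff f k)))") auto
  define E where "E i = (1 + real CARD('n)) * (\<mu>s i + C * (\<mu>s i / \<nu>s i)) + 1/2 * (real CARD('n))\<^sup>2 * pi * D * (\<mu>s i / \<nu>s i)" for i
  have "E \<longlonglongrightarrow> (1 + real CARD('n)) * (0 + C * 0) + 1/2 * (real CARD('n))\<^sup>2 * pi * D * 0"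
    unfolding E_def by (intro tendsto_intros lim)
  then have "(\<lambda>i. K * (E i * R)) \<longlonglongrightarrow> K * (0 * R)"
    by (intro tendsto_intros) simp
  then have lim0: "(\<lambda>i. ennreal (K * (E i * R))) \<longlonglongrightarrow> 0"
    using tendsto_ennrealI by fastforce
  have le: "noisy_average_bound A f C D m (\<mu>s i) (\<nu>s i) \<le> ennreal (K * (E i * R))" for i
  proof -
    have "E i \<ge> 0" "K \<ge> 0" using pos(1-3) pos(4,5)[of i] by (auto simp: E_def K_def)
    then have "ennreal (K * (E i * R)) = ennreal K * (ennreal (E i) * ennreal R)"
      using R(1) by (simp add: ennreal_mult)
    then show ?thesis
      using noisy_average_bound_le[OF pos(1-3) pos(4,5), of A f i i] by (simp add: R(2) K_def E_def)
  qed
  show ?thesis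
    by (rule tendsto_sandwich[OF _ _ tendsto_const lim0]) (simp_all add: le)
qed

theorem proposition2p2:
  fixes A :: "(real^'n) set"
    and h :: "real^'n \<Rightarrow> real"
    and g :: "real^'n \<Rightarrow> real^'n"
    and f :: "(real^'n) \<times> (real^'n) \<Rightarrow> real"
    and C D m Lip :: real
    and P :: "'w measure"
    and w :: "real \<Rightarrow> 'w \<Rightarrow> real^'n"
  assumes "open A" and "bounded A"
    and "C > 0" and "D > 0" and "m > 0" and "Lip > 0"
    and "\<forall>I\<in>A. GDERIV h I :> g I"
    and "diffeomorphism_on A g"
    and "\<forall>I\<in>A. norm (g I) \<le> C"
    and "\<forall>I\<in>A. \<forall>i j. \<bar>jacobian g (at I) $ i $ j\<bar> \<le> D"
    and "\<forall>I\<in>A. \<bar>det (jacobian g (at I))\<bar> \<ge> m"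
    and "Lip-lipschitz_on A g"
    and "smooth_on (A \<times> UNIV) f"
    and "angle_periodic_on A f"
    and "A \<subseteq> closure (active_resonances A g f)"
  shows
    "(\<forall>B. open B \<and> B \<noteq> {} \<and> B \<subseteq> A \<longrightarrow>
        \<not> ((\<lambda>T. norm1 (B - resonances A g)
              (\<lambda>x. time_average g f T x - limit_average g f x)) \<longlongrightarrow> 0) at_top \<and>
        \<not> ((\<lambda>\<mu>. norm1 (B - resonances A g)
              (\<lambda>x. discounted_average g f \<mu> x - limit_average g f x)) \<longlongrightarrow> 0) (at_right 0))
   \<and> (wiener_process P w \<longrightarrow>
        (\<forall>\<mu> \<nu>. \<mu> > 0 \<and> \<nu> > 0 \<longrightarrow>
           norm1 (A - resonances A g)
             (\<lambda>x. noisy_average P w g f \<mu> \<nu> x - limit_average g f x)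
           \<le> noisy_average_bound A f C D m \<mu> \<nu>)
      \<and> ((\<Sum>\<^sub>\<infinity>k\<in>- {0}. sup_norm A (fourier_coeff f k)
                        + (\<Sum>j\<in>UNIV. sup_norm A (partial j (fourier_coeff f k)))) < \<infinity> \<longrightarrow>
         (\<forall>(\<mu>s::nat \<Rightarrow> real) \<nu>s.
            (\<forall>i. \<mu>s i > 0) \<and> (\<forall>i. \<nu>s i > 0) \<and>
            \<mu>s \<longlonglongrightarrow> 0 \<and> \<nu>s \<longlonglongrightarrow> 0 \<and> (\<lambda>i. \<mu>s i / \<nu>s i) \<longlonglongrightarrow> 0 \<longrightarrow>
            (\<lambda>i. norm1 (A - resonances A g)
               (\<lambda>x. noisy_average P w g f (\<mu>s i) (\<nu>s i) x - limit_average g f x))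
            \<longlonglongrightarrow> 0)))"
proof -
  have A: "open A" and pos: "C > 0" "D > 0" "m > 0" and g: "diffeomorphism_on A g"
    and f: "smooth_on (A \<times> UNIV) f" "angle_periodic_on A f"
    and dense: "A \<subseteq> closure (active_resonances A g f)" by fact+
  have C: "\<And>I. I \<in> A \<Longrightarrow> norm (g I) \<le> C"
    and D: "\<And>I i j. I \<in> A \<Longrightarrow> \<bar>jacobian g (at I) $ i $ j\<bar> \<le> D"
    and det: "\<And>I. I \<in> A \<Longrightarrow> m \<le> \<bar>det (jacobian g (at I))\<bar>" using assms by blast+
  have det0: "\<And>I. I \<in> A \<Longrightarrow> det (jacobian g (at I)) \<noteq> 0" using det pos(3) by fastforce
  \<comment> \<open>The multiplier formulas hold for T > 0, which is eventually true as T tends to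
    infinity; hence the admissible set \<open>{0<..}\<close>.\<close>
  have not_time: "\<not> ((\<lambda>T. norm1 (B - resonances A g)
      (\<lambda>x. time_average g f T x - limit_average g f x)) \<longlongrightarrow> 0) at_top"
    if "open B" "B \<noteq> {}" "B \<subseteq> A" for B
  proof (rule norm1_not_tendsto_0[OF A f(1) g det0 dense that, where X = "{0<..}" and \<sigma> = time_mult
        and \<sigma>' = "\<lambda>T a. (1 / T) *\<^sub>R integral {0..T} (\<lambda>t. \<i> * complex_of_real t * cis (t * a))"])
    show "\<forall>\<^sub>F T in at_top. T \<in> {0::real<..}" using eventually_gt_at_top[of 0] by simp
  qed (simp_all add: time_average_coeff[OF f] time_mult_deriv time_mult_0 time_mult_decay)
  have not_disc: "\<not> ((\<lambda>\<mu>. norm1 (B - resonances A g)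
      (\<lambda>x. discounted_average g f \<mu> x - limit_average g f x)) \<longlongrightarrow> 0) (at_right 0)"
    if "open B" "B \<noteq> {}" "B \<subseteq> A" for B
  proof (rule norm1_not_tendsto_0[OF A f(1) g det0 dense that, where X = "{0<..}" and \<sigma> = "\<lambda>\<mu>. disc_mult \<mu> \<mu>"
        and \<sigma>' = "\<lambda>\<mu>. disc_mult_deriv \<mu> \<mu>"])
    show "\<forall>\<^sub>F \<mu> in at_right 0. \<mu> \<in> {0::real<..}" by (simp add: eventually_at_right_less)
    show "disc_mult \<mu> \<mu> 0 = 1" if "\<mu> \<in> {0<..}" for \<mu> using that by (simp add: disc_mult_def)
  qed (simp_all add: discounted_average_coeff[OF f] disc_mult_deriv disc_mult_decay)
  have bound: "norm1 (A - resonances A g) (\<lambda>x. noisy_average P w g f \<mu> \<nu> x - limit_average g f x)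
      \<le> noisy_average_bound A f C D m \<mu> \<nu>" if "wiener_process P w" "\<mu> > 0" "\<nu> > 0" for \<mu> \<nu>
    by (rule norm1_noisy_average_le[OF A f g pos that(2,3) C D det that(1)])
  have limit: "(\<lambda>i. norm1 (A - resonances A g)
      (\<lambda>x. noisy_average P w g f (\<mu>s i) (\<nu>s i) x - limit_average g f x)) \<longlonglongrightarrow> 0"
    if "wiener_process P w"
      and "(\<Sum>\<^sub>\<infinity>k\<in>- {0}. sup_norm A (fourier_coeff f k)
                        + (\<Sum>j\<in>UNIV. sup_norm A (partial j (fourier_coeff f k)))) < \<infinity>"
      and "\<And>i. \<mu>s i > 0" "\<And>i. \<nu>s i > 0" "\<mu>s \<longlonglongrightarrow> 0" "(\<lambda>i. \<mu>s i / \<nu>s i) \<longlonglongrightarrow> 0" for \<mu>s \<nu>s :: "nat \<Rightarrow> real"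
  proof (rule tendsto_sandwich[OF _ _ tendsto_const])
    show "(\<lambda>i. noisy_average_bound A f C D m (\<mu>s i) (\<nu>s i)) \<longlonglongrightarrow> 0"
      by (rule noisy_average_bound_tendsto_0[OF pos that(3-6,2)])
    show "\<forall>\<^sub>F i in sequentially. norm1 (A - resonances A g)
        (\<lambda>x. noisy_average P w g f (\<mu>s i) (\<nu>s i) x - limit_average g f x) \<le> noisy_average_bound A f C D m (\<mu>s i) (\<nu>s i)"
      using bound that by simp
  qed simp
  show ?thesis using not_time not_disc bound limit by blast
qed

end
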